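(* Let $\mathfrak g$ be a semisimple Lie algebra over an algebraically closed field $\Bbbk$ of characteristic $0$, and let $\sigma_1,\sigma_2$ be involutions of $\mathfrak g$ forming a dyad; put $\sigma_3=\sigma_1\sigma_2$. For $i,j\in\{0,1\}$ let $\mathfrak g_{ij}=\{x\in\mathfrak g:\sigma_1(x)=(-1)^ix,\ \sigma_2(x)=(-1)^jx\}$. Then every Cartan subspace $\mathfrak c_{11}$ of $\mathfrak g_{11}$ is also a Cartan subspace of $\mathfrak g_{10}\oplus\mathfrak g_{11}$ (the $(-1)$-eigenspace of $\sigma_1$) and of $\mathfrak g_{01}\oplus\mathfrak g_{11}$ (the $(-1)$-eigenspace of $\sigma_2$).
   Context: $\mathfrak g=\operatorname{Lie}(G)$ with $G$ a connected semisimple algebraic group; involutions of $\mathfrak g$ are assumed induced by involutions of $G$. Two involutions are conjugate if they lie in the same orbit of the group $\operatorname{Int}(G)$ of inner automorphisms acting by conjugation. A dyad is a pair of different, commuting, conjugate involutions. For an involution $\sigma$ of a reductive Lie algebra $\mathfrak h=\mathfrak h_0\oplus\mathfrak h_1$ ($\mathfrak h_i$ the $(-1)^i$-eigenspace), a Cartan subspace of $\mathfrak h_1$ is a maximal subspace of $\mathfrak h_1$ consisting of pairwise commuting semisimple elements; $\mathfrak g_{11}$ is the $(-1)$-eigenspace of the involution induced by $\sigma_1$ on $\mathfrak g^{\sigma_3}=\mathfrak g_{00}\oplus\mathfrak g_{11}$. *)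

theory Defs
  imports Main "HOL-Computational_Algebra.Polynomial"
begin

definition alg_closed :: "'k::field itself \<Rightarrow> bool" where
  "alg_closed _ \<longleftrightarrow> (\<forall>p::'k poly. degree p > 0 \<longrightarrow> (\<exists>x. poly p x = 0))"

definition lie_algebra :: "('k::field \<Rightarrow> 'g::ab_group_add \<Rightarrow> 'g) \<Rightarrow> ('g \<Rightarrow> 'g \<Rightarrow> 'g) \<Rightarrow> bool" where
  "lie_algebra scl br \<longleftrightarrow> vector_space scl
     \<and> (\<forall>x y z. br (x + y) z = br x z + br y z)
     \<and> (\<forall>x y z. br x (y + z) = br x y + br x z)
     \<and> (\<forall>a x y. br (scl a x) y = scl a (br x y))
     \<and> (\<forall>a x y. br x (scl a y) = scl a (br x y))
     \<and> (\<forall>x. br x x = 0)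
     \<and> (\<forall>x y z. br x (br y z) + br y (br z x) + br z (br x y) = 0)"

definition finite_dim :: "('k::field \<Rightarrow> 'g::ab_group_add \<Rightarrow> 'g) \<Rightarrow> bool" where
  "finite_dim scl \<longleftrightarrow> (\<exists>B. finite B \<and> module.span scl B = UNIV)"

definition lie_ideal :: "('k::field \<Rightarrow> 'g::ab_group_add \<Rightarrow> 'g) \<Rightarrow> ('g \<Rightarrow> 'g \<Rightarrow> 'g) \<Rightarrow> 'g set \<Rightarrow> bool" where
  "lie_ideal scl br I \<longleftrightarrow> module.subspace scl I \<and> (\<forall>x y. y \<in> I \<longrightarrow> br x y \<in> I)"

fun derived :: "('k::field \<Rightarrow> 'g::ab_group_add \<Rightarrow> 'g) \<Rightarrow> ('g \<Rightarrow> 'g \<Rightarrow> 'g) \<Rightarrow> 'g set \<Rightarrow> nat \<Rightarrow> 'g set" where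
  "derived scl br I 0 = I"
| "derived scl br I (Suc n) =
     module.span scl {br x y | x y. x \<in> derived scl br I n \<and> y \<in> derived scl br I n}"

definition solvable :: "('k::field \<Rightarrow> 'g::ab_group_add \<Rightarrow> 'g) \<Rightarrow> ('g \<Rightarrow> 'g \<Rightarrow> 'g) \<Rightarrow> 'g set \<Rightarrow> bool" where
  "solvable scl br I \<longleftrightarrow> (\<exists>n. derived scl br I n = {0})"

definition semisimple_lie_algebra :: "('k::field \<Rightarrow> 'g::ab_group_add \<Rightarrow> 'g) \<Rightarrow> ('g \<Rightarrow> 'g \<Rightarrow> 'g) \<Rightarrow> bool" where
  "semisimple_lie_algebra scl br \<longleftrightarrow> lie_algebra scl br \<and> finite_dim scl
     \<and> (\<forall>I. lie_ideal scl br I \<and> solvable scl br I \<longrightarrow> I = {0})"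

definition lie_aut :: "('k::field \<Rightarrow> 'g::ab_group_add \<Rightarrow> 'g) \<Rightarrow> ('g \<Rightarrow> 'g \<Rightarrow> 'g) \<Rightarrow> ('g \<Rightarrow> 'g) \<Rightarrow> bool" where
  "lie_aut scl br \<phi> \<longleftrightarrow> bij \<phi>
     \<and> (\<forall>x y. \<phi> (x + y) = \<phi> x + \<phi> y) \<and> (\<forall>a x. \<phi> (scl a x) = scl a (\<phi> x))
     \<and> (\<forall>x y. \<phi> (br x y) = br (\<phi> x) (\<phi> y))"

definition involution :: "('k::field \<Rightarrow> 'g::ab_group_add \<Rightarrow> 'g) \<Rightarrow> ('g \<Rightarrow> 'g \<Rightarrow> 'g) \<Rightarrow> ('g \<Rightarrow> 'g) \<Rightarrow> bool" where
  "involution scl br \<sigma> \<longleftrightarrow> lie_aut scl br \<sigma> \<and> \<sigma> \<circ> \<sigma> = id \<and> \<sigma> \<noteq> id"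

definition ad_nilpotent :: "('g::ab_group_add \<Rightarrow> 'g \<Rightarrow> 'g) \<Rightarrow> 'g \<Rightarrow> bool" where
  "ad_nilpotent br x \<longleftrightarrow> (\<exists>m. \<forall>y. (br x ^^ m) y = 0)"

definition exp_ad :: "('k::field_char_0 \<Rightarrow> 'g::ab_group_add \<Rightarrow> 'g) \<Rightarrow> ('g \<Rightarrow> 'g \<Rightarrow> 'g) \<Rightarrow> 'g \<Rightarrow> 'g \<Rightarrow> 'g" where
  "exp_ad scl br x y =
     (\<Sum>n < (LEAST m. \<forall>z. (br x ^^ m) z = 0). scl (1 / of_nat (fact n)) ((br x ^^ n) y))"

text \<open>The group Int(g) = Ad(G) of inner automorphisms: generated by exp(ad x), x ad-nilpotent.\<close>
inductive_set inner_auts :: "('k::field_char_0 \<Rightarrow> 'g::ab_group_add \<Rightarrow> 'g) \<Rightarrow> ('g \<Rightarrow> 'g \<Rightarrow> 'g) \<Rightarrow> ('g \<Rightarrow> 'g) set"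
  for scl br where
  id: "id \<in> inner_auts scl br"
| step: "\<phi> \<in> inner_auts scl br \<Longrightarrow> ad_nilpotent br x \<Longrightarrow> exp_ad scl br x \<circ> \<phi> \<in> inner_auts scl br"

definition conjugate_inv :: "('k::field_char_0 \<Rightarrow> 'g::ab_group_add \<Rightarrow> 'g) \<Rightarrow> ('g \<Rightarrow> 'g \<Rightarrow> 'g) \<Rightarrow> ('g \<Rightarrow> 'g) \<Rightarrow> ('g \<Rightarrow> 'g) \<Rightarrow> bool" where
  "conjugate_inv scl br \<sigma> \<tau> \<longleftrightarrow> (\<exists>\<phi>\<in>inner_auts scl br. \<tau> \<circ> \<phi> = \<phi> \<circ> \<sigma>)"

definition dyad :: "('k::field_char_0 \<Rightarrow> 'g::ab_group_add \<Rightarrow> 'g) \<Rightarrow> ('g \<Rightarrow> 'g \<Rightarrow> 'g) \<Rightarrow> ('g \<Rightarrow> 'g) \<Rightarrow> ('g \<Rightarrow> 'g) \<Rightarrow> bool" where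
  "dyad scl br \<sigma>1 \<sigma>2 \<longleftrightarrow> involution scl br \<sigma>1 \<and> involution scl br \<sigma>2 \<and> \<sigma>1 \<noteq> \<sigma>2
     \<and> \<sigma>1 \<circ> \<sigma>2 = \<sigma>2 \<circ> \<sigma>1 \<and> conjugate_inv scl br \<sigma>1 \<sigma>2"

definition semisimple_elem :: "('k::field \<Rightarrow> 'g::ab_group_add \<Rightarrow> 'g) \<Rightarrow> ('g \<Rightarrow> 'g \<Rightarrow> 'g) \<Rightarrow> 'g \<Rightarrow> bool" where
  "semisimple_elem scl br x \<longleftrightarrow> module.span scl {y. \<exists>c. br x y = scl c y} = UNIV"

definition commuting_semisimple_subspace :: "('k::field \<Rightarrow> 'g::ab_group_add \<Rightarrow> 'g) \<Rightarrow> ('g \<Rightarrow> 'g \<Rightarrow> 'g) \<Rightarrow> 'g set \<Rightarrow> 'g set \<Rightarrow> bool" where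
  "commuting_semisimple_subspace scl br V c \<longleftrightarrow> module.subspace scl c \<and> c \<subseteq> V
     \<and> (\<forall>x\<in>c. semisimple_elem scl br x) \<and> (\<forall>x\<in>c. \<forall>y\<in>c. br x y = 0)"

definition cartan_subspace :: "('k::field \<Rightarrow> 'g::ab_group_add \<Rightarrow> 'g) \<Rightarrow> ('g \<Rightarrow> 'g \<Rightarrow> 'g) \<Rightarrow> 'g set \<Rightarrow> 'g set \<Rightarrow> bool" where
  "cartan_subspace scl br V c \<longleftrightarrow> commuting_semisimple_subspace scl br V c
     \<and> (\<forall>c'. commuting_semisimple_subspace scl br V c' \<and> c \<subseteq> c' \<longrightarrow> c' = c)"

definition gij :: "('g::ab_group_add \<Rightarrow> 'g) \<Rightarrow> ('g \<Rightarrow> 'g) \<Rightarrow> nat \<Rightarrow> nat \<Rightarrow> 'g set" where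
  "gij \<sigma>1 \<sigma>2 i j = {x. \<sigma>1 x = (if i = 0 then x else - x) \<and> \<sigma>2 x = (if j = 0 then x else - x)}"

end

(* Let B be the Killing form and suppose that z lies in a commuting semisimple subspace of the
   (-1)-eigenspace of \<sigma>1 that contains c11.  Since c11 is its own centraliser in g11, it suffices
   to show y = 0 for the \<sigma>2-fixed component y of z.  Choose x in c11 with the same centraliser as
   c11, and order the joint weights of x and y by a rational functional in which x dominates.  Let
   Q be the sum of the nonnegative weight spaces, F the sum of the weight spaces above a threshold
   and K the fixed points of \<sigma>2.  Then F is Q-stable and g = K + Q, because \<sigma>2 flips the sign
   of a weight unless its weight vectors are fixed by \<sigma>2.

   The form B(v, \<sigma>2 w) is K-invariant, so its Gram determinant on a translate of F is a function on
   Int(G) that is left K-invariant and right Q-semi-invariant; if it vanished at the identity it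
   would vanish identically.  But for \<sigma>2 = \<phi> \<sigma>1 \<phi>^-1 it takes the same value at \<phi> as the Gram
   determinant of B(v, \<sigma>1 w) on F, which is not zero since \<sigma>1 negates all weights.  Hence it is
   nonzero at the identity, and as y lies in both K and Q, its trace on F must vanish.  Varying the
   threshold shows that all eigenvalues of y are zero.

   The second assertion follows by exchanging \<sigma>1 and \<sigma>2 and inverting \<phi>. *)
theory Submission
  imports Defs "HOL-Combinatorics.Permutations" "HOL-Library.Function_Algebras"
begin

section \<open>Linear algebra and traces\<close>

text \<open>Density of KQ in the group is replaced by algebra. A function on Int(G) is written as g
  |-> \<open>\<Theta>\<close>(g u), with \<open>\<Theta>\<close> multilinear in finitely many slots
  and u a fixed family of vectors. Its Taylor coefficients at the identity are the values at u of
  iterated derivatives of \<open>\<Theta>\<close>. Exponentials of ad-nilpotent elements are finite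
  sums, so once all these coefficients vanish, the function vanishes on every product of such
  exponentials.

  The Gram determinant has a basis of F in its rows and the dual basis under B(v,
  \<open>\<sigma>1\<close> w) in its columns. The dual basis spans F as well, because x and y are
  self-adjoint for that form, and it makes the determinant at \<open>\<phi>\<close> equal to 1.

  The field carries no order. Signs of weights are read off through a Q-linear map to the rationals
  that is nonzero on the nonzero eigenvalues of ad x and ad y. On one level of the combined
  functional the image of the y-weight is constant, so a vanishing trace on that level forces this
  image to be zero.\<close>

locale fd_space = finite_dimensional_vector_space scl Basis
  for scl :: "'k::field_char_0 \<Rightarrow> 'g::ab_group_add \<Rightarrow> 'g" and Basis :: "'g set"
begin

definition lin :: "('g \<Rightarrow> 'g) \<Rightarrow> bool" where
  "lin T \<longleftrightarrow> (\<forall>x y. T (x + y) = T x + T y) \<and> (\<forall>c x. T (scl c x) = scl c (T x))"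

definition linf :: "('g \<Rightarrow> 'k) \<Rightarrow> bool" where
  "linf l \<longleftrightarrow> (\<forall>x y. l (x + y) = l x + l y) \<and> (\<forall>c x. l (scl c x) = c * l x)"

lemma lin_linear: "lin T \<longleftrightarrow> Vector_Spaces.linear scl scl T"
  unfolding lin_def Vector_Spaces.linear_iff using vector_space_axioms by blast

lemma linI: "(\<And>x y. T (x + y) = T x + T y) \<Longrightarrow> (\<And>c x. T (scl c x) = scl c (T x)) \<Longrightarrow> lin T"
  by (simp add: lin_def)

lemma linfI: "(\<And>x y. l (x + y) = l x + l y) \<Longrightarrow> (\<And>c x. l (scl c x) = c * l x) \<Longrightarrow> linf l"
  by (simp add: linf_def)

context fixes T assumes T: "lin T" begin

lemma lin_add: "T (x + y) = T x + T y" using T by (simp add: lin_def)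
lemma lin_scl: "T (scl c x) = scl c (T x)" using T by (simp add: lin_def)
lemma lin_0: "T 0 = 0" using lin_scl[of 0 0] by simp
lemma lin_neg: "T (- x) = - T x" using lin_scl[of "-1" x] by simp
lemma lin_diff: "T (x - y) = T x - T y"
  using lin_add[of x "-y"] lin_neg by simp
lemma lin_sum: "T (sum h I) = (\<Sum>i\<in>I. T (h i))"
  by (induction I rule: infinite_finite_induct) (auto simp: lin_0 lin_add)
lemma lin_funpow: "lin (T ^^ n)"
proof (induction n)
  case 0 show ?case by (simp add: lin_def)
next
  case (Suc n) then show ?case using T by (simp add: lin_def)
qed

lemma lin_eq_on_spanning:
  assumes S: "lin S" and sp: "span C = UNIV" and eq: "\<And>c. c \<in> C \<Longrightarrow> T c = S c"
  shows "T = S"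
proof
  fix v
  have "v \<in> span C" using sp by simp
  then show "T v = S v"
  proof (induction rule: span_induct)
    case base
    show ?case
      using S T lin_0 by (auto simp: lin_def intro!: subspaceI) (metis scale_zero_left)
  qed (use eq in auto)
qed

end

context fixes l assumes l: "linf l" begin

lemma linf_add: "l (x + y) = l x + l y" using l by (simp add: linf_def)
lemma linf_scl: "l (scl c x) = c * l x" using l by (simp add: linf_def)
lemma linf_0: "l 0 = 0" using linf_scl[of 0 0] by simp
lemma linf_neg: "l (- x) = - l x" using linf_scl[of "-1" x] by simp
lemma linf_diff: "l (x - y) = l x - l y"
  using linf_add[of x "-y"] linf_neg by simp
lemma linf_sum: "l (sum h I) = (\<Sum>i\<in>I. l (h i))"
  by (induction I rule: infinite_finite_induct) (auto simp: linf_0 linf_add)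

end

definition basis :: "'g set \<Rightarrow> bool" where
  "basis C \<longleftrightarrow> independent C \<and> span C = UNIV"

lemma basis_Basis: "basis Basis"
  by (simp add: basis_def independent_Basis span_Basis)

lemma basis_finite: "basis C \<Longrightarrow> finite C"
  by (simp add: basis_def finiteI_independent)

lemma basis_subset_exists:
  assumes "span S = UNIV"
  obtains C where "C \<subseteq> S" "basis C"
proof -
  obtain C where C: "C \<subseteq> S" "independent C" "S \<subseteq> span C"
    using maximal_independent_subset by blast
  have "span S \<subseteq> span C" using C(3) span_minimal subspace_span by blast
  then show thesis using C assms that[of C] by (auto simp: basis_def)
qed

abbreviation "coord C v c \<equiv> representation C v c"

context fixes C assumes C: "basis C" begin

lemma coord_sum: "(\<Sum>c\<in>C. scl (coord C v c) c) = v"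
  using C basis_finite[OF C] by (intro sum_representation_eq) (auto simp: basis_def)

lemma coord_linf: "linf (\<lambda>v. coord C v c)"
  using C by (intro linfI) (auto simp: basis_def representation_add representation_scale)

lemma coord_unique:
  assumes "(\<Sum>c\<in>C. scl (r c) c) = v" "c \<in> C"
  shows "coord C v c = r c"
proof -
  have "(\<Sum>c\<in>C. scl (coord C v c - r c) c) = 0"
    using assms(1) coord_sum[of v] by (simp add: scale_left_diff_distrib sum_subtractf)
  then show ?thesis
    using independentD[of C C "\<lambda>c. coord C v c - r c" c] C assms(2) basis_finite[OF C]
    by (auto simp: basis_def)
qed

lemma lin_coord_expand:
  assumes "lin T" shows "T v = (\<Sum>c\<in>C. scl (coord C v c) (T c))"
proof -
  have "T v = T (\<Sum>c\<in>C. scl (coord C v c) c)" by (simp add: coord_sum)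
  then show ?thesis by (simp add: lin_sum[OF assms] lin_scl[OF assms])
qed

end

definition tr :: "('g \<Rightarrow> 'g) \<Rightarrow> 'k" where
  "tr T = (\<Sum>b\<in>Basis. coord Basis (T b) b)"

lemma tr_add: "tr (\<lambda>v. S v + T v) = tr S + tr T"
  unfolding tr_def using linf_add[OF coord_linf[OF basis_Basis]] by (simp add: sum.distrib)

lemma tr_scl: "tr (\<lambda>v. scl c (T v)) = c * tr T"
  unfolding tr_def using linf_scl[OF coord_linf[OF basis_Basis]] by (simp add: sum_distrib_left)

lemma tr_diff: "tr (\<lambda>v. S v - T v) = tr S - tr T"
  unfolding tr_def using linf_diff[OF coord_linf[OF basis_Basis]] by (simp add: sum_subtractf)

lemma tr_sum: "tr (\<lambda>v. \<Sum>i\<in>I. F i v) = (\<Sum>i\<in>I. tr (F i))"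
  unfolding tr_def by (simp add: linf_sum[OF coord_linf[OF basis_Basis]]) (rule sum.swap)

text \<open>Both \<open>tr_basis\<close> and \<open>tr_comm\<close> come from this: an operator is a
  sum of rank-one operators v |-> (coordinate of v) * (image of a basis vector).\<close>

lemma tr_rank1:
  assumes "linf l" shows "tr (\<lambda>v. scl (l v) w) = l w"
proof -
  have "l w = l (\<Sum>b\<in>Basis. scl (coord Basis w b) b)"
    by (simp only: coord_sum[OF basis_Basis])
  also have "\<dots> = (\<Sum>b\<in>Basis. coord Basis w b * l b)"
    by (simp add: linf_sum[OF assms] linf_scl[OF assms])
  finally show ?thesis
    unfolding tr_def by (simp add: linf_scl[OF coord_linf[OF basis_Basis]] mult.commute)
qed

lemma tr_basis:
  assumes C: "basis C" and T: "lin T"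
  shows "tr T = (\<Sum>c\<in>C. coord C (T c) c)"
proof -
  have "tr T = tr (\<lambda>v. \<Sum>c\<in>C. scl (coord C v c) (T c))"
    by (subst lin_coord_expand[OF C T, abs_def]) (rule refl)
  then show ?thesis by (simp add: tr_sum tr_rank1[OF coord_linf[OF C]])
qed

lemma tr_diag:
  assumes C: "basis C" and T: "lin T" and d: "\<And>c. c \<in> C \<Longrightarrow> T c = scl (\<mu> c) c"
  shows "tr T = (\<Sum>c\<in>C. \<mu> c)"
  unfolding tr_basis[OF C T]
proof (rule sum.cong)
  fix c assume c: "c \<in> C"
  have "(\<Sum>c'\<in>C. scl (if c' = c then \<mu> c else 0) c') = (\<Sum>c'\<in>C. if c' = c then scl (\<mu> c) c else 0)"
    by (rule sum.cong) auto
  also have "\<dots> = T c" using c d basis_finite[OF C] by simp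
  finally show "coord C (T c) c = \<mu> c"
    using coord_unique[OF C _ c, of "\<lambda>c'. if c' = c then \<mu> c else 0"] by simp
qed simp

lemma tr_comm:
  assumes S: "lin S" and T: "lin T"
  shows "tr (\<lambda>v. S (T v)) = tr (\<lambda>v. T (S v))"
proof -
  let ?B = Basis
  have l: "linf (\<lambda>v. coord ?B (S v) c)" for c
    using S linf_add[OF coord_linf[OF basis_Basis]] linf_scl[OF coord_linf[OF basis_Basis]]
    by (auto simp: lin_def intro!: linfI)
  have "(\<lambda>v. T (S v)) = (\<lambda>v. \<Sum>c\<in>?B. scl (coord ?B (S v) c) (T c))"
    using lin_coord_expand[OF basis_Basis T] by blast
  then have "tr (\<lambda>v. T (S v)) = (\<Sum>c\<in>?B. coord ?B (S (T c)) c)"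
    by (simp add: tr_sum tr_rank1[OF l])
  then show ?thesis by (simp add: tr_def)
qed

text \<open>A finite basis inside S suffices, and the sum of its exponents kills each of its
  members.\<close>

lemma nilpotent_uniform:
  assumes T: "lin T" and sp: "span S = UNIV" and nil: "\<And>v. v \<in> S \<Longrightarrow> \<exists>m. (T ^^ m) v = 0"
  shows "\<exists>m. \<forall>v. (T ^^ m) v = 0"
proof -
  obtain C where C: "C \<subseteq> S" "basis C" using basis_subset_exists[OF sp] .
  obtain m where m: "\<And>v. v \<in> C \<Longrightarrow> (T ^^ m v) v = 0" using nil C(1) by (metis subsetD)
  let ?M = "\<Sum>v\<in>C. m v"
  have "(T ^^ ?M) v = 0" if "v \<in> C" for v
  proof -
    have "m v \<le> ?M" using basis_finite[OF C(2)] that by (intro member_le_sum) auto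
    then obtain j where "?M = j + m v" by (metis le_add_diff_inverse2)
    then show ?thesis using m[OF that] by (simp add: funpow_add lin_0[OF lin_funpow[OF T]])
  qed
  then have "(T ^^ ?M) v = 0" for v
    using lin_coord_expand[OF C(2) lin_funpow[OF T], of ?M v] by simp
  then show ?thesis by blast
qed

text \<open>T pushes the image of each power into the next smaller one, so in a basis adapted to
  this flag its diagonal is zero.\<close>

lemma tr_nilpotent:
  assumes T: "lin T" and nil: "\<And>v. (T ^^ m) v = 0"
  shows "tr T = 0"
proof -
  have sub: "subspace (range (T ^^ j))" for j
  proof (rule subspaceI)
    show "0 \<in> range (T ^^ j)" using lin_0[OF lin_funpow[OF T], of j]
      by (intro range_eqI[of _ _ 0]) simp
    show "x + y \<in> range (T ^^ j)" if xy: "x \<in> range (T ^^ j)" "y \<in> range (T ^^ j)" for x y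
    proof -
      obtain a b where "x = (T ^^ j) a" "y = (T ^^ j) b" using xy by blast
      then have "x + y = (T ^^ j) (a + b)" using lin_add[OF lin_funpow[OF T]] by simp
      then show ?thesis by blast
    qed
    show "scl c x \<in> range (T ^^ j)" if x: "x \<in> range (T ^^ j)" for c x
    proof -
      obtain a where "x = (T ^^ j) a" using x by blast
      then have "scl c x = (T ^^ j) (scl c a)" using lin_scl[OF lin_funpow[OF T]] by simp
      then show ?thesis by blast
    qed
  qed
  \<comment> \<open>The flag is climbed from the zero space (j = 0) to the whole space (j = m),
    extending the basis at each stage.\<close>
  have "j \<le> m \<Longrightarrow> \<exists>C. independent C \<and> span C = range (T ^^ (m - j)) \<and> (\<forall>c\<in>C. coord C (T c) c = 0)" for j
  proof (induction j)
    case 0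
    have "range (T ^^ m) = {0}" using nil by auto
    then show ?case by (intro exI[of _ "{}"]) (auto simp: independent_empty)
  next
    case (Suc j)
    then obtain C where C: "independent C" "span C = range (T ^^ (m - j))"
      "\<And>c. c \<in> C \<Longrightarrow> coord C (T c) c = 0" by auto
    let ?V = "range (T ^^ (m - Suc j))"
    have mj: "m - j = Suc (m - Suc j)" using Suc.prems by simp
    have "range (T ^^ (m - j)) \<subseteq> ?V" unfolding mj funpow_Suc_right by auto
    then have "C \<subseteq> ?V" using C(2) span_superset by blast
    then obtain E where E: "C \<subseteq> E" "E \<subseteq> ?V" "independent E" "?V \<subseteq> span E"
      using maximal_independent_subset_extend[OF _ C(1)] by blast
    \<comment> \<open>T c lies in the span of C, so a vector of E outside C does not occur in it;
      the vectors of C are covered by the induction.\<close>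
    have "coord E (T c) c = 0" if "c \<in> E" for c
    proof -
      have "T c \<in> range (T ^^ (m - j))" using that E(2) unfolding mj by auto
      then have "coord E (T c) = coord C (T c)"
        using representation_extend[OF E(3) _ E(1)] C(2) by simp
      then show ?thesis using C(3) C(1) that representation_ne_zero by metis
    qed
    moreover have "span E = ?V"
      using E sub span_subspace by blast
    ultimately show ?case using E(3) by blast
  qed
  from this[of m] obtain C where "independent C" "span C = range (T ^^ 0)"
    "\<And>c. c \<in> C \<Longrightarrow> coord C (T c) c = 0" by auto
  then show ?thesis using tr_basis[OF _ T, of C] by (simp add: basis_def)
qed

text \<open>The injection sending s to the vector with coordinates \<open>\<beta> s b\<close> is onto.\<close>
lemma nondegenerate_represents:
  assumes b1: "\<And>x. linf (\<beta> x)" and b2: "\<And>y. linf (\<lambda>x. \<beta> x y)"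
    and nd: "\<And>x. (\<And>y. \<beta> x y = 0) \<Longrightarrow> x = 0" and l: "linf l"
  obtains s where "\<And>z. \<beta> s z = l z"
proof -
  let ?f = "\<lambda>s. \<Sum>b\<in>Basis. scl (\<beta> s b) b"
  have lf: "lin ?f"
    using linf_add[OF b2] linf_scl[OF b2]
    by (intro linI) (simp_all add: scale_left_distrib sum.distrib scale_sum_right)
  have ext: "\<beta> s z = m z" if "linf m" "\<And>b. b \<in> Basis \<Longrightarrow> \<beta> s b = m b" for s m z
  proof -
    have "\<beta> s (\<Sum>b\<in>Basis. scl (coord Basis z b) b) = m (\<Sum>b\<in>Basis. scl (coord Basis z b) b)"
      by (simp add: that linf_sum[OF b1] linf_scl[OF b1] linf_sum[OF that(1)] linf_scl[OF that(1)])
    then show ?thesis by (simp only: coord_sum[OF basis_Basis])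
  qed
  have eq: "\<beta> s b = r b" if "(\<Sum>b\<in>Basis. scl (r b) b) = ?f s" "b \<in> Basis" for s r b
    using coord_unique[OF basis_Basis that]
      coord_unique[OF basis_Basis refl that(2), of "\<beta> s"] by simp
  have "inj ?f"
  proof (rule injI)
    fix s t assume "?f s = ?f t"
    then have "\<beta> s b = \<beta> t b" if "b \<in> Basis" for b using eq[OF _ that, of "\<beta> t" s] by simp
    then have "\<beta> s z = \<beta> t z" for z using ext[OF b1] by blast
    then have "\<beta> (s - t) z = 0" for z using linf_diff[OF b2, of s t z] by simp
    then show "s = t" using nd[of "s - t"] by simp
  qed
  then have "surj ?f"
    using linear_inj_imp_surj lf lin_linear by blast
  from surjD[OF this, of "\<Sum>b\<in>Basis. scl (l b) b"]
  obtain s where s: "(\<Sum>b\<in>Basis. scl (l b) b) = ?f s" by blast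
  have bl: "\<beta> s b = l b" if "b \<in> Basis" for b by (rule eq[OF s that])
  show thesis by (rule that[of s], rule ext[OF l bl])
qed

end

section \<open>Generalised eigenspaces\<close>

context fd_space begin

definition sh :: "('g \<Rightarrow> 'g) \<Rightarrow> 'k \<Rightarrow> 'g \<Rightarrow> 'g" where
  "sh T a v = T v - scl a v"

definition geig :: "('g \<Rightarrow> 'g) \<Rightarrow> 'k \<Rightarrow> 'g set" where
  "geig T a = {w. \<exists>m. (sh T a ^^ m) w = 0}"

lemma lin_sh: "lin T \<Longrightarrow> lin (sh T a)"
  by (intro linI) (simp_all add: sh_def lin_add lin_scl scale_right_distrib
      scale_right_diff_distrib scale_left_commute)

lemma lin_funpow_commute:
  assumes "\<And>v. S (T v) = T (S v)"
  shows "S ((T ^^ m) v) = (T ^^ m) (S v)"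
  by (induction m arbitrary: v) (simp_all add: assms)

lemma geigI: "(sh T a ^^ m) w = 0 \<Longrightarrow> w \<in> geig T a"
  by (auto simp: geig_def)

context fixes T assumes T: "lin T" begin

lemma funpow_zero_mono:
  assumes "(T ^^ m) w = 0" "m \<le> n" shows "(T ^^ n) w = 0"
proof -
  obtain j where "n = j + m" using assms(2) by (metis le_add_diff_inverse2)
  then show ?thesis using assms(1) by (simp add: funpow_add lin_0[OF lin_funpow[OF T]])
qed

end

context fixes T assumes T: "lin T" begin

lemma subspace_geig: "subspace (geig T a)"
proof (rule subspaceI)
  note l = lin_sh[OF T] and lp = lin_funpow[OF lin_sh[OF T]]
  show "0 \<in> geig T a" by (rule geigI[where m = 0]) simp
  show "x + y \<in> geig T a" if xy: "x \<in> geig T a" "y \<in> geig T a" for x y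
  proof -
    obtain m n where m: "(sh T a ^^ m) x = 0" and n: "(sh T a ^^ n) y = 0"
      using xy unfolding geig_def by blast
    have "(sh T a ^^ max m n) (x + y) = 0"
      using funpow_zero_mono[OF l m, of "max m n"] funpow_zero_mono[OF l n, of "max m n"]
      by (simp add: lin_add[OF lp])
    then show ?thesis by (rule geigI)
  qed
  show "scl c x \<in> geig T a" if "x \<in> geig T a" for c x
    using that by (auto simp: geig_def lin_scl[OF lp])
qed

lemma geig_commute:
  assumes S: "lin S" and c: "\<And>v. S (T v) = T (S v)" and w: "w \<in> geig T a"
  shows "S w \<in> geig T a"
proof -
  have "S (sh T a v) = sh T a (S v)" for v
    by (simp add: sh_def lin_diff[OF S] lin_scl[OF S] c)
  then have *: "S ((sh T a ^^ m) w) = (sh T a ^^ m) (S w)" for m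
    by (rule lin_funpow_commute)
  obtain m where "(sh T a ^^ m) w = 0" using w by (auto simp: geig_def)
  then show ?thesis using *[of m] lin_0[OF S] by (intro geigI[where m = m]) simp
qed

lemma sh_commute: "sh T a (T v) = T (sh T a v)"
  by (simp add: sh_def lin_diff[OF T] lin_scl[OF T])

lemma geig_T: "w \<in> geig T a \<Longrightarrow> T w \<in> geig T a"
  by (rule geig_commute[OF T]) auto

lemma geig_sh: "w \<in> geig T a \<Longrightarrow> sh T b w \<in> geig T a"
  by (rule geig_commute[OF lin_sh[OF T]]) (auto simp: sh_commute)

lemma eig_funpow: "T w = scl c w \<Longrightarrow> (T ^^ n) w = scl (c ^ n) w"
  by (induction n) (simp_all add: lin_scl[OF T] mult.commute)

end

context fixes T assumes T: "lin T" begin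

text \<open>On a vector killed by T - a, the operator T - b is the nonzero scalar a - b, so none of
  its powers kills a nonzero vector there. Induction on the exponent of T - a reduces to this
  case.\<close>

lemma geig_disjoint:
  assumes ab: "a \<noteq> b" and a: "w \<in> geig T a" and b: "w \<in> geig T b"
  shows "w = 0"
proof -
  have "w = 0" if "(sh T a ^^ m) w = 0" "w \<in> geig T b" for m w
    using that
  proof (induction m arbitrary: w)
    case (Suc m)
    have "sh T a w = 0"
      using Suc.IH[of "sh T a w"] Suc.prems geig_sh[OF T] by (simp add: funpow_swap1)
    then have "sh T b w = scl (a - b) w" by (simp add: sh_def scale_left_diff_distrib)
    then have "(sh T b ^^ n) w = scl ((a - b) ^ n) w" for n
      by (rule eig_funpow[OF lin_sh[OF T]])
    then show ?case using Suc.prems(2) ab by (auto simp: geig_def)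
  qed simp
  then show ?thesis using a b by (auto simp: geig_def)
qed

text \<open>If (T - a) u = (T - b) w, then (w - u) / (b - a) is a preimage of w, because (T - a) w -
  (T - b) w = (b - a) w. Such a u comes from induction on the exponent of T - b.\<close>

lemma geig_solve:
  assumes ab: "a \<noteq> b" and b: "w \<in> geig T b"
  shows "\<exists>w'\<in>geig T b. sh T a w' = w"
proof -
  have "\<exists>w'\<in>geig T b. sh T a w' = w" if "(sh T b ^^ m) w = 0" for m w
    using that
  proof (induction m arbitrary: w)
    case 0
    then show ?case
      using subspace_0[OF subspace_geig[OF T]] lin_0[OF lin_sh[OF T]] by auto
  next
    case (Suc m)
    have w: "w \<in> geig T b" using Suc.prems by (rule geigI)
    obtain u where u: "u \<in> geig T b" "sh T a u = sh T b w"
      using Suc.IH[of "sh T b w"] Suc.prems by (auto simp: funpow_swap1)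
    let ?w = "scl (inverse (b - a)) (w - u)"
    have "sh T a ?w = scl (inverse (b - a)) (sh T a w - sh T b w)"
      by (simp add: lin_scl[OF lin_sh[OF T]] lin_diff[OF lin_sh[OF T]] u)
    also have "sh T a w - sh T b w = scl (b - a) w"
      by (simp add: sh_def scale_left_diff_distrib)
    finally have "sh T a ?w = w" using ab by simp
    moreover have "?w \<in> geig T b"
      using w u(1) subspace_scale[OF subspace_geig[OF T]] subspace_diff[OF subspace_geig[OF T]] by blast
    ultimately show ?case by blast
  qed
  then show ?thesis using b by (auto simp: geig_def)
qed

text \<open>T - a can be inverted on all components of (T - a) v except the one in
  \<open>geig T a\<close>. The resulting w has (T - a) (w - v) in \<open>geig T a\<close>, hence w -
  v is there too.\<close>

lemma span_geig_lift:
  assumes "sh T a v \<in> span (\<Union>b. geig T b)"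
  shows "v \<in> span (\<Union>b. geig T b)" (is "_ \<in> ?G")
proof -
  note ls = lin_sh[OF T]
  have "\<exists>w\<in>?G. sh T a w - u \<in> geig T a" if "u \<in> ?G" for u
    using that
  proof (induction rule: span_induct)
    case base
    show ?case
    proof (rule subspaceI)
      show "0 \<in> {u. \<exists>w\<in>?G. sh T a w - u \<in> geig T a}"
        using lin_0[OF ls] subspace_0[OF subspace_geig[OF T]] span_zero[of "\<Union>b. geig T b"]
        by (intro CollectI bexI[of _ 0]) simp_all
    next
      fix x y assume "x \<in> {u. \<exists>w\<in>?G. sh T a w - u \<in> geig T a}" "y \<in> {u. \<exists>w\<in>?G. sh T a w - u \<in> geig T a}"
      then obtain w w' where w: "w \<in> ?G" "sh T a w - x \<in> geig T a" "w' \<in> ?G" "sh T a w' - y \<in> geig T a"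
        by blast
      have "sh T a (w + w') - (x + y) = (sh T a w - x) + (sh T a w' - y)"
        by (simp add: lin_add[OF ls])
      then have "sh T a (w + w') - (x + y) \<in> geig T a"
        using subspace_add[OF subspace_geig[OF T] w(2,4)] by metis
      then show "x + y \<in> {u. \<exists>w\<in>?G. sh T a w - u \<in> geig T a}"
        using span_add[OF w(1,3)] by blast
    next
      fix c x assume "x \<in> {u. \<exists>w\<in>?G. sh T a w - u \<in> geig T a}"
      then obtain w where w: "w \<in> ?G" "sh T a w - x \<in> geig T a" by blast
      have "sh T a (scl c w) - scl c x = scl c (sh T a w - x)"
        by (simp add: lin_scl[OF ls] scale_right_diff_distrib)
      then have "sh T a (scl c w) - scl c x \<in> geig T a"
        using subspace_scale[OF subspace_geig[OF T] w(2)] by simp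
      then show "scl c x \<in> {u. \<exists>w\<in>?G. sh T a w - u \<in> geig T a}"
        using span_scale[OF w(1)] by blast
    qed
  next
    case (step u)
    then obtain b where b: "u \<in> geig T b" by blast
    show ?case
    proof (cases "a = b")
      case True
      then show ?thesis
        using b subspace_neg[OF subspace_geig[OF T]] lin_0[OF ls] span_zero[of "\<Union>b. geig T b"]
        by (intro bexI[of _ 0]) auto
    next
      case False
      from geig_solve[OF this b] obtain w where w: "w \<in> geig T b" "sh T a w = u" by blast
      then have "w \<in> ?G" by (intro span_base) blast
      then show ?thesis
        using w subspace_0[OF subspace_geig[OF T]] by (intro bexI[of _ w]) auto
    qed
  qed
  from this[OF assms] obtain w where w: "w \<in> ?G" "sh T a w - sh T a v \<in> geig T a" by blast
  then have "sh T a (w - v) \<in> geig T a" by (simp add: lin_diff[OF ls])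
  then obtain m where "(sh T a ^^ m) (sh T a (w - v)) = 0" by (auto simp: geig_def)
  then have "w - v \<in> geig T a" by (intro geigI[where m = "Suc m"]) (simp add: funpow_swap1)
  then have "w - v \<in> ?G" by (intro span_base) blast
  from span_diff[OF w(1) this] show ?thesis by simp
qed

text \<open>A power of T - a0 removes the summand of a0 and preserves the other generalised
  eigenspaces. By induction it kills the other summands, which then lie in two different generalised
  eigenspaces.\<close>

lemma geig_independent:
  assumes "finite A" and "\<And>a. a \<in> A \<Longrightarrow> w a \<in> geig T a" and "(\<Sum>a\<in>A. w a) = 0" and "a \<in> A"
  shows "w a = 0"
  using assms
proof (induction A arbitrary: w a rule: finite_induct)
  case (insert a0 A)
  note lp = lin_funpow[OF lin_sh[OF T]]
  obtain m where m: "(sh T a0 ^^ m) (w a0) = 0" using insert.prems(1) by (auto simp: geig_def)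
  let ?S = "sh T a0 ^^ m"
  have "(\<Sum>a\<in>A. ?S (w a)) = ?S (\<Sum>a\<in>insert a0 A. w a)"
    using insert.hyps m by (simp add: lin_sum[OF lp] lin_add[OF lp])
  also have "\<dots> = 0" using insert.prems(2) lin_0[OF lp] by simp
  finally have s: "(\<Sum>a\<in>A. ?S (w a)) = 0" .
  have "?S (w a) \<in> geig T a" if "a \<in> A" for a
  proof (rule geig_commute[OF T lp])
    show "(sh T a0 ^^ m) (T v) = T ((sh T a0 ^^ m) v)" for v
      using lin_funpow_commute[of T "sh T a0"] sh_commute[OF T] by metis
  qed (use that insert.prems in auto)
  then have "?S (w a) = 0" if "a \<in> A" for a using insert.IH[of "\<lambda>a. ?S (w a)"] s that by blast
  then have A: "w a = 0" if "a \<in> A" for a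
    using geig_disjoint[of a0 a "w a"] geigI[of m T a0 "w a"] insert.prems(1)[of a] insert.hyps(2) that by auto
  then have "w a0 = 0" using insert.prems(2) insert.hyps by simp
  then show ?case using A insert.prems(3) by auto
qed simp

end

section \<open>Polynomials in an operator and functional calculus\<close>

definition pap :: "('g \<Rightarrow> 'g) \<Rightarrow> 'k poly \<Rightarrow> 'g \<Rightarrow> 'g" where
  "pap T p v = (\<Sum>i\<le>degree p. scl (coeff p i) ((T ^^ i) v))"

lemma pap_bound:
  assumes "degree p \<le> N" shows "pap T p v = (\<Sum>i\<le>N. scl (coeff p i) ((T ^^ i) v))"
  unfolding pap_def using assms by (intro sum.mono_neutral_left) (auto simp: coeff_eq_0)

text \<open>The linear factor is made to reach v before q does: dividing an annihilating polynomial
  by X - a replaces v by (T - a) v, which is what \<open>span_geig_lift\<close> handles.\<close>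

lemma pap_root:
  assumes T: "lin T"
  shows "pap T ([:-a, 1:] * q) v = pap T q (sh T a v)"
proof -
  let ?N = "Suc (degree q)"
  have e: "[:-a, 1:] * q = pCons 0 q - smult a q" by simp
  have "degree ([:-a, 1:] * q) \<le> ?N"
    using degree_mult_le[of "[:-a, 1:]" q] by (simp del: mult_pCons_left)
  then have "pap T ([:-a, 1:] * q) v = (\<Sum>i\<le>?N. scl (coeff (pCons 0 q - smult a q) i) ((T ^^ i) v))"
    unfolding e by (rule pap_bound)
  also have "\<dots> = (\<Sum>i\<le>?N. scl (coeff (pCons 0 q) i) ((T ^^ i) v)) - (\<Sum>i\<le>?N. scl (coeff (smult a q) i) ((T ^^ i) v))"
    by (simp add: scale_left_diff_distrib sum_subtractf del: sum.atMost_Suc)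
  also have "(\<Sum>i\<le>?N. scl (coeff (pCons 0 q) i) ((T ^^ i) v)) = (\<Sum>i\<le>degree q. scl (coeff q i) ((T ^^ i) (T v)))"
    by (subst sum.atMost_Suc_shift) (simp add: funpow_swap1)
  also have "(\<Sum>i\<le>?N. scl (coeff (smult a q) i) ((T ^^ i) v)) = (\<Sum>i\<le>degree q. scl (coeff q i) ((T ^^ i) (scl a v)))"
    by (simp add: lin_scl[OF lin_funpow[OF T]] coeff_eq_0 mult.commute)
  finally show ?thesis
    by (simp add: pap_def sh_def lin_diff[OF lin_funpow[OF T]] scale_right_diff_distrib sum_subtractf)
qed

lemma span_image_finite:
  assumes "finite I" "w \<in> span (h ` I)"
  obtains r where "w = (\<Sum>i\<in>I. scl (r i) (h i))"
proof -
  have "\<exists>r. w = (\<Sum>i\<in>I. scl (r i) (h i))"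
    using assms(2)
  proof (induction rule: span_induct)
    case base
    show ?case
    proof (rule subspaceI)
      show "0 \<in> {w. \<exists>r. w = (\<Sum>i\<in>I. scl (r i) (h i))}" by (auto intro: exI[of _ "\<lambda>_. 0"])
    next
      fix x y assume "x \<in> {w. \<exists>r. w = (\<Sum>i\<in>I. scl (r i) (h i))}" "y \<in> {w. \<exists>r. w = (\<Sum>i\<in>I. scl (r i) (h i))}"
      then obtain r s where "x = (\<Sum>i\<in>I. scl (r i) (h i))" "y = (\<Sum>i\<in>I. scl (s i) (h i))" by blast
      then have "x + y = (\<Sum>i\<in>I. scl (r i + s i) (h i))" by (simp add: scale_left_distrib sum.distrib)
      then show "x + y \<in> {w. \<exists>r. w = (\<Sum>i\<in>I. scl (r i) (h i))}" by (intro CollectI exI)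
    next
      fix c x assume "x \<in> {w. \<exists>r. w = (\<Sum>i\<in>I. scl (r i) (h i))}"
      then obtain r where "x = (\<Sum>i\<in>I. scl (r i) (h i))" by blast
      then have "scl c x = (\<Sum>i\<in>I. scl (c * r i) (h i))" by (simp add: scale_sum_right)
      then show "scl c x \<in> {w. \<exists>r. w = (\<Sum>i\<in>I. scl (r i) (h i))}" by (intro CollectI exI)
    qed
  next
    case (step x)
    then obtain j where j: "j \<in> I" "x = h j" by blast
    have "(\<Sum>i\<in>I. scl (if i = j then 1 else 0) (h i)) = (\<Sum>i\<in>I. if i = j then h j else 0)"
      by (rule sum.cong) auto
    then have "x = (\<Sum>i\<in>I. scl (if i = j then 1 else 0) (h i))" using assms(1) j by simp
    then show ?case by (intro exI)
  qed
  then show thesis using that by blast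
qed

text \<open>If no T^n v were in the span of the earlier iterates, these would form independent sets
  of every size. The polynomial is X^n minus the relation so obtained.\<close>

lemma annihilator_exists:
  obtains p where "p \<noteq> 0" "pap T p v = 0"
proof -
  let ?h = "\<lambda>i. (T ^^ i) v"
  have "\<exists>n. ?h n \<in> span (?h ` {..<n})"
  proof (rule ccontr)
    assume neg: "\<nexists>n. ?h n \<in> span (?h ` {..<n})"
    have "independent (?h ` {..<n}) \<and> card (?h ` {..<n}) = n" for n
    proof (induction n)
      case (Suc n)
      have n: "?h n \<notin> span (?h ` {..<n})" using neg by blast
      then have "?h n \<notin> ?h ` {..<n}" using span_superset[of "?h ` {..<n}"] by (rule contra_subsetD[rotated])
      then show ?case
        using Suc n by (simp add: lessThan_Suc independent_insertI)
    qed (simp add: independent_empty)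
    from this[of "Suc (card Basis)"] show False
      using independent_span_bound[OF finite_Basis, of "?h ` {..<Suc (card Basis)}"] span_Basis by auto
  qed
  then obtain n where "?h n \<in> span (?h ` {..<n})" by blast
  then obtain r where r: "?h n = (\<Sum>i<n. scl (r i) (?h i))" using span_image_finite by blast
  let ?p = "monom 1 n - (\<Sum>i<n. monom (r i) i)"
  have cf: "coeff ?p j = (if j = n then 1 else if j < n then - r j else 0)" for j
    by (simp add: coeff_sum sum.delta)
  have "degree ?p \<le> n" by (rule degree_le) (simp only: cf, simp)
  then have "pap T ?p v = (\<Sum>i\<le>n. scl (coeff ?p i) (?h i))" by (rule pap_bound)
  also have "\<dots> = (\<Sum>i<n. scl (coeff ?p i) (?h i)) + scl (coeff ?p n) (?h n)"
    by (simp only: lessThan_Suc_atMost[symmetric] sum.lessThan_Suc)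
  also have "\<dots> = 0" using r by (simp add: cf sum_negf del: coeff_diff)
  finally have "pap T ?p v = 0" .
  moreover have "?p \<noteq> 0" using cf[of n] by fastforce
  ultimately show thesis using that by blast
qed

text \<open>Induction on the degree of a polynomial annihilating v: for a root a, the quotient by X
  - a annihilates (T - a) v.\<close>

lemma span_geig:
  assumes ac: "alg_closed TYPE('k)" and T: "lin T"
  shows "span (\<Union>a. geig T a) = UNIV"
proof -
  have "v \<in> span (\<Union>a. geig T a)" if "p \<noteq> 0" "pap T p v = 0" for p v
    using that
  proof (induction "degree p" arbitrary: p v)
    case 0
    then obtain c where "p = [:c:]" using degree_eq_zeroE[of p] by metis
    then have "v = 0" using 0 by (simp add: pap_def)
    then show ?case using span_zero by simp
  next
    case (Suc n)
    then have "degree p > 0" by simp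
    then obtain a where "poly p a = 0" using ac unfolding alg_closed_def by blast
    then obtain q where q: "p = [:-a, 1:] * q" using poly_eq_0_iff_dvd by blast
    have "q \<noteq> 0" using Suc.prems q by auto
    then have "degree p = Suc (degree q)" unfolding q by (subst degree_mult_eq) auto
    then have "n = degree q" using Suc.hyps by simp
    moreover have "pap T q (sh T a v) = 0" using Suc.prems(2) unfolding q pap_root[OF T] .
    ultimately have "sh T a v \<in> span (\<Union>a. geig T a)" using Suc.hyps(1) \<open>q \<noteq> 0\<close> by blast
    then show ?case by (rule span_geig_lift[OF T])
  qed
  then show ?thesis using annihilator_exists by blast
qed

text \<open>With the identity as \<open>\<phi>\<close> this is the semisimple part of T; with a
  rational functional and T = ad x it is the derivation of Cartan's argument.\<close>

lemma geig_functional_calculus: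
  assumes sp: "span (\<Union>a. geig T a) = UNIV" and T: "lin T"
  obtains D where "lin D" "\<And>a w. w \<in> geig T a \<Longrightarrow> D w = scl (\<phi> a) w"
proof -
  obtain C where C: "C \<subseteq> (\<Union>a. geig T a)" "basis C" using basis_subset_exists[OF sp] .
  then obtain ev where ev: "\<And>c. c \<in> C \<Longrightarrow> c \<in> geig T (ev c)" by (metis UN_iff subsetD)
  note fC = basis_finite[OF C(2)]
  let ?D = "\<lambda>v. \<Sum>c\<in>C. scl (coord C v c * \<phi> (ev c)) c"
  have "lin ?D"
    using linf_add[OF coord_linf[OF C(2)]] linf_scl[OF coord_linf[OF C(2)]]
    by (intro linI) (simp_all add: distrib_right scale_left_distrib sum.distrib scale_sum_right mult.assoc)
  moreover have "?D w = scl (\<phi> a) w" if w: "w \<in> geig T a" for a w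
  proof -
    \<comment> \<open>The part of w carried by basis vectors of eigenvalue b. By independence it is
      w for b = a and zero otherwise, so D acts correctly on every w in \<open>geig T a\<close> and
      not only on members of C.\<close>
    define u where "u b = (\<Sum>c\<in>{c \<in> C. ev c = b}. scl (coord C w c) c)" for b
    let ?A = "insert a (ev ` C)"
    have u: "u b \<in> geig T b" for b
      unfolding u_def using ev subspace_scale[OF subspace_geig[OF T]]
      by (intro subspace_sum[OF subspace_geig[OF T]]) auto
    have us: "(\<Sum>b\<in>?A. scl (\<psi> b) (u b)) = (\<Sum>c\<in>C. scl (coord C w c * \<psi> (ev c)) c)" for \<psi>
    proof -
      have "(\<Sum>c\<in>C. scl (coord C w c * \<psi> (ev c)) c) =
          (\<Sum>b\<in>?A. \<Sum>c\<in>{c \<in> C. ev c = b}. scl (coord C w c * \<psi> (ev c)) c)"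
        using fC by (intro sum.group[symmetric]) auto
      also have "\<dots> = (\<Sum>b\<in>?A. scl (\<psi> b) (u b))"
        unfolding u_def scale_sum_right by (intro sum.cong) (auto simp: mult.commute)
      finally show ?thesis by simp
    qed
    have "(\<Sum>b\<in>?A. u b) = w" using us[of "\<lambda>_. 1"] by (simp add: coord_sum[OF C(2)])
    moreover have "(\<Sum>b\<in>?A. if b = a then w else 0) = w" using fC by simp
    ultimately have "(\<Sum>b\<in>?A. u b - (if b = a then w else 0)) = 0" by (simp only: sum_subtractf) simp
    moreover have "u b - (if b = a then w else 0) \<in> geig T b" for b
      using u w subspace_diff[OF subspace_geig[OF T]] by simp
    ultimately have uw: "u b = (if b = a then w else 0)" if "b \<in> ?A" for b
      using geig_independent[OF T, of ?A "\<lambda>b. u b - (if b = a then w else 0)" b] fC that by auto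
    have "?D w = (\<Sum>b\<in>?A. scl (\<phi> b) (u b))" by (rule us[symmetric])
    also have "\<dots> = (\<Sum>b\<in>?A. if b = a then scl (\<phi> a) w else 0)"
      by (rule sum.cong) (auto simp: uw)
    also have "\<dots> = scl (\<phi> a) w" using fC by simp
    finally show ?thesis .
  qed
  ultimately show thesis using that by blast
qed

end

section \<open>Lie algebras, the Killing form and Engel's theorem\<close>

definition rat_linear :: "('k::field_char_0 \<Rightarrow> rat) \<Rightarrow> bool" where
  "rat_linear f \<longleftrightarrow> (\<forall>x y. f (x + y) = f x + f y) \<and> (\<forall>q x. f (of_rat q * x) = q * f x)"

lemma rat_linear_add: "rat_linear f \<Longrightarrow> f (x + y) = f x + f y"
  and rat_linear_of_rat: "rat_linear f \<Longrightarrow> f (of_rat q * x) = q * f x"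
  by (auto simp: rat_linear_def)

lemma rat_linear_0: "rat_linear f \<Longrightarrow> f 0 = 0"
  using rat_linear_of_rat[of f 0 0] by simp

lemma rat_linear_neg: "rat_linear f \<Longrightarrow> f (- x) = - f x"
  using rat_linear_of_rat[of f "-1" x] by simp

lemma rat_linear_sum: "rat_linear f \<Longrightarrow> f (sum h I) = (\<Sum>i\<in>I. f (h i))"
  by (induction I rule: infinite_finite_induct) (auto simp: rat_linear_0 rat_linear_add)

text \<open>The field is a vector space over the rationals, and s |-> 1 extends linearly from the
  independent set {s}.\<close>

lemma rat_linear_exists1:
  fixes s :: "'k::field_char_0"
  assumes "s \<noteq> 0" obtains f :: "'k \<Rightarrow> rat" where "rat_linear f" "f s \<noteq> 0"
proof -
  interpret v: vector_space "\<lambda>(q::rat) (x::'k). of_rat q * x"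
    by unfold_locales (simp_all add: algebra_simps of_rat_add of_rat_mult)
  interpret r: vector_space "\<lambda>(q::rat) (x::rat). q * x"
    by unfold_locales (simp_all add: algebra_simps)
  interpret p: vector_space_pair "\<lambda>(q::rat) (x::'k). of_rat q * x" "\<lambda>(q::rat) (x::rat). q * x" ..
  have "v.independent {s}" using assms by (simp only: v.dependent_single) simp
  from p.linear_independent_extend[OF this, of "\<lambda>_. 1"]
  obtain g where g: "Vector_Spaces.linear (\<lambda>(q::rat) (x::'k). of_rat q * x) (\<lambda>(q::rat) (x::rat). q * x) g" "g s = 1"
    by auto
  have "rat_linear g" using g(1) unfolding rat_linear_def Vector_Spaces.linear_iff by blast
  then show thesis using that[of g] g(2) by simp
qed

text \<open>With f good on S and g nonzero at s, the sum f + n g vanishes at a given element for at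
  most one n, so some n avoids all of them.\<close>

lemma rat_linear_exists:
  fixes S :: "'k::field_char_0 set"
  assumes "finite S" "0 \<notin> S"
  shows "\<exists>f :: 'k \<Rightarrow> rat. rat_linear f \<and> (\<forall>s\<in>S. f s \<noteq> 0)"
  using assms
proof (induction rule: finite_induct)
  case empty
  have "rat_linear (\<lambda>_ :: 'k. 0)" by (simp add: rat_linear_def)
  then show ?case by blast
next
  case (insert s S)
  obtain f :: "'k \<Rightarrow> rat" where f: "rat_linear f" "\<And>t. t \<in> S \<Longrightarrow> f t \<noteq> 0" using insert by auto
  obtain g :: "'k \<Rightarrow> rat" where g: "rat_linear g" "g s \<noteq> 0"
    using insert.prems rat_linear_exists1[of s] by (metis insertI1)
  let ?bad = "\<lambda>t. {n :: nat. f t + of_nat n * g t = 0}"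
  have "finite (?bad t)" if t: "t \<in> insert s S" for t
  proof (cases "g t = 0")
    case True
    then show ?thesis using t f(2) g(2) by auto
  next
    case False
    have "inj_on (\<lambda>n. of_nat n * g t) (?bad t)" using False by (intro inj_onI) simp
    moreover have "(\<lambda>n. of_nat n * g t) ` ?bad t \<subseteq> {- f t}" by (auto simp: add_eq_0_iff)
    ultimately show ?thesis using finite_subset finite_imageD by (metis finite.emptyI finite.insertI)
  qed
  then have "finite (\<Union>t\<in>insert s S. ?bad t)" using insert.hyps(1) by blast
  then obtain n where n: "n \<notin> (\<Union>t\<in>insert s S. ?bad t)"
    using ex_new_if_finite infinite_UNIV_nat by blast
  have "rat_linear (\<lambda>x. f x + of_nat n * g x)"
    using f(1) g(1) by (simp add: rat_linear_def algebra_simps)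
  then show ?case using n by (intro exI[of _ "\<lambda>x. f x + of_nat n * g x"]) auto
qed

locale fd_lie = fd_space scl Basis
  for scl :: "'k::field_char_0 \<Rightarrow> 'g::ab_group_add \<Rightarrow> 'g" and Basis :: "'g set" +
  fixes br :: "'g \<Rightarrow> 'g \<Rightarrow> 'g"
  assumes lie: "lie_algebra scl br" and ac: "alg_closed TYPE('k)"
begin

lemma br_add_left: "br (x + y) z = br x z + br y z"
  and br_add_right: "br x (y + z) = br x y + br x z"
  and br_scl_left: "br (scl a x) y = scl a (br x y)"
  and br_scl_right: "br x (scl a y) = scl a (br x y)"
  and br_self: "br x x = 0"
  and jacobi: "br x (br y z) + br y (br z x) + br z (br x y) = 0"
  using lie by (simp_all add: lie_algebra_def)

lemma lin_br: "lin (br x)"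
  by (simp add: lin_def br_add_right br_scl_right)

lemma lin_br_left: "lin (\<lambda>x. br x y)"
  by (simp add: lin_def br_add_left br_scl_left)

lemmas br_0_left = lin_0[OF lin_br_left]
lemmas br_0_right = lin_0[OF lin_br]
lemmas br_neg_left = lin_neg[OF lin_br_left]
lemmas br_neg_right = lin_neg[OF lin_br]
lemmas br_diff_left = lin_diff[OF lin_br_left]
lemmas br_diff_right = lin_diff[OF lin_br]

lemma br_anti: "br x y = - br y x"
proof -
  have "br x y + br y x = 0"
    using br_self[of "x + y"] br_self[of x] br_self[of y] unfolding br_add_left br_add_right by (simp add: add.commute[of "br x y"])
  then show ?thesis by (simp add: eq_neg_iff_add_eq_0)
qed

lemma br_br_right: "br x (br y z) = br (br x y) z + br y (br x z)"
proof -
  have "br y (br z x) = - br y (br x z)" "br z (br x y) = - br (br x y) z"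
    using br_anti[of z x] br_anti[of z "br x y"] by (simp_all add: br_neg_right)
  then have "br x (br y z) - br y (br x z) - br (br x y) z = 0" using jacobi[of x y z] by simp
  then show ?thesis by (simp add: algebra_simps)
qed

lemma br_br_left: "br (br x y) z = br x (br y z) - br y (br x z)"
  using br_br_right[of x y z] by simp

lemma lin_comp: "lin S \<Longrightarrow> lin T \<Longrightarrow> lin (\<lambda>v. S (T v))"
  by (simp add: lin_def)

definition killing :: "'g \<Rightarrow> 'g \<Rightarrow> 'k" where
  "killing x y = tr (\<lambda>z. br x (br y z))"

lemma killing_sym: "killing x y = killing y x"
  unfolding killing_def by (rule tr_comm[OF lin_br lin_br])

lemma killing_linf: "linf (\<lambda>x. killing x y)"
  by (rule linfI) (simp_all add: killing_def br_add_left br_scl_left tr_add tr_scl)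

lemma killing_linf_right: "linf (killing x)"
  using killing_linf[of x] by (simp add: linf_def killing_sym)

lemmas killing_add_left = linf_add[OF killing_linf]
lemmas killing_add_right = linf_add[OF killing_linf_right]
lemmas killing_scl_left = linf_scl[OF killing_linf]
lemmas killing_scl_right = linf_scl[OF killing_linf_right]
lemmas killing_0_left = linf_0[OF killing_linf]
lemmas killing_0_right = linf_0[OF killing_linf_right]
lemmas killing_neg_left = linf_neg[OF killing_linf]
lemmas killing_neg_right = linf_neg[OF killing_linf_right]
lemmas killing_diff_left = linf_diff[OF killing_linf]
lemmas killing_diff_right = linf_diff[OF killing_linf_right]

lemma killing_assoc: "killing (br x y) z = killing x (br y z)"
proof -
  have "tr (\<lambda>w. br y (br x (br z w))) = tr (\<lambda>w. br x (br z (br y w)))"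
    by (rule tr_comm[OF lin_br lin_comp[OF lin_br lin_br]])
  then show ?thesis
    by (simp add: killing_def br_br_left br_diff_right tr_diff)
qed

lemma killing_inv: "killing (br x y) z = - killing y (br x z)"
  using killing_assoc[of y x z] br_anti[of x y] by (simp add: killing_neg_left)

lemma ad_nilpotent_span:
  assumes "span S = UNIV" "\<And>v. v \<in> S \<Longrightarrow> \<exists>m. (br x ^^ m) v = 0"
  shows "ad_nilpotent br x"
  unfolding ad_nilpotent_def using nilpotent_uniform[OF lin_br assms] .

lemma br_commute: "br x y = 0 \<Longrightarrow> br x (br y z) = br y (br x z)"
  using br_br_right[of x y z] by (simp add: br_0_left)

text \<open>The powers of a product of commuting operators split, so ad n ad y is nilpotent and has
  trace zero.\<close>

lemma killing_nilpotent_commute: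
  assumes n: "ad_nilpotent br n" and c: "br n y = 0"
  shows "killing n y = 0"
proof -
  obtain m where m: "\<And>z. (br n ^^ m) z = 0" using n by (auto simp: ad_nilpotent_def)
  have "((\<lambda>z. br n (br y z)) ^^ j) z = (br n ^^ j) ((br y ^^ j) z)" for j z
  proof (induction j arbitrary: z)
    case (Suc j)
    have "br y ((br n ^^ j) w) = (br n ^^ j) (br y w)" for w
      by (rule lin_funpow_commute) (simp add: br_commute[OF c])
    then show ?case by (simp add: Suc)
  qed simp
  then have "((\<lambda>z. br n (br y z)) ^^ m) z = 0" for z by (simp add: m)
  then show ?thesis unfolding killing_def by (rule tr_nilpotent[OF lin_comp[OF lin_br lin_br]])
qed

lemma killing_nilpotent_self: "ad_nilpotent br n \<Longrightarrow> killing n n = 0"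
  by (rule killing_nilpotent_commute) (simp_all add: br_self)

text \<open>Engel's theorem for K acting on W / U, the quotient being expressed by membership in U.
  The relative form serves its own induction, where a subalgebra L acts on K / L, and later the case
  K = W.\<close>

lemma engel:
  assumes "subspace K" "\<And>x y. x \<in> K \<Longrightarrow> y \<in> K \<Longrightarrow> br x y \<in> K"
    and "\<And>x. x \<in> K \<Longrightarrow> ad_nilpotent br x"
    and "subspace W" "subspace U" "U \<subset> W"
    and "\<And>x w. x \<in> K \<Longrightarrow> w \<in> W \<Longrightarrow> br x w \<in> W"
    and "\<And>x u. x \<in> K \<Longrightarrow> u \<in> U \<Longrightarrow> br x u \<in> U"
  shows "\<exists>w\<in>W - U. \<forall>x\<in>K. br x w \<in> U"
  using assms
proof (induction "dim K" arbitrary: K W U rule: less_induct)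
  case less
  show ?case
  proof (cases "K = {0}")
    case True
    obtain w where "w \<in> W - U" using less.prems(6) by blast
    then show ?thesis using True subspace_0[OF less.prems(5)] by (auto simp: br_0_left)
  next
    case False
    \<comment> \<open>A proper subalgebra L of largest dimension; it will have codimension one in
      K.\<close>
    let ?P = "\<lambda>L. subspace L \<and> (\<forall>x\<in>L. \<forall>y\<in>L. br x y \<in> L) \<and> L \<subset> K"
    have "?P {0}" using False subspace_0[OF less.prems(1)] by (auto simp: br_0_left)
    moreover have "\<forall>L. ?P L \<longrightarrow> dim L < Suc (dim K)"
      using dim_subset by (metis less_Suc_eq_le psubset_imp_subset)
    ultimately have "\<exists>L. ?P L \<and> (\<forall>L'. ?P L' \<longrightarrow> dim L' \<le> dim L)"
      by (rule Lattices_Big.ex_has_greatest_nat)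
    then obtain L where L: "?P L" and Lmax: "\<And>L'. ?P L' \<Longrightarrow> dim L' \<le> dim L" by blast
    have dL: "dim L < dim K" using L less.prems(1) by (intro dim_psubset) (simp add: span_eq_iff[THEN iffD2])
    have Lx: "x \<in> K" if "x \<in> L" for x using L that by blast
    \<comment> \<open>Induction for L acting on K / L: some z outside L normalises L.\<close>
    have "\<exists>z\<in>K - L. \<forall>x\<in>L. br x z \<in> L"
      by (rule less.hyps[OF dL]) (use L Lx less.prems in auto)
    then obtain z where z: "z \<in> K" "z \<notin> L" "\<And>x. x \<in> L \<Longrightarrow> br x z \<in> L" by blast
    have zL: "br z x \<in> L" if "x \<in> L" for x
      using z(3)[OF that] br_anti[of z x] subspace_neg L by metis
    let ?M = "span (insert z L)"
    have sL: "span L = L" using L by simp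
    have M: "x \<in> ?M \<longleftrightarrow> (\<exists>k. x - scl k z \<in> L)" for x by (simp add: span_breakdown_eq sL)
    have MK: "?M \<subseteq> K" using z(1) L less.prems(1) by (intro span_minimal) auto
    have "br x y \<in> ?M" if xy: "x \<in> ?M" "y \<in> ?M" for x y
    proof -
      obtain j k where j: "x - scl j z \<in> L" and k: "y - scl k z \<in> L" using xy M by blast
      have "br x y = br (x - scl j z) (y - scl k z) + scl k (br (x - scl j z) z) + scl j (br z (y - scl k z))"
        by (simp add: br_diff_left br_diff_right br_scl_left br_scl_right br_self
            scale_right_diff_distrib algebra_simps)
      also have "\<dots> \<in> L" using L j k z(3) zL by (intro subspace_add subspace_scale) auto
      finally show ?thesis using span_superset[of "insert z L"] by blast
    qed
    moreover have "L \<subset> ?M" using z(2) span_superset[of "insert z L"] by blast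
    then have "dim L < dim ?M" by (intro dim_psubset) (simp only: sL span_span)
    ultimately have "?M = K" using Lmax[of ?M] MK by fastforce
    \<comment> \<open>The vectors sent into U by L. They are stable under z, since z normalises
      L.\<close>
    let ?W = "{w \<in> W. \<forall>x\<in>L. br x w \<in> U}"
    have "\<exists>w\<in>W - U. \<forall>x\<in>L. br x w \<in> U"
      by (rule less.hyps[OF dL]) (use L Lx less.prems in auto)
    then obtain w0 where w0: "w0 \<in> ?W" "w0 \<notin> U" by blast
    have zW: "br z w \<in> ?W" if "w \<in> ?W" for w
    proof -
      have "br x (br z w) \<in> U" if "x \<in> L" for x
        unfolding br_br_right[of x z w]
        using \<open>w \<in> ?W\<close> that z less.prems(8) by (intro subspace_add[OF less.prems(5)]) auto
      then show ?thesis using that z(1) less.prems(7) by auto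
    qed
    have pW: "(br z ^^ m) w0 \<in> ?W" for m by (induction m) (use w0 zW in auto)
    obtain m where "(br z ^^ m) w0 = 0" using less.prems(3)[OF z(1)] by (auto simp: ad_nilpotent_def)
    then have ex: "(br z ^^ m) w0 \<in> U" using subspace_0[OF less.prems(5)] by simp
    \<comment> \<open>The iterate of w0 just before the first one inside U is sent into U by z, and
      also by L.\<close>
    define l where "l = (LEAST m. (br z ^^ m) w0 \<in> U)"
    have l: "(br z ^^ l) w0 \<in> U" unfolding l_def using ex by (rule LeastI)
    have "l \<noteq> 0" using l w0(2) by (metis funpow_0)
    then obtain j where j: "l = Suc j" using not0_implies_Suc by blast
    let ?w = "(br z ^^ j) w0"
    have wU: "?w \<notin> U" using not_less_Least[of j "\<lambda>m. (br z ^^ m) w0 \<in> U"] j l_def by simp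
    have "br x ?w \<in> U" if x: "x \<in> K" for x
    proof -
      obtain k where k: "x - scl k z \<in> L" using x M \<open>?M = K\<close> by blast
      have "br x ?w = br (x - scl k z) ?w + scl k (br z ?w)" by (simp add: br_diff_left br_scl_left)
      also have "\<dots> \<in> U" using pW[of j] k l j
        by (intro subspace_add[OF less.prems(5)] subspace_scale[OF less.prems(5)]) auto
      finally show ?thesis .
    qed
    then show ?thesis using wU pW[of j] by blast
  qed
qed

definition derivation :: "('g \<Rightarrow> 'g) \<Rightarrow> bool" where
  "derivation D \<longleftrightarrow> lin D \<and> (\<forall>x y. D (br x y) = br (D x) y + br x (D y))"

text \<open>Leibniz rule for shifted operators: ad x - (a + b) maps [v, w] to [(ad x - a) v, w] +
  [v, (ad x - b) w], so exponents m and n give m + n.\<close>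

lemma geig_br:
  assumes "v \<in> geig (br x) a" "w \<in> geig (br x) b"
  shows "br v w \<in> geig (br x) (a + b)"
proof -
  have e: "sh (br x) (a + b) (br v w) = br (sh (br x) a v) w + br v (sh (br x) b w)" for v w
    by (simp add: sh_def br_diff_left br_diff_right br_scl_left br_scl_right scale_left_distrib
        br_br_right[of x v w])
  have "(sh (br x) (a + b) ^^ (m + n)) (br v w) = 0"
    if "(sh (br x) a ^^ m) v = 0" "(sh (br x) b ^^ n) w = 0" for m n v w
    using that
  proof (induction "m + n" arbitrary: m n v w)
    case 0
    then show ?case by (simp add: br_0_left)
  next
    case (Suc N)
    note l0 = lin_0[OF lin_funpow[OF lin_sh[OF lin_br]]]
    consider "m = 0" | "n = 0" | m' n' where "m = Suc m'" "n = Suc n'"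
      by (metis not0_implies_Suc)
    then show ?case
    proof cases
      case 3
      have "(sh (br x) (a + b) ^^ N) (br (sh (br x) a v) w) = 0"
        using Suc.hyps(1)[of m' n "sh (br x) a v" w] Suc.hyps(2) Suc.prems 3 by (simp add: funpow_swap1)
      moreover have "(sh (br x) (a + b) ^^ N) (br v (sh (br x) b w)) = 0"
        using Suc.hyps(1)[of m n' v "sh (br x) b w"] Suc.hyps(2) Suc.prems 3 by (simp add: funpow_swap1)
      ultimately show ?thesis
        unfolding Suc.hyps(2)[symmetric] funpow_Suc_right comp_def e
        by (simp add: lin_add[OF lin_funpow[OF lin_sh[OF lin_br]]])
    qed (use Suc.prems in \<open>simp_all add: br_0_left br_0_right l0\<close>)
  qed
  then show ?thesis using assms unfolding geig_def by blast
qed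

lemma linear_on_span:
  assumes "span S = UNIV" "lin F" "lin G" "\<And>x. x \<in> S \<Longrightarrow> F x = G x"
  shows "F v = G v"
  using lin_eq_on_spanning[OF assms(2,3,1,4)] by simp

text \<open>Brackets add the labels of generalised eigenspaces, so additivity of
  \<open>\<phi>\<close> is the Leibniz rule on generalised eigenvectors; these span.\<close>

lemma derivation_functional_calculus:
  assumes D: "lin D" "\<And>a w. w \<in> geig (br x) a \<Longrightarrow> D w = scl (\<phi> a) w"
    and \<phi>: "\<And>a b. \<phi> (a + b) = \<phi> a + \<phi> b"
  shows "derivation D"
proof -
  let ?G = "\<Union>a. geig (br x) a"
  note sp = span_geig[OF ac lin_br]
  note la = lin_add[OF D(1)] note ls = lin_scl[OF D(1)]
  have 1: "D (br v w) = br (D v) w + br v (D w)" if vw: "v \<in> ?G" "w \<in> ?G" for v w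
  proof -
    obtain a b where ab: "v \<in> geig (br x) a" "w \<in> geig (br x) b" using vw by blast
    show ?thesis
      by (simp add: D(2)[OF geig_br[OF ab]] D(2)[OF ab(1)] D(2)[OF ab(2)] \<phi> scale_left_distrib
          br_scl_left br_scl_right)
  qed
  have 2: "D (br v w) = br (D v) w + br v (D w)" if v: "v \<in> ?G" for v w
    by (rule linear_on_span[OF sp, where F = "\<lambda>w. D (br v w)"])
      (auto intro!: linI 1[OF v] simp: la ls br_add_right br_scl_right scale_right_distrib)
  have "D (br v w) = br (D v) w + br v (D w)" for v w
    by (rule linear_on_span[OF sp, where F = "\<lambda>v. D (br v w)"])
      (auto intro!: linI 2 simp: la ls br_add_left br_scl_left scale_right_distrib)
  then show ?thesis using D(1) by (simp add: derivation_def)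
qed

text \<open>D ad[a, b] equals ad(D a) ad b + ad a D ad b - D ad b ad a, and the last two products
  have the same trace.\<close>

lemma tr_derivation_ad_bracket:
  assumes "derivation D"
  shows "tr (\<lambda>v. D (br (br a b) v)) = killing (D a) b"
proof -
  have D: "lin D" and Db: "\<And>x y. D (br x y) = br (D x) y + br x (D y)"
    using assms by (auto simp: derivation_def)
  have "tr (\<lambda>v. br a (D (br b v))) = tr (\<lambda>v. D (br b (br a v)))"
    by (rule tr_comm[OF lin_br lin_comp[OF D lin_br]])
  moreover have "D (br (br a b) v) = br (D a) (br b v) + br a (D (br b v)) - D (br b (br a v))" for v
    using Db[of a "br b v"] by (simp add: br_br_left lin_diff[OF D])
  ultimately show ?thesis by (simp add: killing_def tr_add tr_diff)
qed

end

section \<open>Semisimplicity and the Jordan decomposition\<close>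

locale ss_lie = fd_lie scl Basis br
  for scl :: "'k::field_char_0 \<Rightarrow> 'g::ab_group_add \<Rightarrow> 'g" and Basis br +
  assumes semisimple: "\<And>I. lie_ideal scl br I \<Longrightarrow> solvable scl br I \<Longrightarrow> I = {0}"
begin

text \<open>Cartan's argument: every derivation \<open>D\<close> that is diagonal on the generalised eigenspaces
  of \<open>ad x\<close>, with rational eigenvalues \<open>f a\<close>, pairs to zero with \<open>ad x\<close>.\<close>
lemma ad_nilpotent_of_derivations:
  assumes z: "\<And>D. derivation D \<Longrightarrow> tr (\<lambda>v. D (br x v)) = 0"
  shows "ad_nilpotent br x"
proof -
  let ?T = "br x"
  note sp = span_geig[OF ac lin_br[of x]]
  obtain C where C: "C \<subseteq> (\<Union>a. geig ?T a)" "basis C" using basis_subset_exists[OF sp] .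
  then have "\<forall>c\<in>C. \<exists>a. c \<in> geig ?T a" by blast
  then obtain ev where ev: "\<And>c. c \<in> C \<Longrightarrow> c \<in> geig ?T (ev c)" by metis
  obtain S where S: "lin S" "\<And>a w. w \<in> geig ?T a \<Longrightarrow> S w = scl a w"
    using geig_functional_calculus[OF sp lin_br, of "\<lambda>a. a"] by blast
  have "ev c = 0" if c: "c \<in> C" for c
  proof (rule ccontr)
    assume "ev c \<noteq> 0"
    then obtain f :: "'k \<Rightarrow> rat" where f: "rat_linear f" "f (ev c) \<noteq> 0"
      using rat_linear_exists1 by metis
    let ?\<phi> = "\<lambda>a. of_rat (f a) :: 'k"
    obtain D where D: "lin D" "\<And>a w. w \<in> geig ?T a \<Longrightarrow> D w = scl (?\<phi> a) w"
      using geig_functional_calculus[OF sp lin_br, of ?\<phi>] by blast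
    have "derivation D"
      by (rule derivation_functional_calculus[OF D]) (auto simp: rat_linear_add[OF f(1)] of_rat_add)
    then have 0: "tr (\<lambda>v. D (br x v)) = 0" by (rule z)
    \<comment> \<open>On the generalised a-eigenspace this is a scalar times the nilpotent ad x - a,
      so D ad x and D S have the same trace.\<close>
    let ?N = "\<lambda>v. D (br x v) - D (S v)"
    have lN: "lin ?N"
      by (intro linI) (simp_all add: lin_add[OF D(1)] lin_add[OF S(1)] br_add_right br_scl_right
          lin_scl[OF D(1)] lin_scl[OF S(1)] scale_right_diff_distrib)
    have "\<exists>m. (?N ^^ m) w = 0" if w: "w \<in> (\<Union>a. geig ?T a)" for w
    proof -
      obtain a where a: "w \<in> geig ?T a" using w by blast
      have N: "?N u = scl (?\<phi> a) (sh ?T a u)" if u: "u \<in> geig ?T a" for u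
        using D(2)[OF geig_T[OF lin_br u]] D(2)[OF u] S(2)[OF u]
        by (simp add: sh_def lin_scl[OF D(1)] scale_right_diff_distrib mult.commute)
      have *: "(?N ^^ m) w = scl (?\<phi> a ^ m) ((sh ?T a ^^ m) w) \<and> (sh ?T a ^^ m) w \<in> geig ?T a" for m
      proof (induction m)
        case (Suc m)
        then show ?case
          using N geig_sh[OF lin_br]
          by (simp add: lin_scl[OF lN] mult.commute del: of_rat_power)
      qed (use a in simp)
      obtain m where "(sh ?T a ^^ m) w = 0" using a unfolding geig_def by blast
      then have "(?N ^^ m) w = 0" using *[of m] by simp
      then show ?thesis by blast
    qed
    from nilpotent_uniform[OF lN sp this] have trN: "tr ?N = 0" using tr_nilpotent[OF lN] by blast
    have "tr (\<lambda>v. D (S v)) = (\<Sum>c\<in>C. ?\<phi> (ev c) * ev c)"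
    proof (rule tr_diag[OF C(2) lin_comp[OF D(1) S(1)]])
      show "D (S c) = scl (?\<phi> (ev c) * ev c) c" if "c \<in> C" for c
        using D(2)[OF ev[OF that]] S(2)[OF ev[OF that]] by (simp add: lin_scl[OF D(1)] mult.commute)
    qed
    moreover have "tr (\<lambda>v. D (S v)) = 0" using trN 0 by (simp add: tr_diff)
    \<comment> \<open>Applying f once more turns the trace into a sum of rational squares, so every
      f (ev c) vanishes.\<close>
    ultimately have "f (\<Sum>c\<in>C. ?\<phi> (ev c) * ev c) = 0" by (simp add: rat_linear_0[OF f(1)])
    then have "(\<Sum>c\<in>C. f (ev c) * f (ev c)) = 0"
      by (simp add: rat_linear_sum[OF f(1)] rat_linear_of_rat[OF f(1)])
    then have "f (ev c) * f (ev c) = 0"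
      using basis_finite[OF C(2)] c by (subst (asm) sum_nonneg_eq_0_iff) auto
    then show False using f(2) by simp
  qed
  then have "c \<in> geig ?T 0" if "c \<in> C" for c using ev that by metis
  then have "\<exists>m. (br x ^^ m) c = 0" if "c \<in> C" for c
    using that unfolding geig_def by (force simp: sh_def[abs_def])
  then show ?thesis using C(2) ad_nilpotent_span unfolding basis_def by blast
qed

text \<open>Cartan's criterion. The radical R of the form is an ideal whose derived series
  stabilises at some S = [S, S]. Elements of S are ad-nilpotent, and Engel's theorem then excludes S
  = [S, S] unless S = 0. So R is solvable, hence zero.\<close>

lemma killing_nondegenerate:
  assumes "\<And>y. killing x y = 0" shows "x = 0"
proof -
  define R where "R = {x. \<forall>y. killing x y = 0}"
  let ?d = "derived scl br R"
  have dS: "?d (Suc n) = span {br x y | x y. x \<in> ?d n \<and> y \<in> ?d n}" for n by simp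
  have sR: "subspace R"
    unfolding R_def by (rule subspaceI) (auto simp: killing_0_left killing_add_left killing_scl_left)
  have iR: "br x y \<in> R" if "y \<in> R" for x y
    using that unfolding R_def by (auto simp: killing_inv[of x y])
  have ideal: "subspace (?d n) \<and> (\<forall>x y. y \<in> ?d n \<longrightarrow> br x y \<in> ?d n)" for n
  proof (induction n)
    case (Suc n)
    have "br x y \<in> ?d (Suc n)" if "y \<in> ?d (Suc n)" for x y
      using that unfolding dS
    proof (induction rule: span_induct)
      case base
      show ?case
        by (rule subspaceI) (auto simp: br_0_right br_add_right br_scl_right
            intro: span_zero span_add span_scale)
    next
      case (step y)
      then obtain a b where ab: "y = br a b" "a \<in> ?d n" "b \<in> ?d n" by blast
      have "br x y = br (br x a) b + br a (br x b)" unfolding ab(1) by (rule br_br_right)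
      moreover have "br (br x a) b \<in> span {br x y | x y. x \<in> ?d n \<and> y \<in> ?d n}"
        "br a (br x b) \<in> span {br x y | x y. x \<in> ?d n \<and> y \<in> ?d n}"
        using ab Suc.IH by (blast intro: span_base)+
      ultimately show ?case using span_add by (simp only:)
    qed
    then show ?case unfolding dS by blast
  qed (use sR iR in auto)
  have mono: "?d (Suc n) \<subseteq> ?d n" for n
    unfolding dS using ideal[of n] by (intro span_minimal) auto
  have "\<exists>n. dim (?d n) \<le> dim (?d (Suc n))"
  proof (rule ccontr)
    assume "\<nexists>n. dim (?d n) \<le> dim (?d (Suc n))"
    then have less: "dim (?d (Suc n)) < dim (?d n)" for n by (simp add: not_le)
    have "dim (?d n) + n \<le> dim (?d 0)" for n
    proof (induction n)
      case (Suc n) then show ?case using less[of n] by linarith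
    qed simp
    from this[of "Suc (dim (?d 0))"] show False by simp
  qed
  then obtain n where n: "dim (?d n) \<le> dim (?d (Suc n))" by blast
  define S where "S = ?d n"
  have eq: "?d (Suc n) = S"
    unfolding S_def using ideal mono n by (intro subspace_dim_equal) auto
  have sS: "subspace S" and iS: "\<And>x y. y \<in> S \<Longrightarrow> br x y \<in> S" using ideal[of n] S_def by auto
  have SR: "S \<subseteq> R"
  proof -
    have "?d m \<subseteq> R" for m using mono by (induction m) auto
    then show ?thesis by (simp add: S_def)
  qed
  have Sb: "S = span {br x y | x y. x \<in> S \<and> y \<in> S}" using eq unfolding dS S_def by simp
  have nil: "ad_nilpotent br x" if "x \<in> S" for x
  proof (rule ad_nilpotent_of_derivations)
    fix D assume D: "derivation D"
    then have lD: "lin D" by (simp add: derivation_def)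
    from that have "x \<in> span {br x y | x y. x \<in> S \<and> y \<in> S}" using Sb by simp
    then show "tr (\<lambda>v. D (br x v)) = 0"
    proof (induction rule: span_induct)
      case base
      have "tr (\<lambda>v. D (br 0 v)) = 0" using tr_scl[of 0 "\<lambda>v. v"] by (simp add: br_0_left lin_0[OF lD])
      then show ?case
        by (intro subspaceI)
          (auto simp: br_add_left lin_add[OF lD] tr_add br_scl_left lin_scl[OF lD] tr_scl)
    next
      case (step y)
      then obtain a b where ab: "y = br a b" "a \<in> S" "b \<in> S" by blast
      \<comment> \<open>b lies in R. This uses that S is spanned by brackets of its own
        elements.\<close>
      then have "killing b (D a) = 0" using SR R_def by blast
      then show ?case using ab tr_derivation_ad_bracket[OF D] by (simp add: killing_sym)
    qed
  qed
  have "S = {0}"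
  proof (rule ccontr)
    assume S0: "S \<noteq> {0}"
    \<comment> \<open>A largest proper S-stable subspace U. Engel's theorem makes it a hyperplane of
      S containing [S, S], which is S itself.\<close>
    let ?P = "\<lambda>U. subspace U \<and> (\<forall>x\<in>S. \<forall>u\<in>U. br x u \<in> U) \<and> U \<subset> S"
    have "?P {0}" using S0 subspace_0[OF sS] by (auto simp: br_0_right)
    moreover have "\<forall>U. ?P U \<longrightarrow> dim U < Suc (dim S)"
      using dim_subset by (metis less_Suc_eq_le psubset_imp_subset)
    ultimately have "\<exists>U. ?P U \<and> (\<forall>U'. ?P U' \<longrightarrow> dim U' \<le> dim U)"
      by (rule Lattices_Big.ex_has_greatest_nat)
    then obtain U where U: "?P U" and Umax: "\<And>U'. ?P U' \<Longrightarrow> dim U' \<le> dim U" by blast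
    have "\<exists>w\<in>S - U. \<forall>x\<in>S. br x w \<in> U"
      by (rule engel[OF sS _ nil sS]) (use U iS in auto)
    then obtain w where w: "w \<in> S" "w \<notin> U" "\<And>x. x \<in> S \<Longrightarrow> br x w \<in> U" by blast
    let ?M = "span (insert w U)"
    have sU: "span U = U" using U by simp
    have M: "x \<in> ?M \<longleftrightarrow> (\<exists>k. x - scl k w \<in> U)" for x by (simp add: span_breakdown_eq sU)
    have MS: "?M \<subseteq> S" using w(1) U sS by (intro span_minimal) auto
    have brM: "br x y \<in> U" if x: "x \<in> S" and y: "y \<in> ?M" for x y
    proof -
      obtain k where k: "y - scl k w \<in> U" using y M by blast
      have "br x y = br x (y - scl k w) + scl k (br x w)" by (simp add: br_diff_right br_scl_right)
      also have "\<dots> \<in> U" using k U w(3)[OF x] x by (intro subspace_add subspace_scale) auto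
      finally show ?thesis .
    qed
    have "U \<subseteq> ?M" using span_superset[of "insert w U"] by blast
    then have "br x y \<in> ?M" if "x \<in> S" "y \<in> ?M" for x y using brM[OF that] by blast
    moreover have "U \<subset> ?M" using w(2) span_superset[of "insert w U"] by blast
    then have "dim U < dim ?M" by (intro dim_psubset) (simp only: sU span_span)
    ultimately have "?M = S" using Umax[of ?M] MS by fastforce
    then have "{br x y | x y. x \<in> S \<and> y \<in> S} \<subseteq> U" using brM by blast
    then have "S \<subseteq> U" using Sb span_minimal[of _ U] U by blast
    then show False using U by blast
  qed
  then have "solvable scl br R" unfolding solvable_def S_def by blast
  moreover have "lie_ideal scl br R" using sR iR by (simp add: lie_ideal_def)
  ultimately have "R = {0}" using semisimple by blast
  then show ?thesis using assms unfolding R_def by blast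
qed

lemma center_trivial: "(\<And>y. br x y = 0) \<Longrightarrow> x = 0"
  using killing_nondegenerate[of x] tr_scl[of 0 "\<lambda>v. v"] by (simp add: killing_def)

text \<open>The functional z |-> tr (D ad z) is represented by some s. Since tr (D ad[w, z]) = B(D
  w, z), invariance of B gives B(D w - [s, w], z) = 0 for all z.\<close>

lemma derivation_inner:
  assumes D: "derivation D" obtains s where "\<And>y. D y = br s y"
proof -
  have lD: "lin D" and Db: "\<And>x y. D (br x y) = br (D x) y + br x (D y)"
    using D by (auto simp: derivation_def)
  have "linf (\<lambda>z. tr (\<lambda>v. D (br z v)))"
    by (rule linfI) (simp_all add: br_add_left br_scl_left lin_add[OF lD] lin_scl[OF lD] tr_add tr_scl)
  then obtain s where s: "\<And>z. killing s z = tr (\<lambda>v. D (br z v))"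
    using nondegenerate_represents[of killing, OF killing_linf_right killing_linf killing_nondegenerate]
    by metis
  have "D w - br s w = 0" for w
  proof (rule killing_nondegenerate)
    fix z
    have "killing (D w) z = killing s (br w z)"
      using s tr_derivation_ad_bracket[OF D] by metis
    then show "killing (D w - br s w) z = 0"
      by (simp add: killing_diff_left killing_assoc)
  qed
  then show thesis using that by simp
qed

text \<open>The semisimple part of ad x scales generalised eigenspaces by the identity function,
  which is additive; so it is a derivation, hence inner. The first conclusion is the handle for
  commutation and for involutions.\<close>

lemma jordan_decomposition:
  obtains s where "\<And>a w. w \<in> geig (br x) a \<Longrightarrow> br s w = scl a w"
    "semisimple_elem scl br s" "ad_nilpotent br (x - s)"
proof -
  note sp = span_geig[OF ac lin_br[of x]]
  obtain D where D: "lin D" "\<And>a w. w \<in> geig (br x) a \<Longrightarrow> D w = scl a w"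
    using geig_functional_calculus[OF sp lin_br, of "\<lambda>a. a"] by blast
  have "derivation D" by (rule derivation_functional_calculus[OF D]) auto
  then obtain s where "\<And>y. D y = br s y" using derivation_inner by blast
  then have s: "br s w = scl a w" if "w \<in> geig (br x) a" for a w using D(2) that by simp
  have "(\<Union>a. geig (br x) a) \<subseteq> {y. \<exists>c. br s y = scl c y}" using s by blast
  then have "semisimple_elem scl br s"
    unfolding semisimple_elem_def using span_mono sp by blast
  moreover have "ad_nilpotent br (x - s)"
  proof (rule ad_nilpotent_span[OF sp])
    fix w assume "w \<in> (\<Union>a. geig (br x) a)"
    then obtain a where a: "w \<in> geig (br x) a" by blast
    have *: "(br (x - s) ^^ m) w = (sh (br x) a ^^ m) w \<and> (sh (br x) a ^^ m) w \<in> geig (br x) a" for m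
    proof (induction m)
      case (Suc m)
      then have "br (x - s) ((sh (br x) a ^^ m) w) = sh (br x) a ((sh (br x) a ^^ m) w)"
        using s[of "(sh (br x) a ^^ m) w"] by (simp add: br_diff_left sh_def[of _ _ "(sh (br x) a ^^ m) w"])
      then show ?case using Suc geig_sh[OF lin_br] by simp
    qed (use a in simp)
    obtain m where "(sh (br x) a ^^ m) w = 0" using a unfolding geig_def by blast
    then show "\<exists>m. (br (x - s) ^^ m) w = 0" using *[of m] by auto
  qed
  ultimately show thesis using that s by blast
qed

end

section \<open>Exponentials and inner automorphisms\<close>

text \<open>A separate locale because exponentials are taken in two spaces: the Lie algebra and the
  scalar functions on families of its vectors.\<close>

locale vector_space_0 = vector_space scl
  for scl :: "'k::field_char_0 \<Rightarrow> 'b::ab_group_add \<Rightarrow> 'b"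
begin

definition dexp :: "('b \<Rightarrow> 'b) \<Rightarrow> nat \<Rightarrow> 'b \<Rightarrow> 'b" where
  "dexp N n v = scl (1 / of_nat (fact n)) ((N ^^ n) v)"

context
  fixes A B :: "'b \<Rightarrow> 'b"
  assumes Aa: "\<And>x y. A (x + y) = A x + A y" and As: "\<And>c x. A (scl c x) = scl c (A x)"
    and Ba: "\<And>x y. B (x + y) = B x + B y" and Bs: "\<And>c x. B (scl c x) = scl c (B x)"
    and AB: "\<And>x. A (B x) = B (A x)"
begin

lemma dexp_Suc:
  assumes "\<And>c x. N (scl c x) = scl c (N x)"
  shows "N (dexp N n v) = scl (of_nat (Suc n)) (dexp N (Suc n) v)"
proof -
  have "of_nat (Suc n) * (1 / of_nat (fact (Suc n)) :: 'k) = 1 / of_nat (fact n)"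
    by (simp only: fact_Suc of_nat_id of_nat_mult) (simp del: of_nat_Suc)
  then show ?thesis by (simp add: dexp_def assms del: of_nat_Suc fact_Suc)
qed

lemma dexp_scl:
  assumes "\<And>c x. N (scl c x) = scl c (N x)"
  shows "dexp N n (scl c v) = scl c (dexp N n v)"
proof -
  have "(N ^^ n) (scl c v) = scl c ((N ^^ n) v)" by (induction n) (simp_all add: assms)
  then show ?thesis by (simp add: dexp_def mult.commute)
qed

lemma sum_map:
  assumes "\<And>x y. N (x + y) = N x + N y" "\<And>c x. N (scl c x) = scl c (N x)"
  shows "N (sum h I) = (\<Sum>i\<in>I. N (h i))"
proof -
  have "N 0 = 0" using assms(2)[of 0 0] by simp
  then show ?thesis by (induction I rule: infinite_finite_induct) (simp_all add: assms)
qed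

text \<open>The binomial formula, free of coefficients for divided powers. Multiplied by n + 1, it
  follows by adding the weights k from A and n + 1 - k from B.\<close>

lemma dexp_add: "dexp (\<lambda>v. A v + B v) n v = (\<Sum>k\<le>n. dexp A k (dexp B (n - k) v))"
proof (induction n)
  case 0
  show ?case by (simp add: dexp_def)
next
  case (Suc n)
  let ?F = "\<lambda>k j. dexp A k (dexp B j v)"
  have Bk: "B ((A ^^ k) x) = (A ^^ k) (B x)" for k x by (induction k) (simp_all add: AB[symmetric])
  then have BA: "B (dexp A k x) = dexp A k (B x)" for k x by (simp add: dexp_def Bs)
  have BF: "B (?F k j) = scl (of_nat (Suc j)) (?F k (Suc j))" for k j
    by (simp add: BA dexp_Suc[OF Bs] dexp_scl[OF As] del: of_nat_Suc)
  have "scl (of_nat (Suc n)) (dexp (\<lambda>v. A v + B v) (Suc n) v)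
      = A (dexp (\<lambda>v. A v + B v) n v) + B (dexp (\<lambda>v. A v + B v) n v)"
    by (rule dexp_Suc[symmetric]) (simp add: As Bs scale_right_distrib)
  also have "\<dots> = (\<Sum>k\<le>n. A (?F k (n - k))) + (\<Sum>k\<le>n. B (?F k (n - k)))"
    by (simp add: Suc.IH sum_map[OF Aa As] sum_map[OF Ba Bs])
  also have "(\<Sum>k\<le>n. A (?F k (n - k))) = (\<Sum>k\<le>Suc n. scl (of_nat k) (?F k (Suc n - k)))"
    by (subst sum.atMost_Suc_shift) (simp add: dexp_Suc[OF As] del: of_nat_Suc)
  also have "(\<Sum>k\<le>n. B (?F k (n - k))) = (\<Sum>k\<le>Suc n. scl (of_nat (Suc n - k)) (?F k (Suc n - k)))"
    by (simp add: BF Suc_diff_le del: of_nat_Suc of_nat_diff)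
  also have "(\<Sum>k\<le>Suc n. scl (of_nat k) (?F k (Suc n - k))) + \<dots>
      = (\<Sum>k\<le>Suc n. scl (of_nat (Suc n)) (?F k (Suc n - k)))"
    unfolding sum.distrib[symmetric] scale_left_distrib[symmetric] of_nat_add[symmetric]
    by (intro sum.cong) auto
  also have "\<dots> = scl (of_nat (Suc n)) (\<Sum>k\<le>Suc n. ?F k (Suc n - k))"
    by (rule scale_sum_right[symmetric])
  finally show ?case using of_nat_neq_0[of n, where 'a = 'k] unfolding scale_cancel_left by blast
qed

context
  fixes v a b
  assumes van: "\<And>k j. a \<le> k \<or> b \<le> j \<Longrightarrow> (A ^^ k) ((B ^^ j) v) = 0"
begin

lemma dexp_dexp_zero: "a \<le> k \<or> b \<le> j \<Longrightarrow> dexp A k (dexp B j v) = 0"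
  using van[of k j] dexp_scl[OF As, of k "1 / of_nat (fact j)" "(B ^^ j) v"]
  by (simp add: dexp_def[of B] ) (simp add: dexp_def)

lemma funpow_add_zero:
  assumes "a + b \<le> n" shows "((\<lambda>v. A v + B v) ^^ n) v = 0"
proof -
  have "dexp (\<lambda>v. A v + B v) n v = 0"
    unfolding dexp_add using assms by (intro sum.neutral ballI dexp_dexp_zero) auto
  then show ?thesis by (simp add: dexp_def)
qed

text \<open>The triangle k + j < K contains the a by b rectangle outside which all terms vanish, so
  truncated exponentials multiply exactly. Nilpotency is asked at v alone: slot operators are
  nilpotent on multilinear forms but not on all functions.\<close>

lemma exp_add:
  assumes "a + b \<le> K"
  shows "(\<Sum>n<K. dexp (\<lambda>v. A v + B v) n v) = (\<Sum>k<a. \<Sum>j<b. dexp A k (dexp B j v))"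
proof -
  let ?F = "\<lambda>k j. dexp A k (dexp B j v)"
  have sub: "{..<a} \<times> {..<b} \<subseteq> {(k, j). k + j < K}" using assms by auto
  have fin: "finite {(k, j). k + j < K}"
    by (rule finite_subset[of _ "{..<K} \<times> {..<K}"]) auto
  have "(\<Sum>n<K. dexp (\<lambda>v. A v + B v) n v) = (\<Sum>(k, j)\<in>{(k, j). k + j < K}. ?F k j)"
    unfolding dexp_add by (rule sum.triangle_reindex[symmetric])
  also have "\<dots> = (\<Sum>(k, j)\<in>{..<a} \<times> {..<b}. ?F k j)"
    using fin sub by (intro sum.mono_neutral_right) (auto simp: not_less intro!: dexp_dexp_zero)
  finally show ?thesis by (simp add: sum.cartesian_product)
qed

end
end
end

lemma sum_fun_apply: "(\<Sum>i\<in>I. F i) x = (\<Sum>i\<in>I. F i x)"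
  for F :: "'i \<Rightarrow> 'a \<Rightarrow> 'b::comm_monoid_add"
  by (induction I rule: infinite_finite_induct) auto

context fd_lie
begin

section \<open>Multilinear forms and their derivatives\<close>

definition slot_lin :: "'i set \<Rightarrow> (('i \<Rightarrow> 'g) \<Rightarrow> 'k) \<Rightarrow> bool" where
  "slot_lin I \<Theta> \<longleftrightarrow> (\<forall>i\<in>I. \<forall>w. linf (\<lambda>x. \<Theta> (w(i := x))))"

definition slot :: "'i \<Rightarrow> 'g \<Rightarrow> (('i \<Rightarrow> 'g) \<Rightarrow> 'k) \<Rightarrow> ('i \<Rightarrow> 'g) \<Rightarrow> 'k" where
  "slot i x \<Theta> w = \<Theta> (w(i := br x (w i)))"

text \<open>The derivative at t = 0 of \<open>\<Theta>\<close>(exp(t ad x) w), the exponential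
  acting in every slot of I: an algebraic stand-in for a vector field on the group.\<close>

definition Dv :: "'i set \<Rightarrow> 'g \<Rightarrow> (('i \<Rightarrow> 'g) \<Rightarrow> 'k) \<Rightarrow> ('i \<Rightarrow> 'g) \<Rightarrow> 'k" where
  "Dv I x \<Theta> w = (\<Sum>i\<in>I. slot i x \<Theta> w)"

definition on_slots :: "'i set \<Rightarrow> ('g \<Rightarrow> 'g) \<Rightarrow> ('i \<Rightarrow> 'g) \<Rightarrow> 'i \<Rightarrow> 'g" where
  "on_slots S E w i = (if i \<in> S then E (w i) else w i)"

lemma slot_linD: "slot_lin I \<Theta> \<Longrightarrow> i \<in> I \<Longrightarrow> linf (\<lambda>x. \<Theta> (w(i := x)))"
  by (simp add: slot_lin_def)

lemma linf_comp_lin: "linf l \<Longrightarrow> lin T \<Longrightarrow> linf (\<lambda>x. l (T x))"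
  by (simp add: linf_def lin_def)

lemma slot_lin_slot:
  assumes "slot_lin I \<Theta>" shows "slot_lin I (slot i x \<Theta>)"
  unfolding slot_lin_def
proof (intro ballI allI)
  fix j w assume j: "j \<in> I"
  show "linf (\<lambda>y. slot i x \<Theta> (w(j := y)))"
  proof (cases "i = j")
    case True
    then show ?thesis
      using linf_comp_lin[OF slot_linD[OF assms j] lin_br] by (simp add: slot_def)
  next
    case False
    then have "slot i x \<Theta> (w(j := y)) = \<Theta> ((w(i := br x (w i)))(j := y))" for y
      by (simp add: slot_def fun_upd_twist)
    then show ?thesis using slot_linD[OF assms j] by simp
  qed
qed

lemma slot_lin_add: "slot_lin I \<Theta> \<Longrightarrow> slot_lin I \<Theta>' \<Longrightarrow> slot_lin I (\<Theta> + \<Theta>')"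
  by (auto simp: slot_lin_def linf_def algebra_simps)

lemma slot_lin_0: "slot_lin I 0"
  by (auto simp: slot_lin_def linf_def)

lemma slot_lin_sum: "(\<And>i. i \<in> S \<Longrightarrow> slot_lin I (F i)) \<Longrightarrow> slot_lin I (\<Sum>i\<in>S. F i)"
  by (induction S rule: infinite_finite_induct) (auto simp: slot_lin_add slot_lin_0)

lemma Dv_sum: "Dv S x \<Theta> = (\<Sum>i\<in>S. slot i x \<Theta>)"
  by (rule ext) (simp add: Dv_def sum_fun_apply)

lemma slot_lin_Dv: "slot_lin I \<Theta> \<Longrightarrow> slot_lin I (Dv S x \<Theta>)"
  unfolding Dv_sum by (intro slot_lin_sum slot_lin_slot)

lemma slot_lin_scl: "slot_lin I \<Theta> \<Longrightarrow> slot_lin I (\<lambda>w. c * \<Theta> w)"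
  by (auto simp: slot_lin_def linf_def algebra_simps)

sublocale forms: vector_space_0 "\<lambda>(c::'k) (\<Theta>::('i \<Rightarrow> 'g) \<Rightarrow> 'k) w. c * \<Theta> w"
  by unfold_locales (auto simp: fun_eq_iff algebra_simps)

sublocale elems: vector_space_0 scl ..

lemma slot_additive: "slot i x (\<Theta> + \<Theta>') = slot i x \<Theta> + slot i x \<Theta>'"
  by (rule ext) (simp add: slot_def)

lemma slot_scl: "slot i x (\<lambda>w. c * \<Theta> w) = (\<lambda>w. c * slot i x \<Theta> w)"
  by (rule ext) (simp add: slot_def)

lemma Dv_additive: "Dv S x (\<Theta> + \<Theta>') = Dv S x \<Theta> + Dv S x \<Theta>'"
  by (rule ext) (simp add: Dv_def slot_additive sum.distrib)

lemma Dv_scl: "Dv S x (\<lambda>w. c * \<Theta> w) = (\<lambda>w. c * Dv S x \<Theta> w)"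
  by (rule ext) (simp add: Dv_def slot_scl sum_distrib_left)

lemma Dv_0: "Dv S x 0 = 0" and Dv_zero: "Dv S x (\<lambda>_. 0) = (\<lambda>_. 0)"
  by (rule ext, simp add: Dv_def slot_def)+

lemma slot_funpow: "(slot i x ^^ k) \<Theta> w = \<Theta> (w(i := (br x ^^ k) (w i)))"
  by (induction k arbitrary: w) (simp_all add: slot_def funpow_swap1[of "br x"])

lemma slot_lin_funpow: "slot_lin I \<Theta> \<Longrightarrow> slot_lin I ((slot i x ^^ k) \<Theta>)"
  by (induction k) (simp_all add: slot_lin_slot)

text \<open>Operators in different slots commute, so the exponential of their sum is the product of
  the slotwise exponentials. The bounds are strict so that the zeroth term is present even when S is
  empty.\<close>

lemma multi_exp:
  fixes \<Theta> :: "('i \<Rightarrow> 'g) \<Rightarrow> 'k"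
  assumes "finite S" "S \<subseteq> I" "slot_lin I \<Theta>" and nil: "\<And>z. (br n ^^ m) z = 0"
  shows "card S * m < k \<Longrightarrow> (Dv S n ^^ k) \<Theta> = 0"
    and "card S * m < K \<Longrightarrow>
      (\<Sum>k<K. forms.dexp (Dv S n) k \<Theta>) w = \<Theta> (on_slots S (\<lambda>y. \<Sum>j<m. elems.dexp (br n) j y) w)"
proof -
  let ?E = "\<lambda>y. \<Sum>j<m. elems.dexp (br n) j y"
  have "(\<forall>k>card S * m. (Dv S n ^^ k) \<Theta> = 0) \<and>
      (\<forall>K>card S * m. \<forall>w. (\<Sum>k<K. forms.dexp (Dv S n) k \<Theta>) w = \<Theta> (on_slots S ?E w))"
    using assms(1-3)
  proof (induction S arbitrary: \<Theta> rule: finite_induct)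
    case empty
    have D0: "Dv {} n \<Theta>' = 0" for \<Theta>' :: "('i \<Rightarrow> 'g) \<Rightarrow> 'k" by (rule ext) (simp add: Dv_def)
    then have z: "(Dv {} n ^^ k) \<Theta> = 0" if "0 < k" for k using that by (cases k) simp_all
    have "(\<Sum>k<K. forms.dexp (Dv {} n) k \<Theta>) w = \<Theta> (on_slots {} ?E w)" if K: "0 < K" for K w
    proof -
      obtain K' where K': "K = Suc K'" using K by (cases K) auto
      have "forms.dexp (Dv {} n) 0 \<Theta> = \<Theta>" by (simp add: forms.dexp_def)
      moreover have "forms.dexp (Dv {} n) (Suc k) \<Theta> = 0" for k
        using D0 by (simp add: forms.dexp_def fun_eq_iff)
      ultimately have "(\<Sum>k<K. forms.dexp (Dv {} n) k \<Theta>) = \<Theta>"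
        unfolding K' by (subst sum.lessThan_Suc_shift) simp
      then show ?thesis by (simp add: on_slots_def[abs_def])
    qed
    then show ?case using z by simp
  next
    case (insert i S)
    let ?A = "Dv S n" and ?B = "slot i n"
    \<comment> \<open>The induction hypothesis holds strictly above \<open>card S * m\<close>, hence
      the successor.\<close>
    let ?a = "Suc (card S * m)"
    have Dsum: "Dv (insert i S) n = (\<lambda>\<Theta>. ?A \<Theta> + ?B \<Theta>)"
      using insert.hyps by (intro ext) (simp add: Dv_def)
    have comm: "?A (?B \<Theta>') = ?B (?A \<Theta>')" for \<Theta>' :: "('i \<Rightarrow> 'g) \<Rightarrow> 'k"
    proof (rule ext)
      fix w
      show "?A (?B \<Theta>') w = ?B (?A \<Theta>') w"
        using insert.hyps(2) by (auto simp: Dv_def slot_def fun_upd_twist intro!: sum.cong)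
    qed
    have Bl: "slot_lin I ((?B ^^ j) \<Theta>)" for j using insert.prems(2) by (rule slot_lin_funpow)
    have SI: "S \<subseteq> I" "i \<in> I" using insert.prems(1) by auto
    have B0: "(?B ^^ j) \<Theta> = 0" if "m \<le> j" for j
    proof (rule ext)
      fix w
      have "(br n ^^ j) (w i) = 0" using funpow_zero_mono[OF lin_br nil that] .
      moreover have "\<Theta> (w(i := 0)) = 0" by (rule linf_0[OF slot_linD[OF insert.prems(2) SI(2)]])
      ultimately show "(?B ^^ j) \<Theta> w = 0 w" by (simp add: slot_funpow)
    qed
    have A0: "(?A ^^ k) 0 = 0" for k by (induction k) (simp_all add: Dv_0 Dv_zero)
    have van: "(?A ^^ k) ((?B ^^ j) \<Theta>) = 0" if "?a \<le> k \<or> m \<le> j" for k j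
      using that insert.IH[OF SI(1) Bl[of j]] B0[of j] A0[of k] by (auto simp: Suc_le_eq)
    have card: "card (insert i S) * m < k \<longleftrightarrow> ?a + m \<le> k" for k using insert.hyps by auto
    note e = Dv_additive[of S n] Dv_scl[of S n] slot_additive[of i n] slot_scl[of i n] comm van
    have 1: "(Dv (insert i S) n ^^ k) \<Theta> = 0" if "card (insert i S) * m < k" for k
      unfolding Dsum by (rule forms.funpow_add_zero[OF e iffD1[OF card that]])
    have "(\<Sum>k<K. forms.dexp (Dv (insert i S) n) k \<Theta>) w = \<Theta> (on_slots (insert i S) ?E w)"
      if K: "card (insert i S) * m < K" for K w
    proof -
      have IH: "(\<Sum>k<?a. forms.dexp ?A k (forms.dexp ?B j \<Theta>)) w = forms.dexp ?B j \<Theta> (on_slots S ?E w)" for j w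
      proof -
        have "slot_lin I (forms.dexp ?B j \<Theta>)"
          unfolding forms.dexp_def by (rule slot_lin_scl[OF Bl])
        then show ?thesis using insert.IH[OF SI(1)] by blast
      qed
      have "(\<Sum>k<K. forms.dexp (Dv (insert i S) n) k \<Theta>) = (\<Sum>k<?a. \<Sum>j<m. forms.dexp ?A k (forms.dexp ?B j \<Theta>))"
        unfolding Dsum by (rule forms.exp_add[OF e iffD1[OF card K]])
      also have "\<dots> = (\<Sum>j<m. \<Sum>k<?a. forms.dexp ?A k (forms.dexp ?B j \<Theta>))" by (rule sum.swap)
      finally have "(\<Sum>k<K. forms.dexp (Dv (insert i S) n) k \<Theta>) w
          = (\<Sum>j<m. forms.dexp ?B j \<Theta> (on_slots S ?E w))"
        by (simp only: sum_fun_apply[of _ "{..<m}"] IH)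
      also have "\<dots> = (\<Sum>j<m. \<Theta> ((on_slots S ?E w)(i := elems.dexp (br n) j (w i))))"
      proof -
        have "\<Theta> (v(i := scl c x)) = c * \<Theta> (v(i := x))" for v c x
          by (rule linf_scl[OF slot_linD[OF insert.prems(2) SI(2)]])
        then have "forms.dexp ?B j \<Theta> v = \<Theta> (v(i := elems.dexp (br n) j (v i)))" for j v
          by (simp only: forms.dexp_def elems.dexp_def slot_funpow)
        moreover have "on_slots S ?E w i = w i" using insert.hyps(2) by (simp add: on_slots_def)
        ultimately show ?thesis by simp
      qed
      also have "\<dots> = \<Theta> ((on_slots S ?E w)(i := ?E (w i)))"
        by (rule linf_sum[OF slot_linD[OF insert.prems(2) SI(2)], symmetric])
      also have "(on_slots S ?E w)(i := ?E (w i)) = on_slots (insert i S) ?E w"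
        by (rule ext) (simp add: on_slots_def)
      finally show ?thesis .
    qed
    then show ?case using 1 by blast
  qed
  then show "card S * m < k \<Longrightarrow> (Dv S n ^^ k) \<Theta> = 0"
    and "card S * m < K \<Longrightarrow>
      (\<Sum>k<K. forms.dexp (Dv S n) k \<Theta>) w = \<Theta> (on_slots S ?E w)" by blast+
qed

lemma exp_ad_dexp:
  assumes "ad_nilpotent br n"
  obtains m where "\<And>z. (br n ^^ m) z = 0" "exp_ad scl br n = (\<lambda>y. \<Sum>j<m. elems.dexp (br n) j y)"
proof -
  let ?m = "LEAST m. \<forall>z. (br n ^^ m) z = 0"
  have "\<forall>z. (br n ^^ ?m) z = 0"
    using assms unfolding ad_nilpotent_def by (rule LeastI_ex)
  moreover have "exp_ad scl br n = (\<lambda>y. \<Sum>j<?m. elems.dexp (br n) j y)"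
    by (rule ext) (simp add: exp_ad_def elems.dexp_def)
  ultimately show thesis using that by blast
qed

text \<open>Taylor expansion along one exponential at a time: the value at exp(ad n) w is a finite
  combination of values at w of iterated derivatives, which stay in J.\<close>

lemma inner_auts_vanish:
  fixes J :: "(('i \<Rightarrow> 'g) \<Rightarrow> 'k) set"
  assumes I: "finite I" and \<phi>: "\<phi> \<in> inner_auts scl br"
    and J: "\<And>\<Theta>. \<Theta> \<in> J \<Longrightarrow> slot_lin I \<Theta>" "\<And>\<Theta> z. \<Theta> \<in> J \<Longrightarrow> Dv I z \<Theta> \<in> J" "\<And>\<Theta>. \<Theta> \<in> J \<Longrightarrow> \<Theta> u = 0"
  shows "\<Theta> \<in> J \<Longrightarrow> \<Theta> (on_slots I \<phi> u) = 0"
  using \<phi>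
proof (induction arbitrary: \<Theta>)
  case id
  then show ?case using J(3) by (simp add: on_slots_def[abs_def])
next
  case (step \<phi> n)
  obtain m where m: "\<And>z. (br n ^^ m) z = 0" "exp_ad scl br n = (\<lambda>y. \<Sum>j<m. elems.dexp (br n) j y)"
    using exp_ad_dexp[OF step.hyps(2)] by blast
  have e: "on_slots I (exp_ad scl br n \<circ> \<phi>) u = on_slots I (exp_ad scl br n) (on_slots I \<phi> u)"
    by (rule ext) (simp add: on_slots_def)
  have JD: "(Dv I n ^^ k) \<Theta> \<in> J" for k by (induction k) (simp_all add: step.prems J(2))
  have "\<Theta> (on_slots I (exp_ad scl br n) (on_slots I \<phi> u))
      = (\<Sum>k<Suc (card I * m). forms.dexp (Dv I n) k \<Theta>) (on_slots I \<phi> u)"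
    unfolding m(2) by (rule multi_exp(2)[OF I order_refl J(1)[OF step.prems] m(1), symmetric]) simp
  also have "\<dots> = 0"
    unfolding sum_fun_apply using step.IH[OF JD] by (simp add: forms.dexp_def)
  finally show ?case unfolding e .
qed

text \<open>All Taylor coefficients of positive order vanish, so no exponential changes the
  value.\<close>

lemma inner_auts_invariant:
  fixes \<Theta> :: "('i \<Rightarrow> 'g) \<Rightarrow> 'k"
  assumes I: "finite I" and \<phi>: "\<phi> \<in> inner_auts scl br"
    and \<Theta>: "slot_lin I \<Theta>" "\<And>z. Dv I z \<Theta> = 0"
  shows "\<Theta> (on_slots I \<phi> u) = \<Theta> u"
  using \<phi>
proof induction
  case id
  then show ?case by (simp add: on_slots_def[abs_def])
next
  case (step \<phi> n)
  obtain m where m: "\<And>z. (br n ^^ m) z = 0" "exp_ad scl br n = (\<lambda>y. \<Sum>j<m. elems.dexp (br n) j y)"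
    using exp_ad_dexp[OF step.hyps(2)] by blast
  have e: "on_slots I (exp_ad scl br n \<circ> \<phi>) u = on_slots I (exp_ad scl br n) (on_slots I \<phi> u)"
    by (rule ext) (simp add: on_slots_def)
  have D0: "(Dv I n ^^ Suc k) \<Theta> = 0" for k
  proof (induction k)
    case 0
    show ?case using \<Theta>(2) by (simp only: funpow.simps comp_def id_apply)
  next
    case (Suc k)
    have "(Dv I n ^^ Suc (Suc k)) \<Theta> = Dv I n ((Dv I n ^^ Suc k) \<Theta>)" by simp
    then show ?case by (simp only: Suc Dv_0)
  qed
  have d: "forms.dexp (Dv I n) 0 \<Theta> = \<Theta>" "forms.dexp (Dv I n) (Suc k) \<Theta> = (\<lambda>_. 0)" for k
    by (simp add: forms.dexp_def) (simp only: forms.dexp_def D0, simp)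
  have "\<Theta> (on_slots I (exp_ad scl br n) (on_slots I \<phi> u))
      = (\<Sum>k<Suc (card I * m). forms.dexp (Dv I n) k \<Theta>) (on_slots I \<phi> u)"
    unfolding m(2) by (rule multi_exp(2)[OF I order_refl \<Theta>(1) m(1), symmetric]) simp
  also have "\<dots> = \<Theta> (on_slots I \<phi> u)"
    unfolding sum_fun_apply by (subst sum.lessThan_Suc_shift) (simp add: d)
  finally show ?case unfolding e using step.IH by simp
qed

text \<open>The two arguments become slots indexed by False and True; infinitesimal invariance of
  the form says that its derivative vanishes.\<close>

lemma killing_inner_auts:
  assumes "\<phi> \<in> inner_auts scl br" shows "killing (\<phi> x) (\<phi> y) = killing x y"
proof -
  let ?\<Theta> = "\<lambda>w. killing (w False) (w True)"
  have "slot_lin UNIV ?\<Theta>"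
    unfolding slot_lin_def
  proof (intro ballI allI)
    fix i :: bool and w
    show "linf (\<lambda>x. killing ((w(i := x)) False) ((w(i := x)) True))"
      by (cases i) (simp_all add: killing_linf killing_linf_right)
  qed
  moreover have "Dv UNIV z ?\<Theta> = 0" for z
    by (rule ext) (simp add: Dv_def slot_def UNIV_bool killing_inv)
  ultimately have "?\<Theta> (on_slots UNIV \<phi> (case_bool y x)) = ?\<Theta> (case_bool y x)"
    by (rule inner_auts_invariant[OF finite_UNIV assms])
  then show ?thesis by (simp add: on_slots_def)
qed

lemma inner_auts_comp:
  "\<phi> \<in> inner_auts scl br \<Longrightarrow> \<psi> \<in> inner_auts scl br \<Longrightarrow> \<phi> \<circ> \<psi> \<in> inner_auts scl br"
proof (induction rule: inner_auts.induct)
  case (step \<phi> x)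
  from inner_auts.step[OF step.IH[OF step.prems] step.hyps(2)]
  show ?case by (simp only: comp_assoc)
qed simp

text \<open>ad(-n) and ad n commute with sum zero, so their exponentials multiply to the exponential
  of the zero operator.\<close>

lemma exp_ad_neg:
  assumes n: "ad_nilpotent br n"
  shows "ad_nilpotent br (- n)" "exp_ad scl br (- n) (exp_ad scl br n y) = y"
proof -
  have p: "(br (- n) ^^ k) z = scl ((-1) ^ k) ((br n ^^ k) z)" for k z
    by (induction k arbitrary: z) (simp_all add: br_neg_left br_scl_right)
  then show n': "ad_nilpotent br (- n)" using n by (auto simp: ad_nilpotent_def)
  obtain m where m: "\<And>z. (br n ^^ m) z = 0" "exp_ad scl br n = (\<lambda>y. \<Sum>j<m. elems.dexp (br n) j y)"
    using exp_ad_dexp[OF n] by blast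
  obtain m' where m': "\<And>z. (br (- n) ^^ m') z = 0" "exp_ad scl br (- n) = (\<lambda>y. \<Sum>j<m'. elems.dexp (br (- n)) j y)"
    using exp_ad_dexp[OF n'] by blast
  note lp = lin_funpow[OF lin_br]
  have van: "(br (- n) ^^ k) ((br n ^^ j) y) = 0" if "m' \<le> k \<or> m \<le> j" for k j
    using that funpow_zero_mono[OF lin_br m(1)] funpow_zero_mono[OF lin_br m'(1)] lin_0[OF lp] by metis
  have comm: "br (- n) (br n x) = br n (br (- n) x)" for x by (simp add: br_neg_left br_neg_right)
  have dl: "lin (elems.dexp (br (- n)) k)" for k
    by (intro linI) (simp_all add: elems.dexp_def lin_add[OF lp] lin_scl[OF lp] scale_right_distrib mult.commute)
  have "exp_ad scl br (- n) (exp_ad scl br n y) = (\<Sum>k<m'. \<Sum>j<m. elems.dexp (br (- n)) k (elems.dexp (br n) j y))"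
    unfolding m(2) m'(2) by (simp add: lin_sum[OF dl])
  also have "\<dots> = (\<Sum>k<Suc (m' + m). elems.dexp (\<lambda>v. br (- n) v + br n v) k y)"
    by (rule elems.exp_add[OF br_add_right br_scl_right br_add_right br_scl_right comm van, symmetric]) auto
  also have "\<dots> = y"
  proof -
    have z: "((\<lambda>v. br (- n) v + br n v) ^^ Suc k) y = 0" for k by (simp add: br_neg_left)
    have "elems.dexp (\<lambda>v. br (- n) v + br n v) 0 y = y"
      "elems.dexp (\<lambda>v. br (- n) v + br n v) (Suc k) y = 0" for k
      by (simp add: elems.dexp_def) (simp only: elems.dexp_def z scale_zero_right)
    then show ?thesis by (subst sum.lessThan_Suc_shift) simp
  qed
  finally show "exp_ad scl br (- n) (exp_ad scl br n y) = y" .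
qed

lemma inner_auts_inverse:
  assumes "\<phi> \<in> inner_auts scl br"
  shows "\<exists>\<psi>\<in>inner_auts scl br. \<psi> \<circ> \<phi> = id \<and> \<phi> \<circ> \<psi> = id"
  using assms
proof induction
  case id
  then show ?case using inner_auts.id by (intro bexI[of _ id]) auto
next
  case (step \<phi> n)
  then obtain \<psi> where \<psi>: "\<psi> \<in> inner_auts scl br" "\<psi> \<circ> \<phi> = id" "\<phi> \<circ> \<psi> = id" by blast
  let ?e = "exp_ad scl br n" and ?e' = "exp_ad scl br (- n)"
  have e: "?e' \<circ> ?e = id" "?e \<circ> ?e' = id"
    using exp_ad_neg(2)[OF step.hyps(2)] exp_ad_neg(2)[OF exp_ad_neg(1)[OF step.hyps(2)]] by (auto simp: fun_eq_iff)
  have "?e' \<in> inner_auts scl br"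
    using inner_auts.step[OF inner_auts.id exp_ad_neg(1)[OF step.hyps(2)]] by simp
  then have "\<psi> \<circ> ?e' \<in> inner_auts scl br" using \<psi>(1) by (rule inner_auts_comp[rotated])
  moreover have "\<psi> \<circ> ?e' \<circ> (?e \<circ> \<phi>) = id" "?e \<circ> \<phi> \<circ> (\<psi> \<circ> ?e') = id"
    using \<psi>(2,3) e by (metis comp_assoc comp_id)+
  ultimately show ?case by blast
qed

end

section \<open>Alternating forms and determinants\<close>

lemma sum_slots: "(\<Sum>i\<in>C \<times> B. h i) = (\<Sum>c\<in>C. \<Sum>b\<in>B. h (c, b))"
  using sum.cartesian_product[of "\<lambda>c b. h (c, b)" B C] by simp

context fd_lie
begin

definition alternating :: "'i set \<Rightarrow> (('i \<Rightarrow> 'g) \<Rightarrow> 'k) \<Rightarrow> bool" where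
  "alternating A \<Theta> \<longleftrightarrow> (\<forall>w. \<forall>i\<in>A. \<forall>j\<in>A. i \<noteq> j \<longrightarrow> w i = w j \<longrightarrow> \<Theta> w = 0)"

lemma alternatingD: "alternating A \<Theta> \<Longrightarrow> i \<in> A \<Longrightarrow> j \<in> A \<Longrightarrow> i \<noteq> j \<Longrightarrow> w i = w j \<Longrightarrow> \<Theta> w = 0"
  by (auto simp: alternating_def)

lemma slot_lin_add_at: "slot_lin I \<Theta> \<Longrightarrow> i \<in> I \<Longrightarrow> \<Theta> (w(i := x + y)) = \<Theta> (w(i := x)) + \<Theta> (w(i := y))"
  by (rule linf_add[OF slot_linD])

lemma slot_lin_sum_at:
  assumes "slot_lin I \<Theta>" "i \<in> I"
  shows "\<Theta> (w(i := (\<Sum>j\<in>S. scl (r j) (v j)))) = (\<Sum>j\<in>S. r j * \<Theta> (w(i := v j)))"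
proof -
  note l = slot_linD[OF assms, of w]
  have "\<Theta> (w(i := (\<Sum>j\<in>S. scl (r j) (v j)))) = (\<Sum>j\<in>S. \<Theta> (w(i := scl (r j) (v j))))"
    by (rule linf_sum[OF l])
  also have "\<dots> = (\<Sum>j\<in>S. r j * \<Theta> (w(i := v j)))"
    by (rule sum.cong[OF refl]) (rule linf_scl[OF l])
  finally show ?thesis .
qed

lemma alternating_swap:
  assumes l: "slot_lin I \<Theta>" and A: "A \<subseteq> I" and alt: "alternating A \<Theta>" and ij: "i \<in> A" "j \<in> A" "i \<noteq> j"
  shows "\<Theta> (w(i := a, j := b)) + \<Theta> (w(i := b, j := a)) = 0"
proof -
  have iI: "i \<in> I" "j \<in> I" using A ij by auto
  have tw: "\<Theta> (w(i := p, j := q)) = \<Theta> (w(j := q, i := p))" for p q using ij by (simp add: fun_upd_twist)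
  have z: "\<Theta> (w(i := p, j := p)) = 0" for p by (rule alternatingD[OF alt ij]) (use ij in simp)
  have "0 = \<Theta> (w(i := a + b, j := a + b))" by (simp only: z)
  also have "\<dots> = \<Theta> (w(i := a + b, j := a)) + \<Theta> (w(i := a + b, j := b))"
    by (rule slot_lin_add_at[OF l iI(2)])
  also have "\<dots> = \<Theta> (w(j := a, i := a + b)) + \<Theta> (w(j := b, i := a + b))" by (simp only: tw)
  also have "\<dots> = \<Theta> (w(j := a, i := a)) + \<Theta> (w(j := a, i := b)) + (\<Theta> (w(j := b, i := a)) + \<Theta> (w(j := b, i := b)))"
    by (simp only: slot_lin_add_at[OF l iI(1)])
  also have "\<dots> = \<Theta> (w(i := a, j := b)) + \<Theta> (w(i := b, j := a))" by (simp only: tw[symmetric] z) simp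
  finally show ?thesis by simp
qed

text \<open>Terms that alter neither i nor j still have equal entries there; the terms at i and j
  cancel by antisymmetry.\<close>

lemma alternating_Dv:
  assumes I: "finite I" and l: "slot_lin I \<Theta>" and A: "A \<subseteq> I" and alt: "alternating A \<Theta>"
  shows "alternating A (Dv I x \<Theta>)"
  unfolding alternating_def
proof (intro allI ballI impI)
  fix w :: "'a \<Rightarrow> 'g" and i j assume ij: "i \<in> A" "j \<in> A" "i \<noteq> j" and w: "w i = w j"
  have z: "slot k x \<Theta> w = 0" if "k \<notin> {i, j}" for k
    unfolding slot_def by (rule alternatingD[OF alt ij]) (use that w in auto)
  have "Dv I x \<Theta> w = (\<Sum>k\<in>{i, j}. slot k x \<Theta> w)"
    unfolding Dv_def using I A ij z by (intro sum.mono_neutral_right) auto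
  also have "\<dots> = \<Theta> (w(i := br x (w i))) + \<Theta> (w(j := br x (w i)))" using ij w by (simp add: slot_def)
  also have "w(i := br x (w i)) = w(i := br x (w i), j := w i)"
    using w ij(3) by (auto simp: fun_eq_iff)
  also have "w(j := br x (w i)) = w(i := w i, j := br x (w i))" by simp
  finally show "Dv I x \<Theta> w = 0" by (simp only: alternating_swap[OF l A alt ij])
qed

text \<open>Only the diagonal coefficient survives in slot i, since every other one repeats a vector
  of u. This is the source of semi-invariance under Q.\<close>

lemma alternating_trace:
  assumes A: "finite A" "A \<subseteq> I" and l: "slot_lin I \<Theta>" and alt: "alternating A \<Theta>"
    and m: "\<And>i. i \<in> A \<Longrightarrow> br x (u i) = (\<Sum>j\<in>A. scl (M i j) (u j))"
  shows "(\<Sum>i\<in>A. slot i x \<Theta> u) = (\<Sum>i\<in>A. M i i) * \<Theta> u"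
  unfolding sum_distrib_right
proof (rule sum.cong[OF refl])
  fix i assume i: "i \<in> A"
  have "slot i x \<Theta> u = (\<Sum>j\<in>A. M i j * \<Theta> (u(i := u j)))"
    unfolding slot_def m[OF i] using A i by (intro slot_lin_sum_at[OF l]) auto
  also have "\<dots> = (\<Sum>j\<in>A. if j = i then M i i * \<Theta> u else 0)"
  proof (rule sum.cong[OF refl])
    fix j assume j: "j \<in> A"
    show "M i j * \<Theta> (u(i := u j)) = (if j = i then M i i * \<Theta> u else 0)"
      using alternatingD[OF alt i j, of "u(i := u j)"] by auto
  qed
  finally show "slot i x \<Theta> u = M i i * \<Theta> u" using A i by simp
qed

lemma Dv_add_left:
  assumes "slot_lin I \<Theta>" shows "Dv I (x + y) \<Theta> = Dv I x \<Theta> + Dv I y \<Theta>"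
proof (rule ext)
  fix w
  have "slot i (x + y) \<Theta> w = slot i x \<Theta> w + slot i y \<Theta> w" if "i \<in> I" for i
    unfolding slot_def br_add_left by (rule slot_lin_add_at[OF assms that])
  then show "Dv I (x + y) \<Theta> w = (Dv I x \<Theta> + Dv I y \<Theta>) w"
    by (simp add: Dv_def sum.distrib)
qed

text \<open>The bracket is [y, x] because ad acts on the arguments of \<open>\<Theta>\<close>:
  derivatives form an anti-representation.\<close>

lemma Dv_commutator:
  assumes I: "finite I" and l: "slot_lin I \<Theta>"
  shows "Dv I x (Dv I y \<Theta>) = Dv I y (Dv I x \<Theta>) + Dv I (br y x) \<Theta>"
proof (rule ext)
  fix w
  let ?T = "\<lambda>x y j i. slot i y \<Theta> (w(j := br x (w j)))"
  have e: "?T x y j i = ?T y x i j + (if i = j then slot j (br y x) \<Theta> w else 0)" if j: "j \<in> I" for i j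
  proof (cases "i = j")
    case True
    have "\<Theta> (w(j := br x (br y (w j)) + br (br y x) (w j))) =
        \<Theta> (w(j := br x (br y (w j)))) + \<Theta> (w(j := br (br y x) (w j)))"
      by (rule slot_lin_add_at[OF l j])
    moreover have "br y (br x (w j)) = br x (br y (w j)) + br (br y x) (w j)"
      using br_br_left[of y x "w j"] by simp
    ultimately show ?thesis using True by (simp add: slot_def)
  next
    case False
    then show ?thesis by (simp add: slot_def fun_upd_twist)
  qed
  have "Dv I x (Dv I y \<Theta>) w = (\<Sum>j\<in>I. \<Sum>i\<in>I. ?T x y j i)"
    by (simp add: Dv_def slot_def)
  also have "\<dots> = (\<Sum>j\<in>I. \<Sum>i\<in>I. ?T y x i j) + (\<Sum>j\<in>I. \<Sum>i\<in>I. if i = j then slot j (br y x) \<Theta> w else 0)"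
    unfolding sum.distrib[symmetric] using e by (intro sum.cong) auto
  also have "(\<Sum>j\<in>I. \<Sum>i\<in>I. if i = j then slot j (br y x) \<Theta> w else 0) = Dv I (br y x) \<Theta> w"
    using I by (simp add: Dv_def)
  also have "(\<Sum>j\<in>I. \<Sum>i\<in>I. ?T y x i j) = (\<Sum>j\<in>I. \<Sum>i\<in>I. ?T y x j i)"
    by (rule sum.swap)
  also have "\<dots> = Dv I y (Dv I x \<Theta>) w"
    by (simp add: Dv_def slot_def)
  finally show "Dv I x (Dv I y \<Theta>) w = (Dv I y (Dv I x \<Theta>) + Dv I (br y x) \<Theta>) w" by simp
qed

text \<open>Derivatives of order n, graded to allow induction on n. Sums are included because
  commutators produce them, the zero form in every order because invariant directions do.\<close>

inductive iterD :: "'i set \<Rightarrow> (('i \<Rightarrow> 'g) \<Rightarrow> 'k) \<Rightarrow> nat \<Rightarrow> (('i \<Rightarrow> 'g) \<Rightarrow> 'k) \<Rightarrow> bool"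
  for I :: "'i set" and \<Phi> where
  zero: "iterD I \<Phi> n (\<lambda>_. 0)"
| base: "iterD I \<Phi> 0 \<Phi>"
| step: "iterD I \<Phi> n \<Theta> \<Longrightarrow> iterD I \<Phi> (Suc n) (Dv I z \<Theta>)"
| add: "iterD I \<Phi> n \<Theta> \<Longrightarrow> iterD I \<Phi> n \<Theta>' \<Longrightarrow> iterD I \<Phi> n (\<Theta> + \<Theta>')"

lemma iterD_slot_lin: "iterD I \<Phi> n \<Theta> \<Longrightarrow> slot_lin I \<Phi> \<Longrightarrow> slot_lin I \<Theta>"
  by (induction rule: iterD.induct)
    (auto simp: slot_lin_Dv slot_lin_add slot_lin_0[unfolded zero_fun_def])

lemma iterD_alternating:
  assumes "iterD I \<Phi> n \<Theta>" "finite I" "slot_lin I \<Phi>" "A \<subseteq> I" "alternating A \<Phi>"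
  shows "alternating A \<Theta>"
  using assms(1)
proof (induction rule: iterD.induct)
  case (step n \<Theta> z)
  then show ?case using alternating_Dv[OF assms(2) iterD_slot_lin[OF _ assms(3)] assms(4)] by blast
qed (use assms(5) in \<open>auto simp: alternating_def\<close>)

text \<open>An invariant direction is moved past the other derivatives until it meets
  \<open>\<Phi>\<close>. Each commutator merges two derivatives into one, so the order does not
  rise.\<close>

lemma iterD_invariant:
  assumes "iterD I \<Phi> n \<Theta>" "finite I" "slot_lin I \<Phi>" and \<kappa>: "Dv I \<kappa> \<Phi> = (\<lambda>_. 0)"
  shows "iterD I \<Phi> n (Dv I \<kappa> \<Theta>)"
  using assms(1)
proof (induction rule: iterD.induct)
  case (zero n)
  then show ?case by (simp add: Dv_zero iterD.zero)
next
  case base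
  then show ?case by (simp add: \<kappa> iterD.zero)
next
  case (step n \<Theta> z)
  show ?case
    by (subst Dv_commutator[OF assms(2) iterD_slot_lin[OF step.hyps assms(3)]])
      (intro iterD.add iterD.step step)
next
  case (add n \<Theta> \<Theta>')
  then show ?case unfolding Dv_additive by (intro iterD.add)
qed

text \<open>Infinitesimal form of the fact that a left \<open>K\<close>-invariant, right \<open>Q\<close>-semi-invariant function
  on the group is determined on the dense subset \<open>K Q\<close> by its value at the identity.\<close>
lemma iterD_vanish:
  assumes I: "finite I" and l: "slot_lin I \<Phi>"
    and dec: "\<And>z. \<exists>\<kappa> q. z = \<kappa> + q \<and> Dv I \<kappa> \<Phi> = (\<lambda>_. 0) \<and>
        (\<forall>n \<Theta>. iterD I \<Phi> n \<Theta> \<longrightarrow> (\<exists>c. Dv I q \<Theta> u = c * \<Theta> u))"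
    and u: "\<Phi> u = 0" and \<Theta>: "iterD I \<Phi> n \<Theta>"
  shows "\<Theta> u = 0"
  using \<Theta>
proof (induction n arbitrary: \<Theta>)
  case 0
  then show ?case by (induction "0::nat" \<Theta> rule: iterD.induct) (auto simp: u)
next
  case (Suc n)
  from Suc.prems show ?case
  proof (induction "Suc n" \<Theta> rule: iterD.induct)
    case (step \<Theta> z)
    \<comment> \<open>Neither part escapes the induction hypothesis: the derivative along
      \<open>\<kappa>\<close> is again of order n, and the one along q is at u a multiple of the
      value of \<open>\<Theta>\<close>.\<close>
    obtain \<kappa> q c where z: "z = \<kappa> + q" "Dv I \<kappa> \<Phi> = (\<lambda>_. 0)" "Dv I q \<Theta> u = c * \<Theta> u"
      using dec[of z] step.hyps(1) by blast
    have "Dv I z \<Theta> u = Dv I \<kappa> \<Theta> u + Dv I q \<Theta> u"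
      unfolding z(1) by (simp add: Dv_add_left[OF iterD_slot_lin[OF step.hyps(1) l]])
    also have "\<dots> = 0"
      using Suc.IH[OF iterD_invariant[OF step.hyps(1) I l z(2)]] Suc.IH[OF step.hyps(1)] z(3) by simp
    finally show ?case .
  qed auto
qed

text \<open>The derivatives of \<open>\<Phi>\<close> of all orders form a set closed under
  derivation whose members vanish at u, as the Taylor argument requires.\<close>

lemma iterD_inner_vanish:
  assumes I: "finite I" and l: "slot_lin I \<Phi>"
    and dec: "\<And>z. \<exists>\<kappa> q. z = \<kappa> + q \<and> Dv I \<kappa> \<Phi> = (\<lambda>_. 0) \<and>
        (\<forall>n \<Theta>. iterD I \<Phi> n \<Theta> \<longrightarrow> (\<exists>c. Dv I q \<Theta> u = c * \<Theta> u))"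
    and u: "\<Phi> u = 0" and \<phi>: "\<phi> \<in> inner_auts scl br"
  shows "\<Phi> (on_slots I \<phi> u) = 0"
proof (rule inner_auts_vanish[OF I \<phi>, of "{\<Theta>. \<exists>n. iterD I \<Phi> n \<Theta>}"])
  show "\<Theta> \<in> {\<Theta>. \<exists>n. iterD I \<Phi> n \<Theta>} \<Longrightarrow> \<Theta> u = 0" for \<Theta>
    using iterD_vanish[OF I l dec u] by blast
qed (use iterD_slot_lin[OF _ l] iterD.step iterD.base in blast)+

section \<open>Gram determinants as multilinear forms\<close>

definition dterm :: "('g \<Rightarrow> 'g \<Rightarrow> 'k) \<Rightarrow> 'g set \<Rightarrow> ('g \<Rightarrow> 'g) \<Rightarrow> ('g \<times> bool \<Rightarrow> 'g) \<Rightarrow> 'k" where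
  "dterm \<beta> C p w = (\<Prod>c\<in>C. \<beta> (w (c, False)) (w (p c, True)))"

text \<open>The Leibniz determinant of the matrix with entries
  \<open>\<beta> (w (c, False)) (w (d, True))\<close>. Rows and columns have slots of their own, so
  the column vectors may be a different family.\<close>

definition detform :: "('g \<Rightarrow> 'g \<Rightarrow> 'k) \<Rightarrow> 'g set \<Rightarrow> ('g \<times> bool \<Rightarrow> 'g) \<Rightarrow> 'k" where
  "detform \<beta> C w = (\<Sum>p | p permutes C. of_int (sign p) * dterm \<beta> C p w)"

context
  fixes C :: "'g set" and \<beta> :: "'g \<Rightarrow> 'g \<Rightarrow> 'k"
  assumes C: "finite C" and b1: "\<And>x. linf (\<beta> x)" and b2: "\<And>y. linf (\<lambda>x. \<beta> x y)"
begin

lemma dterm_upd_left: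
  assumes "c0 \<in> C"
  shows "dterm \<beta> C p (w((c0, False) := y))
    = \<beta> y (w (p c0, True)) * (\<Prod>c\<in>C - {c0}. \<beta> (w (c, False)) (w (p c, True)))"
proof -
  have "(\<Prod>c\<in>C - {c0}. \<beta> ((w((c0, False) := y)) (c, False)) ((w((c0, False) := y)) (p c, True)))
      = (\<Prod>c\<in>C - {c0}. \<beta> (w (c, False)) (w (p c, True)))"
    by (rule prod.cong) auto
  then show ?thesis unfolding dterm_def by (subst prod.remove[OF C assms]) simp
qed

lemma dterm_upd_right:
  assumes "c0 \<in> C" and p: "p permutes C"
  shows "dterm \<beta> C p (w((p c0, True) := y))
    = \<beta> (w (c0, False)) y * (\<Prod>c\<in>C - {c0}. \<beta> (w (c, False)) (w (p c, True)))"
proof -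
  have "p c \<noteq> p c0" if "c \<noteq> c0" for c using permutes_inj[OF p] that by (auto dest: injD)
  then have "(\<Prod>c\<in>C - {c0}. \<beta> ((w((p c0, True) := y)) (c, False)) ((w((p c0, True) := y)) (p c, True)))
      = (\<Prod>c\<in>C - {c0}. \<beta> (w (c, False)) (w (p c, True)))"
    by (intro prod.cong) auto
  then show ?thesis unfolding dterm_def by (subst prod.remove[OF C assms(1)]) simp
qed

lemma detform_slot_lin: "slot_lin (C \<times> UNIV) (detform \<beta> C)"
  unfolding slot_lin_def
proof (intro ballI allI)
  fix s w assume "s \<in> C \<times> (UNIV :: bool set)"
  then obtain c b where s: "s = (c, b)" "c \<in> C" by blast
  have lc: "linf (\<lambda>x. l x * r)" if "linf l" for l r
    using that by (auto simp: linf_def distrib_right)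
  have t: "linf (\<lambda>x. dterm \<beta> C p (w(s := x)))" if p: "p permutes C" for p
  proof (cases b)
    case True
    obtain c0 where c0: "c0 \<in> C" "p c0 = c" using p s(2) by (metis permutes_inv permutes_in_image permutes_inverses(1))
    show ?thesis
      using dterm_upd_right[OF c0(1) p, of w] lc[OF b1] True c0(2) by (simp add: s(1))
  next
    case False
    show ?thesis
      unfolding s(1) using False by (simp add: dterm_upd_left[OF s(2)] lc[OF b2])
  qed
  show "linf (\<lambda>x. detform \<beta> C (w(s := x)))"
    unfolding detform_def
    by (rule linfI)
      (simp_all add: linf_add[OF t] linf_scl[OF t] distrib_left sum.distrib sum_distrib_left mult.left_commute)
qed

text \<open>Composing p on the right with the transposition preserves the product and flips the
  sign, so the determinant is its own negative.\<close>

lemma detform_alternating_left: "alternating (C \<times> {False}) (detform \<beta> C)"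
  unfolding alternating_def
proof (intro allI ballI impI)
  fix w :: "'g \<times> bool \<Rightarrow> 'g" and i j
  assume "i \<in> C \<times> {False}" "j \<in> C \<times> {False}" "i \<noteq> j" and w: "w i = w j"
  then obtain a b where ab: "i = (a, False)" "j = (b, False)" "a \<in> C" "b \<in> C" "a \<noteq> b" by blast
  let ?t = "transpose a b"
  have t: "?t permutes C" using ab by (intro permutes_swap_id)
  have wt: "w (?t c, False) = w (c, False)" for c using w ab by (auto simp: transpose_def)
  have dt: "dterm \<beta> C (p \<circ> ?t) w = dterm \<beta> C p w" if p: "p permutes C" for p
  proof -
    have "dterm \<beta> C p w = (\<Prod>c\<in>C. \<beta> (w (?t c, False)) (w (p (?t c), True)))"
      unfolding dterm_def by (rule prod.permute[OF t, unfolded comp_def])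
    then show ?thesis by (simp add: dterm_def wt)
  qed
  have sg: "sign (p \<circ> ?t) = - sign p" if p: "p permutes C" for p
    using sign_compose[of p ?t] permutation_permutes C p t ab(5) by (auto simp: sign_swap_id)
  have "detform \<beta> C w = (\<Sum>p | p permutes C. of_int (sign (p \<circ> ?t)) * dterm \<beta> C (p \<circ> ?t) w)"
    unfolding detform_def by (rule sum_permutations_compose_right[OF t])
  also have "\<dots> = - detform \<beta> C w"
    unfolding detform_def sum_negf[symmetric] by (rule sum.cong) (auto simp: sg dt)
  finally show "detform \<beta> C w = 0" by simp
qed

lemma detform_alternating_right: "alternating (C \<times> {True}) (detform \<beta> C)"
  unfolding alternating_def
proof (intro allI ballI impI)
  fix w :: "'g \<times> bool \<Rightarrow> 'g" and i j
  assume "i \<in> C \<times> {True}" "j \<in> C \<times> {True}" "i \<noteq> j" and w: "w i = w j"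
  then obtain a b where ab: "i = (a, True)" "j = (b, True)" "a \<in> C" "b \<in> C" "a \<noteq> b" by blast
  let ?t = "transpose a b"
  have t: "?t permutes C" using ab by (intro permutes_swap_id)
  have wt: "w (?t c, True) = w (c, True)" for c using w ab by (auto simp: transpose_def)
  have dt: "dterm \<beta> C (?t \<circ> p) w = dterm \<beta> C p w" for p by (simp add: dterm_def wt)
  have sg: "sign (?t \<circ> p) = - sign p" if p: "p permutes C" for p
    using sign_compose[of ?t p] permutation_permutes C p t ab(5) by (auto simp: sign_swap_id)
  have "detform \<beta> C w = (\<Sum>p | p permutes C. of_int (sign (?t \<circ> p)) * dterm \<beta> C (?t \<circ> p) w)"
    unfolding detform_def by (rule setum_permutations_compose_left[OF t])
  also have "\<dots> = - detform \<beta> C w"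
    unfolding detform_def sum_negf[symmetric] by (rule sum.cong) (auto simp: sg dt)
  finally show "detform \<beta> C w = 0" by simp
qed

text \<open>In the term of p, the derivatives at (c, False) and (p c, True) hit the same factor and
  cancel; hence the column sum is reindexed by p.\<close>

lemma detform_invariant:
  assumes inv: "\<And>v w. \<beta> (br \<kappa> v) w + \<beta> v (br \<kappa> w) = 0"
  shows "Dv (C \<times> UNIV) \<kappa> (detform \<beta> C) = (\<lambda>_. 0)"
proof (rule ext)
  fix w
  let ?L = "\<lambda>p c. dterm \<beta> C p (w((c, False) := br \<kappa> (w (c, False))))"
  let ?R = "\<lambda>p c. dterm \<beta> C p (w((c, True) := br \<kappa> (w (c, True))))"
  have z: "(\<Sum>c\<in>C. ?L p c) + (\<Sum>c\<in>C. ?R p c) = 0" if p: "p permutes C" for p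
  proof -
    have "(\<Sum>c\<in>C. ?R p c) = (\<Sum>c\<in>C. ?R p (p c))" by (rule sum.permute[OF p, unfolded comp_def])
    moreover have "?L p c + ?R p (p c) = 0" if "c \<in> C" for c
      unfolding dterm_upd_left[OF that] dterm_upd_right[OF that p] distrib_right[symmetric] inv by simp
    ultimately show ?thesis by (simp add: sum.distrib[symmetric])
  qed
  have "Dv (C \<times> UNIV) \<kappa> (detform \<beta> C) w
      = (\<Sum>c\<in>C. detform \<beta> C (w((c, False) := br \<kappa> (w (c, False)))) + detform \<beta> C (w((c, True) := br \<kappa> (w (c, True)))))"
    unfolding Dv_def slot_def sum_slots by (simp add: UNIV_bool)
  also have "\<dots> = (\<Sum>p | p permutes C. of_int (sign p) * ((\<Sum>c\<in>C. ?L p c) + (\<Sum>c\<in>C. ?R p c)))"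
    unfolding detform_def sum.distrib distrib_left sum_distrib_left
    by (simp add: sum.swap[of _ C])
  also have "\<dots> = 0" using z by (intro sum.neutral) simp
  finally show "Dv (C \<times> UNIV) \<kappa> (detform \<beta> C) w = 0" .
qed

lemma Dv_bialternating_trace:
  assumes l: "slot_lin (C \<times> UNIV) \<Theta>" and alt: "alternating (C \<times> {False}) \<Theta>" "alternating (C \<times> {True}) \<Theta>"
    and m: "\<And>c b. c \<in> C \<Longrightarrow> br q (u (c, b)) = (\<Sum>c'\<in>C. scl (M b c c') (u (c', b)))"
  shows "Dv (C \<times> UNIV) q \<Theta> u = ((\<Sum>c\<in>C. M False c c) + (\<Sum>c\<in>C. M True c c)) * \<Theta> u"
proof -
  have tr: "(\<Sum>i\<in>C \<times> {b}. slot i q \<Theta> u) = (\<Sum>c\<in>C. M b c c) * \<Theta> u" for b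
  proof -
    have "(\<Sum>i\<in>C \<times> {b}. slot i q \<Theta> u) = (\<Sum>i\<in>C \<times> {b}. M b (fst i) (fst i)) * \<Theta> u"
    proof (rule alternating_trace[where I = "C \<times> UNIV" and M = "\<lambda>i j. M b (fst i) (fst j)"])
      show "alternating (C \<times> {b}) \<Theta>" using alt by (cases b) auto
      show "br q (u i) = (\<Sum>j\<in>C \<times> {b}. scl (M b (fst i) (fst j)) (u j))" if "i \<in> C \<times> {b}" for i
        using that m[of "fst i" b] by (auto simp: sum_slots)
    qed (use C l in auto)
    then show ?thesis by (simp add: sum_slots)
  qed
  have "C \<times> UNIV = C \<times> {False} \<union> C \<times> {True}" by (auto intro: bool.exhaust)
  then have "Dv (C \<times> UNIV) q \<Theta> u = (\<Sum>i\<in>C \<times> {False}. slot i q \<Theta> u) + (\<Sum>i\<in>C \<times> {True}. slot i q \<Theta> u)"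
    unfolding Dv_def using C by (simp only:) (intro sum.union_disjoint, auto)
  then show ?thesis by (simp only: tr distrib_right)
qed

text \<open>Contrapositive of the vanishing principle: \<open>\<kappa>\<close> annihilates the
  determinant by infinitesimal invariance of \<open>\<beta>\<close>, and q preserves both spans, so
  it multiplies the value at u of every derivative by a trace.\<close>

lemma detform_inner_nonzero:
  assumes dec: "\<And>z. \<exists>\<kappa> q. z = \<kappa> + q \<and> (\<forall>v w. \<beta> (br \<kappa> v) w + \<beta> v (br \<kappa> w) = 0) \<and>
      (\<forall>c\<in>C. \<forall>b. br q (u (c, b)) \<in> span ((\<lambda>c. u (c, b)) ` C))"
    and \<phi>: "\<phi> \<in> inner_auts scl br" and nz: "detform \<beta> C (on_slots (C \<times> UNIV) \<phi> u) \<noteq> 0"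
  shows "detform \<beta> C u \<noteq> 0"
proof
  assume u: "detform \<beta> C u = 0"
  let ?I = "C \<times> (UNIV :: bool set)"
  have I: "finite ?I" using C by simp
  have "\<exists>\<kappa> q. z = \<kappa> + q \<and> Dv ?I \<kappa> (detform \<beta> C) = (\<lambda>_. 0) \<and>
        (\<forall>n \<Theta>. iterD ?I (detform \<beta> C) n \<Theta> \<longrightarrow> (\<exists>c. Dv ?I q \<Theta> u = c * \<Theta> u))" for z
  proof -
    obtain \<kappa> q where z: "z = \<kappa> + q" "\<And>v w. \<beta> (br \<kappa> v) w + \<beta> v (br \<kappa> w) = 0"
      "\<And>c b. c \<in> C \<Longrightarrow> br q (u (c, b)) \<in> span ((\<lambda>c. u (c, b)) ` C)"
      using dec[of z] by blast
    have "\<exists>M. c \<in> C \<longrightarrow> br q (u (c, b)) = (\<Sum>c'\<in>C. scl (M c') (u (c', b)))" for b c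
      using span_image_finite[OF C z(3)[of c b]] by metis
    then have "\<exists>M. \<forall>b c. c \<in> C \<longrightarrow> br q (u (c, b)) = (\<Sum>c'\<in>C. scl (M b c c') (u (c', b)))"
      by (intro choice allI)
    then obtain M where M: "\<And>c b. c \<in> C \<Longrightarrow> br q (u (c, b)) = (\<Sum>c'\<in>C. scl (M b c c') (u (c', b)))"
      by blast
    have "\<exists>c. Dv ?I q \<Theta> u = c * \<Theta> u" if "iterD ?I (detform \<beta> C) n \<Theta>" for n \<Theta>
    proof -
      have "slot_lin ?I \<Theta>" using iterD_slot_lin[OF that detform_slot_lin] .
      moreover have "alternating (C \<times> {False}) \<Theta>"
        by (rule iterD_alternating[OF that I detform_slot_lin _ detform_alternating_left]) auto
      moreover have "alternating (C \<times> {True}) \<Theta>"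
        by (rule iterD_alternating[OF that I detform_slot_lin _ detform_alternating_right]) auto
      ultimately show ?thesis using Dv_bialternating_trace M by blast
    qed
    then show ?thesis
      using z(1) detform_invariant[OF z(2)] by blast
  qed
  from iterD_inner_vanish[where \<Phi> = "detform \<beta> C" and u = u, OF I detform_slot_lin this u \<phi>]
  show False using nz by contradiction
qed

lemma detform_diag:
  assumes "\<And>c c'. c \<in> C \<Longrightarrow> c' \<in> C \<Longrightarrow> \<beta> (u (c, False)) (u (c', True)) = (if c = c' then 1 else 0)"
  shows "detform \<beta> C u = 1"
proof -
  have "dterm \<beta> C p u = (if p = id then 1 else 0)" if p: "p permutes C" for p
  proof (cases "p = id")
    case True
    then show ?thesis using assms by (simp add: dterm_def)
  next
    case False
    then obtain c where c: "p c \<noteq> c" by (auto simp: fun_eq_iff)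
    then have "c \<in> C" "p c \<in> C" using p by (auto simp: permutes_def permutes_in_image[OF p])
    then have "\<beta> (u (c, False)) (u (p c, True)) = 0" using assms c by auto
    then show ?thesis using False \<open>c \<in> C\<close> C unfolding dterm_def by (auto intro!: prod_zero)
  qed
  then have "detform \<beta> C u = (\<Sum>p | p permutes C. if p = id then 1 else 0)"
    unfolding detform_def by (intro sum.cong) (auto simp: sign_id)
  also have "\<dots> = 1"
    using finite_permutations[OF C] permutes_id[of C] by simp
  finally show ?thesis .
qed

end
end

section \<open>Weights of commuting semisimple elements\<close>

lemma dominating_multiple:
  fixes P :: "(rat \<times> rat) set"
  assumes "finite P"
  shows "\<exists>N :: nat. \<forall>p q. (p, q) \<in> P \<longrightarrow> p \<noteq> 0 \<longrightarrow> \<bar>q\<bar> < of_nat N * \<bar>p\<bar>"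
proof -
  \<comment> \<open>N exceeds the sum of all ratios; a pair with p = 0 contributes 0, since division
    by zero yields 0.\<close>
  obtain N :: nat where N: "(\<Sum>(p, q)\<in>P. \<bar>q\<bar> / \<bar>p\<bar>) < of_nat N" using reals_Archimedean2 by blast
  have "\<bar>q\<bar> < of_nat N * \<bar>p\<bar>" if pq: "(p, q) \<in> P" and p: "p \<noteq> 0" for p q
  proof -
    have "(case (p, q) of (p, q) \<Rightarrow> \<bar>q\<bar> / \<bar>p\<bar>) \<le> (\<Sum>(p, q)\<in>P. \<bar>q\<bar> / \<bar>p\<bar>)"
      using pq assms by (intro member_le_sum) auto
    then have "\<bar>q\<bar> / \<bar>p\<bar> < of_nat N" using N by simp
    then show ?thesis using p by (simp add: field_simps)
  qed
  then show ?thesis by blast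
qed

context fd_space
begin

lemma coord_eigen:
  assumes C: "basis C" and T: "lin T" and e: "\<And>c. c \<in> C \<Longrightarrow> T c = scl (\<mu> c) c" and c: "c \<in> C"
  shows "coord C (T v) c = \<mu> c * coord C v c"
proof -
  have "T v = (\<Sum>c\<in>C. scl (\<mu> c * coord C v c) c)"
    unfolding lin_coord_expand[OF C T, of v] by (rule sum.cong) (simp_all add: e mult.commute)
  then show ?thesis using coord_unique[OF C _ c] by metis
qed

end

context fd_lie
begin

definition wt :: "'g \<Rightarrow> 'g \<Rightarrow> 'k \<Rightarrow> 'k \<Rightarrow> 'g set" where
  "wt x y \<alpha> \<beta> = {v. br x v = scl \<alpha> v \<and> br y v = scl \<beta> v}"

lemma wt_br: "v \<in> wt x y \<alpha> \<beta> \<Longrightarrow> w \<in> wt x y \<alpha>' \<beta>' \<Longrightarrow> br v w \<in> wt x y (\<alpha> + \<alpha>') (\<beta> + \<beta>')"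
  by (simp add: wt_def br_br_right[of _ v w] br_scl_left br_scl_right scale_left_distrib)

lemma eigen_geig: "br x v = scl a v \<Longrightarrow> v \<in> geig (br x) a"
  by (rule geigI[where m = 1]) (simp add: sh_def)

text \<open>The components of an x-eigenvector in the eigenspaces of ad y are again x-eigenvectors:
  their defects lie in different generalised eigenspaces of ad y and sum to zero.\<close>

lemma span_wt:
  assumes x: "semisimple_elem scl br x" and y: "semisimple_elem scl br y" and xy: "br x y = 0"
  shows "span (\<Union>\<alpha> \<beta>. wt x y \<alpha> \<beta>) = UNIV"
proof -
  let ?W = "span (\<Union>\<alpha> \<beta>. wt x y \<alpha> \<beta>)"
  obtain C where C: "C \<subseteq> {v. \<exists>c. br y v = scl c v}" "basis C"
    using basis_subset_exists y unfolding semisimple_elem_def by metis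
  then have "\<forall>c\<in>C. \<exists>b. br y c = scl b c" by blast
  then obtain b where b: "\<And>c. c \<in> C \<Longrightarrow> br y c = scl (b c) c" by metis
  note fC = basis_finite[OF C(2)]
  have "w \<in> ?W" if w: "br x w = scl \<alpha> w" for w \<alpha>
  proof -
    define u where "u \<beta> = (\<Sum>c\<in>{c \<in> C. b c = \<beta>}. scl (coord C w c) c)" for \<beta>
    have u: "br y (u \<beta>) = scl \<beta> (u \<beta>)" for \<beta>
      unfolding u_def lin_sum[OF lin_br] scale_sum_right
      by (rule sum.cong) (auto simp: br_scl_right b mult.commute)
    have s: "(\<Sum>\<beta>\<in>b ` C. u \<beta>) = w"
      unfolding u_def using sum.group[of C "b ` C" b "\<lambda>c. scl (coord C w c) c"] fC
      by (simp add: coord_sum[OF C(2)])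
    have "br x (u \<beta>) \<in> geig (br y) \<beta>" for \<beta>
      by (rule geig_commute[OF lin_br lin_br _ eigen_geig[OF u]]) (rule br_commute[OF xy])
    then have g: "br x (u \<beta>) - scl \<alpha> (u \<beta>) \<in> geig (br y) \<beta>" for \<beta>
      using eigen_geig[OF u] subspace_geig[OF lin_br] subspace_diff subspace_scale by metis
    have "(\<Sum>\<beta>\<in>b ` C. br x (u \<beta>) - scl \<alpha> (u \<beta>)) = br x w - scl \<alpha> w"
      by (simp only: sum_subtractf lin_sum[OF lin_br, symmetric] scale_sum_right[symmetric] s)
    then have "br x (u \<beta>) - scl \<alpha> (u \<beta>) = 0" if "\<beta> \<in> b ` C" for \<beta>
      using geig_independent[OF lin_br, of "b ` C" "\<lambda>\<beta>. br x (u \<beta>) - scl \<alpha> (u \<beta>)" y \<beta>] g w fC that by simp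
    then have "u \<beta> \<in> wt x y \<alpha> \<beta>" if "\<beta> \<in> b ` C" for \<beta> using u that by (simp add: wt_def)
    then have "u \<beta> \<in> ?W" if "\<beta> \<in> b ` C" for \<beta> using that by (intro span_base) blast
    then have "(\<Sum>\<beta>\<in>b ` C. u \<beta>) \<in> ?W" by (rule span_sum)
    then show ?thesis using s by simp
  qed
  then have "span {v. \<exists>c. br x v = scl c v} \<subseteq> ?W" by (intro span_minimal) auto
  then show ?thesis using x unfolding semisimple_elem_def by blast
qed

lemma weight_basis:
  assumes "semisimple_elem scl br x" "semisimple_elem scl br y" "br x y = 0"
  obtains C a b where "basis C" "\<And>c. c \<in> C \<Longrightarrow> br x c = scl (a c) c" "\<And>c. c \<in> C \<Longrightarrow> br y c = scl (b c) c"
proof -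
  obtain C where C: "C \<subseteq> (\<Union>\<alpha> \<beta>. wt x y \<alpha> \<beta>)" "basis C"
    by (rule basis_subset_exists[OF span_wt[OF assms]])
  then have "\<forall>c\<in>C. \<exists>\<alpha> \<beta>. br x c = scl \<alpha> c \<and> br y c = scl \<beta> c" unfolding wt_def by blast
  then obtain a b where ab: "\<forall>c\<in>C. br x c = scl (a c) c \<and> br y c = scl (b c) c" by metis
  show thesis by (rule that[OF C(2), of a b]) (use ab in auto)
qed

lemma semisimple_elem_add:
  assumes "semisimple_elem scl br x" "semisimple_elem scl br y" "br x y = 0"
  shows "semisimple_elem scl br (x + scl k y)"
proof -
  have sub: "(\<Union>\<alpha> \<beta>. wt x y \<alpha> \<beta>) \<subseteq> {v. \<exists>c. br (x + scl k y) v = scl c v}"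
  proof clarify
    fix v \<alpha> \<beta> assume "v \<in> wt x y \<alpha> \<beta>"
    then have "br (x + scl k y) v = scl (\<alpha> + k * \<beta>) v"
      by (simp add: wt_def br_add_left br_scl_left scale_left_distrib)
    then show "\<exists>c. br (x + scl k y) v = scl c v" by blast
  qed
  show ?thesis using span_wt[OF assms] span_mono[OF sub] unfolding semisimple_elem_def by blast
qed

text \<open>An element whose centraliser has least dimension works. If some z in S moved a v0
  centralised by x, then x + t z for generic t would have a strictly smaller centraliser.\<close>

lemma generic_element:
  assumes "commuting_semisimple_subspace scl br V S"
  obtains x where "x \<in> S" "\<And>v z. br x v = 0 \<Longrightarrow> z \<in> S \<Longrightarrow> br z v = 0"
proof -
  have S: "subspace S" "\<And>x. x \<in> S \<Longrightarrow> semisimple_elem scl br x" "\<And>x y. x \<in> S \<Longrightarrow> y \<in> S \<Longrightarrow> br x y = 0"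
    using assms by (auto simp: commuting_semisimple_subspace_def)
  let ?Z = "\<lambda>x. {v. br x v = 0}"
  have sZ: "subspace (?Z x)" for x
    by (rule subspaceI) (auto simp: br_0_right br_add_right br_scl_right)
  have "\<exists>x. x \<in> S \<and> (\<forall>x'. x' \<in> S \<longrightarrow> dim (?Z x) \<le> dim (?Z x'))"
    by (rule ex_has_least_nat[of "\<lambda>x. x \<in> S" 0]) (rule subspace_0[OF S(1)])
  then obtain x where x: "x \<in> S" "\<And>x'. x' \<in> S \<Longrightarrow> dim (?Z x) \<le> dim (?Z x')" by blast
  have "br z v0 = 0" if v0: "br x v0 = 0" and z: "z \<in> S" for v0 z
  proof (rule ccontr)
    assume nz: "br z v0 \<noteq> 0"
    obtain C a b where C: "basis C" "\<And>c. c \<in> C \<Longrightarrow> br x c = scl (a c) c" "\<And>c. c \<in> C \<Longrightarrow> br z c = scl (b c) c"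
      using weight_basis[OF S(2)[OF x(1)] S(2)[OF z] S(3)[OF x(1) z]] by metis
    \<comment> \<open>Avoids the finitely many t with a c + t * b c = 0 and b c nonzero. For the
      remaining t the sum vanishes only if a c = b c = 0.\<close>
    have "finite ((\<lambda>c. - a c / b c) ` C)" using basis_finite[OF C(1)] by blast
    then obtain t where t: "t \<notin> (\<lambda>c. - a c / b c) ` C"
      using ex_new_if_finite[OF infinite_UNIV_char_0] by blast
    have t0: "b c = 0" if "c \<in> C" "a c + t * b c = 0" for c
    proof (rule ccontr)
      assume "b c \<noteq> 0"
      then have "t = - a c / b c" using that(2) by (simp add: field_simps eq_neg_iff_add_eq_0 add.commute)
      then show False using t that(1) by blast
    qed
    let ?x = "x + scl t z"
    have xS: "?x \<in> S" using x(1) z S(1) by (intro subspace_add subspace_scale)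
    have e: "br ?x c = scl (a c + t * b c) c" if "c \<in> C" for c
      using that C by (simp add: br_add_left br_scl_left scale_left_distrib)
    have Zv: "br x v = 0 \<and> br z v = 0" if v: "br ?x v = 0" for v
    proof -
      have cz: "coord C v c = 0 \<or> (a c = 0 \<and> b c = 0)" if c: "c \<in> C" for c
      proof -
        have "coord C (br ?x v) c = (a c + t * b c) * coord C v c"
          by (rule coord_eigen[OF C(1) lin_br e c])
        moreover have "coord C (br ?x v) c = 0" using v linf_0[OF coord_linf[OF C(1)]] by simp
        ultimately show ?thesis using t0[OF c] by auto
      qed
      show ?thesis
        unfolding lin_coord_expand[OF C(1) lin_br, of _ v]
        by (intro conjI sum.neutral ballI) (use cz C in auto)
    qed
    have "?Z ?x \<subset> ?Z x" using Zv v0 nz by blast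
    then have "dim (?Z ?x) < dim (?Z x)"
      by (intro dim_psubset) (simp only: span_eq_iff[THEN iffD2, OF sZ])
    then show False using x(2)[OF xS] by simp
  qed
  then show thesis using that x(1) by blast
qed

definition inv_aut :: "('g \<Rightarrow> 'g) \<Rightarrow> bool" where
  "inv_aut \<sigma> \<longleftrightarrow> lin \<sigma> \<and> (\<forall>x y. \<sigma> (br x y) = br (\<sigma> x) (\<sigma> y)) \<and> (\<forall>x. \<sigma> (\<sigma> x) = x)"

context fixes \<sigma> assumes \<sigma>: "inv_aut \<sigma>" begin

lemma inv_lin: "lin \<sigma>" using \<sigma> by (simp add: inv_aut_def)
lemma inv_br: "\<sigma> (br x y) = br (\<sigma> x) (\<sigma> y)" using \<sigma> by (simp add: inv_aut_def)
lemma inv_inv: "\<sigma> (\<sigma> x) = x" using \<sigma> by (simp add: inv_aut_def)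
lemma inv_br': "br x (\<sigma> y) = \<sigma> (br (\<sigma> x) y)" by (simp add: inv_br inv_inv)

lemmas inv_simps = lin_add[OF inv_lin] lin_diff[OF inv_lin] lin_neg[OF inv_lin] lin_scl[OF inv_lin]
  lin_0[OF inv_lin] inv_inv

lemma killing_aut: "killing (\<sigma> x) y = killing x (\<sigma> y)"
proof -
  have "tr (\<lambda>z. \<sigma> (br x (br (\<sigma> y) (\<sigma> z)))) = tr (\<lambda>z. br x (br (\<sigma> y) (\<sigma> (\<sigma> z))))"
    by (rule tr_comm[OF inv_lin]) (intro lin_comp[OF lin_br] lin_comp[OF lin_br inv_lin])
  then show ?thesis by (simp add: killing_def inv_br inv_inv)
qed

end
end

context ss_lie
begin

text \<open>The sum is the trace of ad y on F with threshold r. The last hypothesis is g = K + Q,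
  asked only for basis vectors of negative weight.\<close>

lemma weight_sum_zero:
  fixes \<omega> :: "'k \<Rightarrow> 'k \<Rightarrow> rat"
  assumes s1: "inv_aut \<sigma>1" and s2: "inv_aut \<sigma>2"
    and \<phi>: "\<phi> \<in> inner_auts scl br" "\<And>v. \<sigma>2 (\<phi> v) = \<phi> (\<sigma>1 v)"
    and x1: "\<sigma>1 x = - x" and y1: "\<sigma>1 y = - y" and y2: "\<sigma>2 y = y"
    and C: "basis C" and a: "\<And>c. c \<in> C \<Longrightarrow> br x c = scl (a c) c" and b: "\<And>c. c \<in> C \<Longrightarrow> br y c = scl (b c) c"
    and \<omega>: "\<And>\<alpha> \<beta> \<alpha>' \<beta>'. \<omega> (\<alpha> + \<alpha>') (\<beta> + \<beta>') = \<omega> \<alpha> \<beta> + \<omega> \<alpha>' \<beta>'"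
    and neg: "\<And>c. c \<in> C \<Longrightarrow> \<omega> (a c) (b c) < 0 \<Longrightarrow>
      \<exists>\<kappa> q. c = \<kappa> + q \<and> \<sigma>2 \<kappa> = \<kappa> \<and> q \<in> span (\<Union>{wt x y \<alpha> \<beta> | \<alpha> \<beta>. 0 \<le> \<omega> \<alpha> \<beta>})"
  shows "(\<Sum>c\<in>{c \<in> C. r \<le> \<omega> (a c) (b c)}. b c) = 0"
proof -
  let ?Q = "\<Union>{wt x y \<alpha> \<beta> | \<alpha> \<beta>. 0 \<le> \<omega> \<alpha> \<beta>}"
  let ?C = "{c \<in> C. r \<le> \<omega> (a c) (b c)}"
  let ?\<beta>1 = "\<lambda>v w. killing v (\<sigma>1 w)" and ?\<beta>2 = "\<lambda>v w. killing v (\<sigma>2 w)"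
  note fC = basis_finite[OF C]
  have fin: "finite ?C" using fC by simp
  have l2: "linf (?\<beta>2 v)" "linf (\<lambda>v. ?\<beta>2 v w)" for v w
    using linf_comp_lin[OF killing_linf_right inv_lin[OF s2]] killing_linf by auto
  have eq1: "v = w" if "\<And>z. ?\<beta>1 z v = ?\<beta>1 z w" for v w
  proof -
    have "killing (\<sigma>1 (v - w)) z = 0" for z
      using that[of z] by (simp add: killing_sym[of _ z] inv_simps[OF s1] killing_diff_right)
    then have "\<sigma>1 (v - w) = 0" by (rule killing_nondegenerate)
    then have "v - w = 0" using inv_inv[OF s1, of "v - w"] lin_0[OF inv_lin[OF s1]] by simp
    then show ?thesis by simp
  qed
  \<comment> \<open>Elements negated by \<open>\<sigma>1\<close> are self-adjoint for
    \<open>?\<beta>1\<close>; this gives a dual basis vector the weight of its partner.\<close>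
  have adj: "?\<beta>1 v (br z w) = ?\<beta>1 (br z v) w" if "\<sigma>1 z = - z" for z v w
    using that by (simp add: inv_br[OF s1] br_neg_left killing_neg_right killing_inv)
  \<comment> \<open>The basis dual to C under \<open>?\<beta>1\<close> is the image under
    \<open>\<sigma>1\<close> of the Killing-dual basis.\<close>
  have "\<exists>e. \<forall>v. ?\<beta>1 v e = coord C v c" for c
  proof -
    obtain s where "\<And>z. killing s z = coord C z c"
      using nondegenerate_represents[of killing, OF killing_linf_right killing_linf killing_nondegenerate coord_linf[OF C, of c]]
      by metis
    then have "?\<beta>1 v (\<sigma>1 s) = coord C v c" for v by (simp add: inv_inv[OF s1] killing_sym[of v])
    then show ?thesis by blast
  qed
  then obtain e where e: "\<And>c v. ?\<beta>1 v (e c) = coord C v c" by metis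
  have ex: "br x (e c) = scl (a c) (e c)" if c: "c \<in> C" for c
  proof (rule eq1)
    show "?\<beta>1 z (br x (e c)) = ?\<beta>1 z (scl (a c) (e c))" for z
      using coord_eigen[OF C lin_br a c] by (simp add: adj[OF x1] e inv_simps[OF s1] killing_scl_right)
  qed
  have ey: "br y (e c) = scl (b c) (e c)" if c: "c \<in> C" for c
  proof (rule eq1)
    show "?\<beta>1 z (br y (e c)) = ?\<beta>1 z (scl (b c) (e c))" for z
      using coord_eigen[OF C lin_br b c] by (simp add: adj[OF y1] e inv_simps[OF s1] killing_scl_right)
  qed
  \<comment> \<open>F is described twice, here as the span of basis vectors above the threshold and
    in \<open>wte\<close> as the span of their duals, because rows and columns must both be
    Q-stable.\<close>
  have wtC: "v \<in> span ?C" if v: "v \<in> wt x y \<alpha> \<beta>" and r: "r \<le> \<omega> \<alpha> \<beta>" for v \<alpha> \<beta>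
  proof -
    have "scl (coord C v c) c \<in> span ?C" if c: "c \<in> C" for c
    proof (cases "coord C v c = 0")
      case True
      then show ?thesis by (simp add: span_zero)
    next
      case False
      have "a c * coord C v c = \<alpha> * coord C v c" "b c * coord C v c = \<beta> * coord C v c"
        using coord_eigen[OF C lin_br a c, of v] coord_eigen[OF C lin_br b c, of v] v linf_scl[OF coord_linf[OF C]]
        by (auto simp: wt_def)
      then have "c \<in> ?C" using False c r by simp
      then show ?thesis by (intro span_scale span_base)
    qed
    then have "(\<Sum>c\<in>C. scl (coord C v c) c) \<in> span ?C" by (rule span_sum)
    then show ?thesis by (simp add: coord_sum[OF C])
  qed
  have wte: "v \<in> span (e ` ?C)" if v: "v \<in> wt x y \<alpha> \<beta>" and r: "r \<le> \<omega> \<alpha> \<beta>" for v \<alpha> \<beta>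
  proof -
    have "(\<Sum>c\<in>C. scl (?\<beta>1 c v) (e c)) = v"
    proof (rule eq1)
      fix z
      have "?\<beta>1 z (\<Sum>c\<in>C. scl (?\<beta>1 c v) (e c)) = (\<Sum>c\<in>C. coord C z c * ?\<beta>1 c v)"
        by (simp add: lin_sum[OF inv_lin[OF s1]] inv_simps[OF s1] linf_sum[OF killing_linf_right]
            killing_scl_right e mult.commute)
      also have "\<dots> = ?\<beta>1 (\<Sum>c\<in>C. scl (coord C z c) c) v"
        by (simp add: linf_sum[OF killing_linf] killing_scl_left)
      finally show "?\<beta>1 z (\<Sum>c\<in>C. scl (?\<beta>1 c v) (e c)) = ?\<beta>1 z v" by (simp add: coord_sum[OF C])
    qed
    moreover have "scl (?\<beta>1 c v) (e c) \<in> span (e ` ?C)" if c: "c \<in> C" for c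
    proof (cases "?\<beta>1 c v = 0")
      case True
      then show ?thesis by (simp add: span_zero)
    next
      case False
      have "a c * ?\<beta>1 c v = \<alpha> * ?\<beta>1 c v" "b c * ?\<beta>1 c v = \<beta> * ?\<beta>1 c v"
        using adj[OF x1, of c v] adj[OF y1, of c v] a[OF c] b[OF c] v
        by (auto simp: wt_def killing_scl_left killing_scl_right inv_simps[OF s1])
      then have "e c \<in> e ` ?C" using False c r by simp
      then show ?thesis by (intro span_scale span_base)
    qed
    ultimately show ?thesis using span_sum[of C "\<lambda>c. scl (?\<beta>1 c v) (e c)"] by metis
  qed
  let ?u = "\<lambda>s. if snd s then e (fst s) else fst s"
  have Qstable: "br q (?u (c, t)) \<in> span ((\<lambda>c. ?u (c, t)) ` ?C)" if q: "q \<in> span ?Q" and c: "c \<in> ?C" for q c t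
    using q
  proof (induction rule: span_induct)
    case base
    show ?case
      by (rule subspaceI) (auto simp: br_0_left br_add_left br_scl_left intro: span_zero span_add span_scale)
  next
    case (step q)
    then obtain \<alpha> \<beta> where q: "q \<in> wt x y \<alpha> \<beta>" "0 \<le> \<omega> \<alpha> \<beta>" by blast
    \<comment> \<open>Weights of Q have \<open>\<omega>\<close> at least 0, so bracketing with Q
      does not fall below the threshold.\<close>
    have r: "r \<le> \<omega> (\<alpha> + a c) (\<beta> + b c)" using c q(2) by (simp add: \<omega>)
    have "?u (c, t) \<in> wt x y (a c) (b c)" using a b c ex ey by (simp add: wt_def)
    then have "br q (?u (c, t)) \<in> wt x y (\<alpha> + a c) (\<beta> + b c)" by (rule wt_br[OF q(1)])
    then show ?case using wtC[OF _ r] wte[OF _ r] by (cases t) auto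
  qed
  have dec: "\<exists>\<kappa> q. z = \<kappa> + q \<and> \<sigma>2 \<kappa> = \<kappa> \<and> q \<in> span ?Q" for z
  proof -
    have "z \<in> span C" using C by (simp add: basis_def)
    then show ?thesis
    proof (induction rule: span_induct)
      case base
      show ?case
      proof (rule subspaceI)
        show "0 \<in> {z. \<exists>\<kappa> q. z = \<kappa> + q \<and> \<sigma>2 \<kappa> = \<kappa> \<and> q \<in> span ?Q}"
          using span_zero[of ?Q] inv_simps(5)[OF s2] by (auto intro: exI[of _ 0])
      next
        fix z z' assume "z \<in> {z. \<exists>\<kappa> q. z = \<kappa> + q \<and> \<sigma>2 \<kappa> = \<kappa> \<and> q \<in> span ?Q}" "z' \<in> {z. \<exists>\<kappa> q. z = \<kappa> + q \<and> \<sigma>2 \<kappa> = \<kappa> \<and> q \<in> span ?Q}"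
        then obtain \<kappa> q \<kappa>' q' where "z = \<kappa> + q" "\<sigma>2 \<kappa> = \<kappa>" "q \<in> span ?Q" "z' = \<kappa>' + q'" "\<sigma>2 \<kappa>' = \<kappa>'" "q' \<in> span ?Q"
          by blast
        then have "z + z' = (\<kappa> + \<kappa>') + (q + q')" "\<sigma>2 (\<kappa> + \<kappa>') = \<kappa> + \<kappa>'" "q + q' \<in> span ?Q"
          by (simp_all add: inv_simps[OF s2] span_add)
        then show "z + z' \<in> {z. \<exists>\<kappa> q. z = \<kappa> + q \<and> \<sigma>2 \<kappa> = \<kappa> \<and> q \<in> span ?Q}" by blast
      next
        fix k z assume "z \<in> {z. \<exists>\<kappa> q. z = \<kappa> + q \<and> \<sigma>2 \<kappa> = \<kappa> \<and> q \<in> span ?Q}"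
        then obtain \<kappa> q where "z = \<kappa> + q" "\<sigma>2 \<kappa> = \<kappa>" "q \<in> span ?Q" by blast
        then have "scl k z = scl k \<kappa> + scl k q" "\<sigma>2 (scl k \<kappa>) = scl k \<kappa>" "scl k q \<in> span ?Q"
          by (simp_all add: inv_simps[OF s2] span_scale scale_right_distrib)
        then show "scl k z \<in> {z. \<exists>\<kappa> q. z = \<kappa> + q \<and> \<sigma>2 \<kappa> = \<kappa> \<and> q \<in> span ?Q}" by blast
      qed
    next
      case (step c)
      show ?case
      proof (cases "\<omega> (a c) (b c) < 0")
        case True
        then show ?thesis using neg step by blast
      next
        case False
        then have "c \<in> ?Q" using a b step by (auto simp: wt_def not_less)
        then have "c \<in> span ?Q" by (rule span_base)
        then show ?thesis using inv_simps(5)[OF s2] by (intro exI[of _ 0] exI[of _ c]) simp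
      qed
    qed
  qed
  have inv2: "?\<beta>2 (br \<kappa> v) w + ?\<beta>2 v (br \<kappa> w) = 0" if "\<sigma>2 \<kappa> = \<kappa>" for \<kappa> v w
    using that by (simp add: inv_br[OF s2] killing_inv)
  \<comment> \<open>\<open>\<phi>\<close> carries \<open>?\<beta>1\<close> to
    \<open>?\<beta>2\<close>, so the Gram matrix of the translated families is the identity by
    duality of C and e.\<close>
  have \<beta>\<phi>: "?\<beta>2 (\<phi> v) (\<phi> w) = ?\<beta>1 v w" for v w
    by (simp add: \<phi>(2) killing_inner_auts[OF \<phi>(1)])
  have "detform ?\<beta>2 ?C (on_slots (?C \<times> UNIV) \<phi> ?u) = 1"
  proof (rule detform_diag[OF fin l2])
    fix c c' assume "c \<in> ?C" "c' \<in> ?C"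
    moreover have "coord C c c' = (if c = c' then 1 else 0)" if "c \<in> C"
      using C that by (simp add: basis_def representation_basis)
    ultimately show "?\<beta>2 (on_slots (?C \<times> UNIV) \<phi> ?u (c, False)) (on_slots (?C \<times> UNIV) \<phi> ?u (c', True)) = (if c = c' then 1 else 0)"
      by (simp add: on_slots_def \<beta>\<phi> e)
  qed
  then have one: "detform ?\<beta>2 ?C (on_slots (?C \<times> UNIV) \<phi> ?u) \<noteq> 0" by simp
  have "\<exists>\<kappa> q. z = \<kappa> + q \<and> (\<forall>v w. ?\<beta>2 (br \<kappa> v) w + ?\<beta>2 v (br \<kappa> w) = 0) \<and>
      (\<forall>c\<in>?C. \<forall>t. br q (?u (c, t)) \<in> span ((\<lambda>c. ?u (c, t)) ` ?C))" for z
  proof -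
    obtain \<kappa> q where z: "z = \<kappa> + q" "\<sigma>2 \<kappa> = \<kappa>" "q \<in> span ?Q" using dec[of z] by blast
    show ?thesis
      by (intro exI[of _ \<kappa>] exI[of _ q] conjI ballI allI z(1) inv2[OF z(2)] Qstable[OF z(3)])
  qed
  from detform_inner_nonzero[OF fin l2 this \<phi>(1) one]
  have nz: "detform ?\<beta>2 ?C ?u \<noteq> 0" .
  \<comment> \<open>The derivative along y computed in two ways: zero because y is fixed by
    \<open>\<sigma>2\<close>, and the determinant times twice the trace because y scales each row
    and column vector.\<close>
  have "0 = Dv (?C \<times> UNIV) y (detform ?\<beta>2 ?C) ?u"
    using detform_invariant[OF fin l2 inv2[OF y2]] by simp
  also have "\<dots> = ((\<Sum>c\<in>?C. b c) + (\<Sum>c\<in>?C. b c)) * detform ?\<beta>2 ?C ?u"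
  proof -
    have "br y (?u (c, t)) = (\<Sum>c'\<in>?C. scl (if c' = c then b c else 0) (?u (c', t)))" if "c \<in> ?C" for c t
    proof -
      have "(\<Sum>c'\<in>?C. scl (if c' = c then b c else 0) (?u (c', t))) = (\<Sum>c'\<in>?C. if c' = c then scl (b c) (?u (c, t)) else 0)"
        by (rule sum.cong) auto
      also have "\<dots> = scl (b c) (?u (c, t))" using fin that by simp
      finally show ?thesis using that b ey by simp
    qed
    from Dv_bialternating_trace[where M = "\<lambda>t c c'. if c' = c then b c else 0", OF fin l2 detform_slot_lin[OF fin l2] detform_alternating_left[OF fin l2]
        detform_alternating_right[OF fin l2] this]
    show ?thesis by simp
  qed
  finally show ?thesis using nz by simp
qed

end

section \<open>Cartan subspaces\<close>

context ss_lie
begin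

text \<open>The positive system is chosen so that \<open>x\<close> dominates \<open>y\<close>: \<open>\<sigma>2\<close> then flips the sign of a
  weight unless the weight vanishes on \<open>x\<close>, and in that case the weight vector is fixed by \<open>\<sigma>2\<close>.\<close>
lemma fixed_part_zero:
  assumes s1: "inv_aut \<sigma>1" and s2: "inv_aut \<sigma>2" and s12: "\<And>v. \<sigma>1 (\<sigma>2 v) = \<sigma>2 (\<sigma>1 v)"
    and \<phi>: "\<phi> \<in> inner_auts scl br" "\<And>v. \<sigma>2 (\<phi> v) = \<phi> (\<sigma>1 v)"
    and x: "\<sigma>1 x = - x" "\<sigma>2 x = - x" "semisimple_elem scl br x"
    and y: "\<sigma>1 y = - y" "\<sigma>2 y = y" "semisimple_elem scl br y"
    and xy: "br x y = 0"
    and H: "\<And>v. br x v = 0 \<Longrightarrow> \<sigma>1 v = - v \<Longrightarrow> \<sigma>2 v = - v \<Longrightarrow> br y v = 0"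
  shows "y = 0"
proof -
  obtain C a b where C: "basis C" and a: "\<And>c. c \<in> C \<Longrightarrow> br x c = scl (a c) c"
    and b: "\<And>c. c \<in> C \<Longrightarrow> br y c = scl (b c) c"
    using weight_basis[OF x(3) y(3) xy] by metis
  note fC = basis_finite[OF C]
  have "finite ((a ` C \<union> b ` C) - {0})" using fC by simp
  then obtain f :: "'k \<Rightarrow> rat" where f: "rat_linear f" and f0: "\<And>s. s \<in> (a ` C \<union> b ` C) - {0} \<Longrightarrow> f s \<noteq> 0"
    using rat_linear_exists[of "(a ` C \<union> b ` C) - {0}"] by blast
  \<comment> \<open>Single weights serve the sign argument; differences ensure that equal values of
    \<open>\<omega>\<close> force equal values of f on both coordinates.\<close>
  let ?P = "(\<lambda>c. (f (a c), f (b c))) ` C \<union> (\<lambda>(c, c'). (f (a c) - f (a c'), f (b c) - f (b c'))) ` (C \<times> C)"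
  have "finite ?P" using fC by simp
  then obtain N :: nat where N: "\<And>p q. (p, q) \<in> ?P \<Longrightarrow> p \<noteq> 0 \<Longrightarrow> \<bar>q\<bar> < of_nat N * \<bar>p\<bar>"
    using dominating_multiple[of ?P] by blast
  define \<omega> where "\<omega> \<alpha> \<beta> = of_nat N * f \<alpha> + f \<beta>" for \<alpha> \<beta>
  have \<omega>: "\<omega> (\<alpha> + \<alpha>') (\<beta> + \<beta>') = \<omega> \<alpha> \<beta> + \<omega> \<alpha>' \<beta>'" for \<alpha> \<beta> \<alpha>' \<beta>'
    by (simp add: \<omega>_def rat_linear_add[OF f] algebra_simps)
  note i1 = inv_simps[OF s1] and i2 = inv_simps[OF s2]
  let ?Q = "\<Union>{wt x y \<alpha> \<beta> | \<alpha> \<beta>. 0 \<le> \<omega> \<alpha> \<beta>}"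
  have neg: "\<exists>\<kappa> q. c = \<kappa> + q \<and> \<sigma>2 \<kappa> = \<kappa> \<and> q \<in> span ?Q"
    if c: "c \<in> C" and w: "\<omega> (a c) (b c) < 0" for c
  proof -
    have xc: "br x (\<sigma>2 c) = scl (- a c) (\<sigma>2 c)"
      by (simp add: inv_br'[OF s2] x a[OF c] br_neg_left i2)
    have yc: "br y (\<sigma>2 c) = scl (b c) (\<sigma>2 c)"
      by (simp add: inv_br'[OF s2] y b[OF c] i2)
    show ?thesis
    proof (cases "a c = 0")
      case False
      have fa: "f (a c) \<noteq> 0" using f0[of "a c"] False c by blast
      have "(f (a c), f (b c)) \<in> ?P" using c by blast
      from N[OF this fa] have lt: "\<bar>f (b c)\<bar> < of_nat N * \<bar>f (a c)\<bar>" .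
      have "f (a c) < 0"
      proof (rule ccontr)
        assume "\<not> f (a c) < 0"
        then have "\<bar>f (b c)\<bar> < of_nat N * f (a c)" using lt by simp
        then show False using w unfolding \<omega>_def by linarith
      qed
      then have "\<bar>f (b c)\<bar> < - (of_nat N * f (a c))" using lt by simp
      then have "0 \<le> \<omega> (- a c) (b c)" unfolding \<omega>_def rat_linear_neg[OF f] by linarith
      moreover have "\<sigma>2 c \<in> wt x y (- a c) (b c)" using xc yc by (simp add: wt_def)
      ultimately have "\<sigma>2 c \<in> ?Q" by blast
      then have "- \<sigma>2 c \<in> span ?Q" by (intro span_neg span_base)
      \<comment> \<open>A vector fixed by \<open>\<sigma>2\<close>, minus one whose x-weight is
        reversed and which therefore lies in Q.\<close>
      moreover have "c = (c + \<sigma>2 c) + - \<sigma>2 c" by simp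
      moreover have "\<sigma>2 (c + \<sigma>2 c) = c + \<sigma>2 c" by (simp add: i2 add.commute)
      ultimately show ?thesis by blast
    next
      case True
      then have "f (b c) < 0" using w by (simp add: \<omega>_def rat_linear_0[OF f])
      then have bc: "b c \<noteq> 0" using rat_linear_0[OF f] by auto
      \<comment> \<open>Up to factors, p is the part of c negated by \<open>\<sigma>2\<close>, and r
        the part of p negated by \<open>\<sigma>1\<close> too. \<open>H\<close> applied to r forces
        \<open>\<sigma>1 p = - p\<close>; then \<open>H\<close> applies to p itself, and p = 0
        because b c is nonzero.\<close>
      define p where "p = c - \<sigma>2 c"
      have p2: "\<sigma>2 p = - p" by (simp add: p_def i2)
      have px: "br x p = 0" using a[OF c] xc True by (simp add: p_def br_diff_right)
      have py: "br y p = scl (b c) p" using b[OF c] yc by (simp add: p_def br_diff_right scale_right_diff_distrib)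
      define r where "r = p - \<sigma>1 p"
      have "br x r = 0"
        using px by (simp add: r_def br_diff_right inv_br'[OF s1] x br_neg_left i1)
      moreover have "\<sigma>1 r = - r" by (simp add: r_def i1)
      moreover have "\<sigma>2 r = - r" by (simp add: r_def i2 s12[symmetric] p2 i1)
      ultimately have "br y r = 0" by (rule H)
      moreover have "br y (\<sigma>1 p) = - scl (b c) (\<sigma>1 p)"
        by (simp add: inv_br'[OF s1] y br_neg_left i1 py)
      ultimately have "scl (b c) (p + \<sigma>1 p) = 0"
        by (simp add: r_def br_diff_right py scale_right_distrib)
      then have "\<sigma>1 p = - p" using bc by (simp add: add_eq_0_iff)
      then have "scl (b c) p = 0" using H[OF px _ p2] py by simp
      then have "p = 0" using bc by simp
      then have "\<sigma>2 c = c" by (simp add: p_def)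
      then show ?thesis using span_zero by (intro exI[of _ c] exI[of _ 0]) simp
    qed
  qed
  have Z: "(\<Sum>c\<in>{c \<in> C. r \<le> \<omega> (a c) (b c)}. b c) = 0" for r
    by (rule weight_sum_zero[OF s1 s2 \<phi> x(1) y(1,2) C a b \<omega> neg])
  have b0: "b c0 = 0" if c0: "c0 \<in> C" for c0
  proof (rule ccontr)
    assume nz: "b c0 \<noteq> 0"
    let ?w = "\<lambda>c. \<omega> (a c) (b c)"
    let ?G = "{c \<in> C. ?w c0 < ?w c}" and ?E = "{c \<in> C. ?w c = ?w c0}"
    have "(\<Sum>c\<in>?G. b c) = 0"
    proof (cases "?G = {}")
      case False
      have fG: "finite (?w ` ?G)" using fC by simp
      \<comment> \<open>The next value above that of c0 turns the strict inequality into a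
        threshold.\<close>
      define m where "m = Min (?w ` ?G)"
      have "m \<in> ?w ` ?G" unfolding m_def using False by (intro Min_in[OF fG]) simp
      then have "?w c0 < m" by auto
      then have "?G = {c \<in> C. m \<le> ?w c}" unfolding m_def using Min_le[OF fG] by auto
      then show ?thesis by (simp only: Z)
    qed (simp only: sum.empty)
    moreover have "{c \<in> C. ?w c0 \<le> ?w c} = ?E \<union> ?G" by auto
    moreover have "(\<Sum>c\<in>?E \<union> ?G. b c) = (\<Sum>c\<in>?E. b c) + (\<Sum>c\<in>?G. b c)"
      using fC by (intro sum.union_disjoint) auto
    ultimately have "(\<Sum>c\<in>?E. b c) = 0" using Z[of "?w c0"] by simp
    \<comment> \<open>Subtracting two consecutive thresholds has left one level of
      \<open>\<omega>\<close>, on which f (b c) is constant.\<close>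
    then have "(\<Sum>c\<in>?E. f (b c)) = 0" using rat_linear_sum[OF f] rat_linear_0[OF f] by metis
    moreover have "f (b c) = f (b c0)" if "c \<in> ?E" for c
    proof -
      have c: "c \<in> C" and eq: "of_nat N * f (a c) + f (b c) = of_nat N * f (a c0) + f (b c0)"
        using that by (auto simp: \<omega>_def)
      have e2: "f (b c) - f (b c0) = - (of_nat N * (f (a c) - f (a c0)))"
        using eq by (simp add: algebra_simps)
      have "f (a c) - f (a c0) = 0"
      proof (rule ccontr)
        assume ne: "f (a c) - f (a c0) \<noteq> 0"
        have "(f (a c) - f (a c0), f (b c) - f (b c0)) \<in> ?P" using c c0 by auto
        from N[OF this ne] show False by (simp add: e2 abs_mult)
      qed
      then show ?thesis using e2 by simp
    qed
    ultimately have "of_nat (card ?E) * f (b c0) = 0" by simp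
    moreover have "card ?E \<noteq> 0" using fC c0 by (simp add: card_eq_0_iff) blast
    ultimately have "f (b c0) = 0" by simp
    then show False using f0[of "b c0"] c0 nz by blast
  qed
  have "(\<Sum>c\<in>C. scl (coord C v c) (br y c)) = 0" for v
    using b b0 by (intro sum.neutral) simp
  then have "br y v = 0" for v
    by (simp only: lin_coord_expand[OF C lin_br[of y], of v])
  then show ?thesis by (rule center_trivial)
qed

text \<open>ad z preserves the generalised eigenspaces of ad v, on which ad s is scalar. The trivial
  centre turns commuting operators into commuting elements.\<close>

lemma jordan_commute:
  assumes s: "\<And>a w. w \<in> geig (br v) a \<Longrightarrow> br s w = scl a w" and z: "br z v = 0"
  shows "br s z = 0"
proof (rule center_trivial)
  fix w
  have "br s (br z w) = br z (br s w)" for w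
  proof (rule linear_on_span[OF span_geig[OF ac lin_br[of v]], of "\<lambda>w. br s (br z w)" "\<lambda>w. br z (br s w)"])
    fix w assume "w \<in> (\<Union>a. geig (br v) a)"
    then obtain a where w: "w \<in> geig (br v) a" by blast
    have "br z w \<in> geig (br v) a"
      by (rule geig_commute[OF lin_br lin_br br_commute[OF z] w])
    then show "br s (br z w) = br z (br s w)" using s w by (simp add: br_scl_right)
  qed (auto intro: lin_comp lin_br)
  then show "br (br s z) w = 0" by (simp add: br_br_left)
qed

text \<open>The involution sends the generalised eigenspace of a to that of -a, where
  \<open>\<sigma> s\<close> and s act by opposite scalars; so their sum is central.\<close>

lemma jordan_inv_aut:
  assumes s: "\<And>a w. w \<in> geig (br v) a \<Longrightarrow> br s w = scl a w" and \<sigma>: "inv_aut \<sigma>" "\<sigma> v = - v"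
  shows "\<sigma> s = - s"
proof -
  note i = inv_simps[OF \<sigma>(1)]
  have "br (\<sigma> s + s) (\<sigma> w) = 0" for w
  proof (rule linear_on_span[OF span_geig[OF ac lin_br[of v]], of "\<lambda>w. br (\<sigma> s + s) (\<sigma> w)" "\<lambda>w. 0"])
    fix w assume "w \<in> (\<Union>a. geig (br v) a)"
    then obtain a where w: "w \<in> geig (br v) a" by blast
    then obtain m where m: "(sh (br v) a ^^ m) w = 0" unfolding geig_def by blast
    have sh: "sh (br v) (- a) (\<sigma> u) = - \<sigma> (sh (br v) a u)" for u
      by (simp add: sh_def inv_br'[OF \<sigma>(1)] \<sigma>(2) br_neg_left i)
    have "(sh (br v) (- a) ^^ m) (\<sigma> w) = scl ((- 1) ^ m) (\<sigma> ((sh (br v) a ^^ m) w))" for m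
      by (induction m) (simp_all add: sh lin_scl[OF lin_sh[OF lin_br]])
    then have "\<sigma> w \<in> geig (br v) (- a)" using m i by (intro geigI[where m = m]) simp
    then have "br s (\<sigma> w) = scl (- a) (\<sigma> w)" by (rule s)
    moreover have "br (\<sigma> s) (\<sigma> w) = scl a (\<sigma> w)" using s[OF w] by (simp add: inv_br[OF \<sigma>(1), symmetric] i)
    ultimately show "br (\<sigma> s + s) (\<sigma> w) = 0" by (simp add: br_add_left)
  qed (simp_all add: lin_def i br_add_right br_scl_right)
  from this[of "\<sigma> w" for w] have "br (\<sigma> s + s) w = 0" for w by (simp add: i)
  then have "\<sigma> s + s = 0" by (rule center_trivial)
  then show ?thesis by (simp add: eq_neg_iff_add_eq_0)
qed

text \<open>Let L be the centraliser of x in g11. By Jordan decomposition and maximality of S, each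
  element of L is an element of S plus a nilpotent element of L. The nilpotent ones are
  Killing-orthogonal to S and, being closed under addition, to each other. The form is nondegenerate
  on L, so they are zero.\<close>

lemma cartan_subspace_centralizer:
  assumes s1: "inv_aut \<sigma>1" and s2: "inv_aut \<sigma>2" and s12: "\<And>v. \<sigma>1 (\<sigma>2 v) = \<sigma>2 (\<sigma>1 v)"
    and cs: "cartan_subspace scl br {v. \<sigma>1 v = - v \<and> \<sigma>2 v = - v} S"
    and x: "x \<in> S" "\<And>v z. br x v = 0 \<Longrightarrow> z \<in> S \<Longrightarrow> br z v = 0"
    and v: "br x v = 0" "\<sigma>1 v = - v" "\<sigma>2 v = - v"
  shows "v \<in> S"
proof -
  let ?V = "{v. \<sigma>1 v = - v \<and> \<sigma>2 v = - v}"
  let ?L = "{v \<in> ?V. br x v = 0}"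
  let ?N = "{v \<in> ?L. ad_nilpotent br v}"
  have S: "subspace S" "S \<subseteq> ?V" "\<And>x. x \<in> S \<Longrightarrow> semisimple_elem scl br x" "\<And>x y. x \<in> S \<Longrightarrow> y \<in> S \<Longrightarrow> br x y = 0"
    and max: "\<And>S'. commuting_semisimple_subspace scl br ?V S' \<Longrightarrow> S \<subseteq> S' \<Longrightarrow> S' = S"
    using cs unfolding cartan_subspace_def commuting_semisimple_subspace_def by blast+
  note i1 = inv_simps[OF s1] and i2 = inv_simps[OF s2]
  have L: "subspace ?L"
    by (rule subspaceI) (auto simp: i1 i2 br_0_right br_add_right br_scl_right)
  have V: "subspace ?V" by (rule subspaceI) (auto simp: i1 i2)
  have SL: "S \<subseteq> ?L" using S(2,4) x(1) by blast
  have jd: "\<exists>s\<in>S. v - s \<in> ?N" if v: "v \<in> ?L" for v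
  proof -
    obtain s where s: "\<And>a w. w \<in> geig (br v) a \<Longrightarrow> br s w = scl a w"
      "semisimple_elem scl br s" "ad_nilpotent br (v - s)"
      using jordan_decomposition[of v] by metis
    have sV: "s \<in> ?V" using jordan_inv_aut[OF s(1) s1] jordan_inv_aut[OF s(1) s2] v by simp
    have sz: "br s z = 0" if "z \<in> S" for z
      by (rule jordan_commute[OF s(1)]) (use x(2)[OF _ that] v in blast)+
    have zs: "br z s = 0" if "z \<in> S" for z using sz[OF that] br_anti[of z s] by simp
    let ?S = "span (insert s S)"
    have mem: "\<exists>k z. z \<in> S \<and> u = z + scl k s" if u: "u \<in> ?S" for u
    proof -
      obtain k where "u - scl k s \<in> span S" using u unfolding span_breakdown_eq by blast
      then have "u - scl k s \<in> S" using S(1) span_eq_iff by metis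
      moreover have "u = (u - scl k s) + scl k s" by simp
      ultimately show ?thesis by blast
    qed
    have "commuting_semisimple_subspace scl br ?V ?S"
      unfolding commuting_semisimple_subspace_def
    proof (intro conjI ballI)
      show "?S \<subseteq> ?V" using V S(2) sV by (intro span_minimal) auto
      show "semisimple_elem scl br u" if u: "u \<in> ?S" for u
        using mem[OF u] semisimple_elem_add[OF S(3) s(2) zs] by blast
      show "br u u' = 0" if u: "u \<in> ?S" "u' \<in> ?S" for u u'
        using mem[OF u(1)] mem[OF u(2)] sz zs S(4)
        by (auto simp: br_add_left br_add_right br_scl_left br_scl_right br_self)
    qed simp
    then have "?S = S" using max span_superset by (metis insert_subset)
    then have sS: "s \<in> S" using span_superset[of "insert s S"] by blast
    then have "v - s \<in> ?L" using v SL subspace_diff[OF L] by blast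
    then show ?thesis using sS s(3) by blast
  qed
  have NS: "killing n z = 0" if n: "n \<in> ?N" and z: "z \<in> S" for n z
  proof (rule killing_nilpotent_commute)
    show "ad_nilpotent br n" using n by blast
    show "br n z = 0" using x(2)[of n z] n z br_anti[of n z] by simp
  qed
  have SN: "killing z n = 0" if "n \<in> ?N" "z \<in> S" for n z using NS[OF that] by (simp add: killing_sym)
  have Lnd: "v = 0" if v: "v \<in> ?L" and z: "\<And>w. w \<in> ?L \<Longrightarrow> killing v w = 0" for v
  proof (rule killing_nondegenerate)
    fix w
    have "w \<in> span {w. \<exists>c. br x w = scl c w}" using S(3)[OF x(1)] by (simp add: semisimple_elem_def)
    then show "killing v w = 0"
    proof (induction rule: span_induct)
      case base
      show ?case by (rule subspaceI) (auto simp: killing_0_right killing_add_right killing_scl_right)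
    next
      case (step w)
      then obtain c where c: "br x w = scl c w" by blast
      have "killing (br x v) w = - (c * killing v w)" by (simp add: killing_inv c killing_scl_right)
      then have c0: "c = 0 \<or> killing v w = 0" using v by (simp add: killing_0_left)
      show ?case
      proof (rule ccontr)
        assume nz: "killing v w \<noteq> 0"
        then have xw: "br x w = 0" using c c0 by simp
        have xS: "\<sigma>1 x = - x" "\<sigma>2 x = - x" using x(1) S(2) by auto
        \<comment> \<open>Four times the projection of w to g11; as v lies in g11, its pairing with
          v is 4 B(v, w).\<close>
        let ?w = "w - \<sigma>1 w - \<sigma>2 w + \<sigma>1 (\<sigma>2 w)"
        have x1: "br x (\<sigma>1 w) = 0" if "br x w = 0" for w
          using that by (simp add: inv_br'[OF s1] xS br_neg_left i1)
        have x2: "br x (\<sigma>2 w) = 0" if "br x w = 0" for w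
          using that by (simp add: inv_br'[OF s2] xS br_neg_left i2)
        have "?w \<in> ?L"
          using xw x1 x2 by (simp add: br_add_right br_diff_right i1 i2 s12[symmetric])
        then have "killing v ?w = 0" by (rule z)
        moreover have "killing v (\<sigma>1 u) = - killing v u" "killing v (\<sigma>2 u) = - killing v u" for u
          using v by (simp_all add: killing_aut[OF s1, symmetric] killing_aut[OF s2, symmetric] killing_neg_left)
        ultimately have "4 * killing v w = 0" by (simp add: killing_add_right killing_diff_right)
        then show False using nz by simp
      qed
    qed
  qed
  have Nadd: "n + n' \<in> ?N" if n: "n \<in> ?N" "n' \<in> ?N" for n n'
  proof -
    have "n + n' \<in> ?L" using n subspace_add[OF L] by blast
    from jd[OF this] obtain s where s: "s \<in> S" "n + n' - s \<in> ?N" by blast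
    have sS: "killing s z = 0" if "z \<in> S" for z
      using NS[OF n(1) that] NS[OF n(2) that] NS[OF s(2) that]
      by (simp add: killing_add_left killing_diff_left)
    \<comment> \<open>The S-component of n + n' is orthogonal to S and to all nilpotent elements of
      L, hence to L.\<close>
    have "s = 0"
    proof (rule Lnd)
      show "s \<in> ?L" using s(1) SL by blast
      fix w assume "w \<in> ?L"
      from jd[OF this] obtain z where z: "z \<in> S" "w - z \<in> ?N" by blast
      have "killing s w = killing s z + killing s (w - z)" by (simp add: killing_diff_right)
      then show "killing s w = 0" using sS[OF z(1)] SN[OF z(2) s(1)] by simp
    qed
    then show ?thesis using s(2) by simp
  qed
  have NN: "killing n n' = 0" if n: "n \<in> ?N" "n' \<in> ?N" for n n'
  proof -
    have "killing (n + n') (n + n') = 0" "killing n n = 0" "killing n' n' = 0"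
      using Nadd[OF n] n killing_nilpotent_self by blast+
    then have "2 * killing n n' = 0"
      using killing_sym[of n' n] by (simp add: killing_add_left killing_add_right)
    then show ?thesis by simp
  qed
  have vL: "v \<in> ?L" using v by simp
  from jd[OF this] obtain s where s: "s \<in> S" "v - s \<in> ?N" by blast
  have "v - s = 0"
  proof (rule Lnd)
    show "v - s \<in> ?L" using s(2) by blast
    fix w assume "w \<in> ?L"
    from jd[OF this] obtain z where z: "z \<in> S" "w - z \<in> ?N" by blast
    have "killing (v - s) w = killing (v - s) z + killing (v - s) (w - z)" by (simp add: killing_diff_right)
    then show "killing (v - s) w = 0" using NS[OF s(2) z(1)] NN[OF s(2) z(2)] by simp
  qed
  then show ?thesis using s(1) by simp
qed

lemma cartan_subspace_extends:
  assumes s1: "inv_aut \<sigma>1" and s2: "inv_aut \<sigma>2" and s12: "\<And>v. \<sigma>1 (\<sigma>2 v) = \<sigma>2 (\<sigma>1 v)"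
    and \<phi>: "\<phi> \<in> inner_auts scl br" "\<And>v. \<sigma>2 (\<phi> v) = \<phi> (\<sigma>1 v)"
    and cs: "cartan_subspace scl br {v. \<sigma>1 v = - v \<and> \<sigma>2 v = - v} S"
  shows "cartan_subspace scl br {v. \<sigma>1 v = - v} S"
proof -
  let ?V = "{v. \<sigma>1 v = - v \<and> \<sigma>2 v = - v}"
  note i1 = inv_simps[OF s1] and i2 = inv_simps[OF s2]
  have css: "commuting_semisimple_subspace scl br ?V S" using cs by (simp add: cartan_subspace_def)
  obtain x where x: "x \<in> S" "\<And>v z. br x v = 0 \<Longrightarrow> z \<in> S \<Longrightarrow> br z v = 0"
    using generic_element[OF css] by metis
  have cent: "v \<in> S" if "br x v = 0" "\<sigma>1 v = - v" "\<sigma>2 v = - v" for v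
    by (rule cartan_subspace_centralizer[OF s1 s2 s12 cs x(1) _ that]) (rule x(2))
  have S: "S \<subseteq> ?V" "\<And>x. x \<in> S \<Longrightarrow> semisimple_elem scl br x"
    using css by (auto simp: commuting_semisimple_subspace_def)
  then have x12: "\<sigma>1 x = - x" "\<sigma>2 x = - x" using x(1) by auto
  have "T \<subseteq> S" if T: "commuting_semisimple_subspace scl br {v. \<sigma>1 v = - v} T" "S \<subseteq> T" for T
  proof
    fix z assume z: "z \<in> T"
    have T': "subspace T" "\<And>z. z \<in> T \<Longrightarrow> \<sigma>1 z = - z" "\<And>z. z \<in> T \<Longrightarrow> semisimple_elem scl br z"
      "\<And>y z. y \<in> T \<Longrightarrow> z \<in> T \<Longrightarrow> br y z = 0"
      using T(1) by (auto simp: commuting_semisimple_subspace_def)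
    have xT: "x \<in> T" using x(1) T(2) by blast
    have xz: "br x z = 0" using T'(4)[OF xT z] .
    \<comment> \<open>The components of z in g11 and g10. Both centralise x, because
      \<open>\<sigma>2\<close> negates x and so preserves its centraliser.\<close>
    let ?m = "scl (1/2) (z - \<sigma>2 z)" and ?y = "scl (1/2) (z + \<sigma>2 z)"
    have "br x (\<sigma>2 z) = 0" using xz by (simp add: inv_br'[OF s2] x12 br_neg_left i2)
    then have xm: "br x ?m = 0" and xy: "br x ?y = 0"
      using xz by (simp_all add: br_scl_right br_diff_right br_add_right)
    have z1: "\<sigma>1 z = - z" using T'(2)[OF z] .
    have m: "\<sigma>1 ?m = - ?m" "\<sigma>2 ?m = - ?m"
      using z1 by (simp_all add: i1 i2 s12 scale_right_diff_distrib)
    have y12: "\<sigma>1 ?y = - ?y" "\<sigma>2 ?y = ?y"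
      using z1 by (simp_all add: i1 i2 s12 scale_right_distrib add.commute)
    have mS: "?m \<in> S" by (rule cent[OF xm m])
    have "?m + ?y = scl (1/2) (z + z)"
      by (simp only: scale_right_distrib[symmetric]) simp
    also have "\<dots> = z" by (simp add: scale_right_distrib scale_left_distrib[symmetric])
    finally have zmy: "?m + ?y = z" .
    then have "?y = z - ?m" by (metis add_diff_cancel_left')
    \<comment> \<open>T is not assumed stable under \<open>\<sigma>2\<close>; \<open>?y\<close>
      belongs to it because \<open>?m\<close> is already in S.\<close>
    then have yT: "?y \<in> T" using subspace_diff[OF T'(1) z] mS T(2) by auto
    have "?y = 0"
    proof (rule fixed_part_zero[OF s1 s2 s12 \<phi> x12 S(2)[OF x(1)] y12 T'(3)[OF yT] xy])
      fix v assume "br x v = 0" "\<sigma>1 v = - v" "\<sigma>2 v = - v"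
      then have "v \<in> T" using cent T(2) by blast
      then show "br ?y v = 0" using T'(4)[OF yT] by blast
    qed
    then show "z \<in> S" using zmy mS by simp
  qed
  then show ?thesis
    using css unfolding cartan_subspace_def commuting_semisimple_subspace_def by blast
qed

end

lemma gij_sum_eigenspace:
  fixes scl :: "'k::field_char_0 \<Rightarrow> 'g::ab_group_add \<Rightarrow> 'g"
  assumes "involution scl br \<sigma>1" "involution scl br \<sigma>2" "\<sigma>1 \<circ> \<sigma>2 = \<sigma>2 \<circ> \<sigma>1" "vector_space scl"
  shows "{a + b | a b. a \<in> gij \<sigma>1 \<sigma>2 1 0 \<and> b \<in> gij \<sigma>1 \<sigma>2 1 1} = {v. \<sigma>1 v = - v}"
proof -
  interpret vector_space scl by fact
  have s: "\<sigma> (x + y) = \<sigma> x + \<sigma> y" "\<sigma> (scl k x) = scl k (\<sigma> x)" "\<sigma> (\<sigma> x) = x" "\<sigma> (- x) = - \<sigma> x"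
    if "involution scl br \<sigma>" for \<sigma> x y k
  proof -
    show l: "\<sigma> (scl k x) = scl k (\<sigma> x)" for k x using that by (simp add: involution_def lie_aut_def)
    show "\<sigma> (x + y) = \<sigma> x + \<sigma> y" using that by (simp add: involution_def lie_aut_def)
    show "\<sigma> (\<sigma> x) = x" using that by (simp add: involution_def fun_eq_iff)
    show "\<sigma> (- x) = - \<sigma> x" using l[of "-1" x] by simp
  qed
  note s1 = s[OF assms(1)] and s2 = s[OF assms(2)]
  have c: "\<sigma>1 (\<sigma>2 x) = \<sigma>2 (\<sigma>1 x)" for x using assms(3) by (simp add: fun_eq_iff)
  have "v \<in> {a + b | a b. a \<in> gij \<sigma>1 \<sigma>2 1 0 \<and> b \<in> gij \<sigma>1 \<sigma>2 1 1}" if v: "\<sigma>1 v = - v" for v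
  proof -
    let ?a = "scl (1/2) (v + \<sigma>2 v)" and ?b = "scl (1/2) (v + - \<sigma>2 v)"
    have "?a \<in> gij \<sigma>1 \<sigma>2 1 0" "?b \<in> gij \<sigma>1 \<sigma>2 1 1"
      using v by (simp_all add: gij_def s1(1,2,4) s2(1,2,4) s2(3) c add.commute scale_right_distrib
          del: add_uminus_conv_diff)
    moreover have "?a + ?b = v"
    proof -
      have "?a + ?b = scl (1/2) (v + v)" by (simp only: scale_right_distrib[symmetric]) simp
      then show ?thesis by (simp add: scale_right_distrib scale_left_distrib[symmetric])
    qed
    ultimately show ?thesis by (metis (mono_tags, lifting) mem_Collect_eq)
  qed
  moreover have "\<sigma>1 (a + b) = - (a + b)" if "a \<in> gij \<sigma>1 \<sigma>2 1 0" "b \<in> gij \<sigma>1 \<sigma>2 1 1" for a b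
    using that by (simp add: gij_def s1(1))
  ultimately show ?thesis by blast
qed

theorem theorem3p7:
  fixes scl :: "'k::field_char_0 \<Rightarrow> 'g::ab_group_add \<Rightarrow> 'g"
    and br :: "'g \<Rightarrow> 'g \<Rightarrow> 'g"
    and \<sigma>1 \<sigma>2 :: "'g \<Rightarrow> 'g"
    and c11 :: "'g set"
  assumes "alg_closed TYPE('k)"
    and "semisimple_lie_algebra scl br"
    and "dyad scl br \<sigma>1 \<sigma>2"
    and "cartan_subspace scl br (gij \<sigma>1 \<sigma>2 1 1) c11"
  shows "cartan_subspace scl br {a + b | a b. a \<in> gij \<sigma>1 \<sigma>2 1 0 \<and> b \<in> gij \<sigma>1 \<sigma>2 1 1} c11
       \<and> cartan_subspace scl br {a + b | a b. a \<in> gij \<sigma>1 \<sigma>2 0 1 \<and> b \<in> gij \<sigma>1 \<sigma>2 1 1} c11"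
proof -
  have L: "lie_algebra scl br" "finite_dim scl"
    and ss: "\<And>I. lie_ideal scl br I \<Longrightarrow> solvable scl br I \<Longrightarrow> I = {0}"
    using assms(2) by (auto simp: semisimple_lie_algebra_def)
  have vs: "vector_space scl" using L(1) by (simp add: lie_algebra_def)
  interpret vs: vector_space scl by fact
  obtain B0 where B0: "finite B0" "vs.span B0 = UNIV" using L(2) unfolding finite_dim_def by blast
  \<comment> \<open>The locale fixes a finite basis, so the finite spanning set is thinned to
    one.\<close>
  obtain B where B: "B \<subseteq> B0" "vs.independent B" "B0 \<subseteq> vs.span B"
    using vs.maximal_independent_subset by blast
  have "vs.span B0 \<subseteq> vs.span B" using B(3) vs.span_minimal vs.subspace_span by blast
  then have spB: "vs.span B = UNIV" using B0(2) by blast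
  interpret ss_lie scl B br
    using finite_subset[OF B(1) B0(1)] B(2) spB L(1) assms(1) ss
    by unfold_locales auto
  have inv: "involution scl br \<sigma>1" "involution scl br \<sigma>2" and comm: "\<sigma>1 \<circ> \<sigma>2 = \<sigma>2 \<circ> \<sigma>1"
    using assms(3) by (auto simp: dyad_def)
  have s: "inv_aut \<sigma>1" "inv_aut \<sigma>2"
    using inv by (auto simp: involution_def lie_aut_def inv_aut_def lin_def fun_eq_iff)
  have c: "\<sigma>1 (\<sigma>2 v) = \<sigma>2 (\<sigma>1 v)" for v using comm by (simp add: fun_eq_iff)
  obtain \<phi> where \<phi>: "\<phi> \<in> inner_auts scl br" "\<sigma>2 \<circ> \<phi> = \<phi> \<circ> \<sigma>1"
    using assms(3) by (auto simp: dyad_def conjugate_inv_def)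
  obtain \<psi> where \<psi>: "\<psi> \<in> inner_auts scl br" "\<psi> \<circ> \<phi> = id" "\<phi> \<circ> \<psi> = id"
    using inner_auts_inverse[OF \<phi>(1)] by blast
  have \<phi>': "\<sigma>2 (\<phi> v) = \<phi> (\<sigma>1 v)" for v using \<phi>(2) by (simp add: fun_eq_iff)
  have \<psi>': "\<sigma>1 (\<psi> v) = \<psi> (\<sigma>2 v)" for v
  proof -
    have "\<psi> (\<sigma>2 (\<phi> (\<psi> v))) = \<psi> (\<phi> (\<sigma>1 (\<psi> v)))" by (simp only: \<phi>')
    then show ?thesis using \<psi>(2,3) by (simp add: fun_eq_iff)
  qed
  have g11: "gij \<sigma>1 \<sigma>2 1 1 = {v. \<sigma>1 v = - v \<and> \<sigma>2 v = - v}" "gij \<sigma>1 \<sigma>2 1 1 = {v. \<sigma>2 v = - v \<and> \<sigma>1 v = - v}"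
    by (auto simp: gij_def)
  have swap: "gij \<sigma>1 \<sigma>2 0 1 = gij \<sigma>2 \<sigma>1 1 0" "gij \<sigma>1 \<sigma>2 1 1 = gij \<sigma>2 \<sigma>1 1 1"
    by (auto simp: gij_def)
  have e1: "{a + b | a b. a \<in> gij \<sigma>1 \<sigma>2 1 0 \<and> b \<in> gij \<sigma>1 \<sigma>2 1 1} = {v. \<sigma>1 v = - v}"
    by (rule gij_sum_eigenspace[OF inv comm vs])
  have e2: "{a + b | a b. a \<in> gij \<sigma>1 \<sigma>2 0 1 \<and> b \<in> gij \<sigma>1 \<sigma>2 1 1} = {v. \<sigma>2 v = - v}"
    unfolding swap by (rule gij_sum_eigenspace[OF inv(2,1) comm[symmetric] vs])
  show ?thesis
    unfolding e1 e2
    using cartan_subspace_extends[OF s c \<phi>(1) \<phi>' assms(4)[unfolded g11(1)]]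
      cartan_subspace_extends[OF s(2,1) c[symmetric] \<psi>(1) \<psi>' assms(4)[unfolded g11(2)]] by blast
qed

end
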